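(* Let $I$ be a homogeneous ideal of $R=k[x_1,\ldots,x_n]$ such that $A=R/I=\bigoplus_{i=0}^{t}A_i$ is a (nonzero) standard graded Artinian $k$-algebra, where $t=\max\{i \mid A_i\ne 0\}$. Then $A$ has the strong Stanley property if and only if for any $(\alpha_1,\ldots,\alpha_{n-1})\in J_{n-1}$, $$f_n(\alpha_1,\ldots,\alpha_{n-1})=t-2|\alpha|+1,$$ where $|\alpha|=\sum_{i=1}^{n-1}\alpha_i$.
   Context: $k$ is a field of characteristic $0$, $R=k[x_1,\ldots,x_n]$ with the standard grading, $n\ge 2$. $\mathrm{gin}(I)$ denotes the generic initial ideal of $I$ with respect to the reverse lexicographic order (with $x_1>\cdots>x_n$): $\mathrm{gin}(I)=\mathrm{in}(gI)$ for $g$ in a nonempty Zariski open subset of $GL_n(k)$. Strong Stanley property of $A=\bigoplus_{i=0}^t A_i$: there is a linear form $L\in R$ such that $\times L^{t-2i}:A_i\to A_{t-i}$ is bijective for each $i=0,1,\ldots,[t/2]$, where $[\cdot]$ is the integer part. Functions $f_i$: $f_1=\min\{s \mid x_1^s\in\mathrm{gin}(I)\}$, and for $2\le i\le n$ and $(\alpha_1,\ldots,\alpha_{i-1})\in\mathbb{Z}_{\ge 0}^{i-1}$, $f_i(\alpha_1,\ldots,\alpha_{i-1})=\min\{s\ge 0 \mid x_1^{\alpha_1}\cdots x_{i-1}^{\alpha_{i-1}}x_i^s\in\mathrm{gin}(I)\}$. For $1\le i\le n-1$, $J_i$ is the set of $(\alpha_1,\ldots,\alpha_i)\in\mathbb{Z}_{\ge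 0}^i$ such that $0\le\alpha_1<f_1$ and $0\le\alpha_j<f_j(\alpha_1,\ldots,\alpha_{j-1})$ for each $2\le j\le i$. *)

theory Defs
  imports
    "HOL-Library.Poly_Mapping"
    "HOL-Algebra.QuotRing"
    "Jordan_Normal_Form.Matrix"
begin

text \<open>
  A monomial is a finitely supported exponent vector and a polynomial is a finitely supported
  family of coefficients. The variables \<open>x\<^sub>1, \<dots>, x\<^sub>n\<close> of \<open>k[x\<^sub>1, \<dots>, x\<^sub>n]\<close> are indexed by
  \<open>0, \<dots>, n - 1\<close>.
\<close>

type_synonym ('x, 'k) mpoly = "('x \<Rightarrow>\<^sub>0 nat) \<Rightarrow>\<^sub>0 'k"

definition mpolys_in :: "'x set \<Rightarrow> ('x, 'k::zero) mpoly set" where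
  "mpolys_in X = {p. \<forall>m\<in>Poly_Mapping.keys p. Poly_Mapping.keys m \<subseteq> X}"

definition poly_ring :: "nat \<Rightarrow> (nat, 'k::field) mpoly ring" where
  "poly_ring n = \<lparr>carrier = mpolys_in {..<n}, monoid.mult = (*), one = 1, zero = 0, add = (+)\<rparr>"

definition monom_deg :: "('x \<Rightarrow>\<^sub>0 nat) \<Rightarrow> nat" where
  "monom_deg m = (\<Sum>i\<in>Poly_Mapping.keys m. Poly_Mapping.lookup m i)"

text \<open>The homogeneous part \<open>R\<^sub>d\<close>; in particular \<open>forms n 1\<close> is the set of linear forms.\<close>

definition forms :: "nat \<Rightarrow> nat \<Rightarrow> (nat, 'k::field) mpoly set" where
  "forms n d = {p \<in> carrier (poly_ring n). \<forall>m\<in>Poly_Mapping.keys p. monom_deg m = d}"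

definition homogeneous_ideal :: "nat \<Rightarrow> (nat, 'k::field) mpoly set \<Rightarrow> bool" where
  "homogeneous_ideal n I \<longleftrightarrow> ideal I (poly_ring n) \<and>
     (\<exists>S. S \<subseteq> (\<Union>d. forms n d) \<and> I = genideal (poly_ring n) S)"

definition quot_alg :: "nat \<Rightarrow> (nat, 'k::field) mpoly set \<Rightarrow> (nat, 'k) mpoly set ring" where
  "quot_alg n I = poly_ring n Quot I"

definition artinian :: "('a, 'b) ring_scheme \<Rightarrow> bool" where
  "artinian A \<longleftrightarrow>
     (\<forall>J. (\<forall>i::nat. ideal (J i) A) \<and> (\<forall>i. J (Suc i) \<subseteq> J i) \<longrightarrow> (\<exists>N. \<forall>i\<ge>N. J i = J N))"

definition quot_class ::
  "nat \<Rightarrow> (nat, 'k::field) mpoly set \<Rightarrow> (nat, 'k) mpoly \<Rightarrow> (nat, 'k) mpoly set" where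
  "quot_class n I p = I +>\<^bsub>poly_ring n\<^esub> p"

text \<open>The graded piece \<open>A\<^sub>d\<close> is the image of \<open>R\<^sub>d\<close> in \<open>A = R/I\<close>.\<close>

definition quot_part ::
  "nat \<Rightarrow> (nat, 'k::field) mpoly set \<Rightarrow> nat \<Rightarrow> (nat, 'k) mpoly set set" where
  "quot_part n I d = quot_class n I ` forms n d"

text \<open>Only meaningful when \<open>A\<close> is nonzero and Artinian, so that the set is finite and nonempty.\<close>

definition top_degree :: "nat \<Rightarrow> (nat, 'k::field) mpoly set \<Rightarrow> nat" where
  "top_degree n I = Max {d. quot_part n I d \<noteq> {\<zero>\<^bsub>quot_alg n I\<^esub>}}"

definition strong_stanley :: "nat \<Rightarrow> (nat, 'k::field) mpoly set \<Rightarrow> bool" where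
  "strong_stanley n I \<longleftrightarrow>
     (let t = top_degree n I; A = quot_alg n I in
      \<exists>L\<in>forms n 1. \<forall>i\<le>t div 2.
        bij_betw (\<lambda>a. (quot_class n I L [^]\<^bsub>A\<^esub> (t - 2 * i)) \<otimes>\<^bsub>A\<^esub> a)
          (quot_part n I i) (quot_part n I (t - i)))"

text \<open>
  The order with \<open>x\<^sub>1 > \<dots> > x\<^sub>n\<close>: in equal degrees, the monomial with the larger exponent
  at the last position of disagreement is the smaller one.
\<close>

definition revlex_less :: "(nat \<Rightarrow>\<^sub>0 nat) \<Rightarrow> (nat \<Rightarrow>\<^sub>0 nat) \<Rightarrow> bool" where
  "revlex_less m m' \<longleftrightarrow> monom_deg m < monom_deg m' \<or>
     (monom_deg m = monom_deg m' \<and>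
      (\<exists>i. Poly_Mapping.lookup m' i < Poly_Mapping.lookup m i \<and>
           (\<forall>j>i. Poly_Mapping.lookup m j = Poly_Mapping.lookup m' j)))"

definition monomial :: "('x \<Rightarrow>\<^sub>0 nat) \<Rightarrow> ('x, 'k::{zero,one}) mpoly" where
  "monomial m = Poly_Mapping.single m 1"

definition lead_monom :: "(nat, 'k::zero) mpoly \<Rightarrow> (nat \<Rightarrow>\<^sub>0 nat)" where
  "lead_monom p = (THE m. m \<in> Poly_Mapping.keys p \<and>
     (\<forall>m'\<in>Poly_Mapping.keys p. m' \<noteq> m \<longrightarrow> revlex_less m' m))"

definition initial_ideal :: "nat \<Rightarrow> (nat, 'k::field) mpoly set \<Rightarrow> (nat, 'k) mpoly set" where
  "initial_ideal n I =
     genideal (poly_ring n) ((\<lambda>p. monomial (lead_monom p)) ` (I - {0}))"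

text \<open>Apply \<open>c\<close> to the coefficients and substitute \<open>\<phi> i\<close> for the \<open>i\<close>-th variable.\<close>

definition subst_poly ::
  "('k::zero \<Rightarrow> 'b::comm_ring_1) \<Rightarrow> ('x \<Rightarrow> 'b) \<Rightarrow> ('x, 'k) mpoly \<Rightarrow> 'b" where
  "subst_poly c \<phi> p = (\<Sum>m\<in>Poly_Mapping.keys p.
     c (Poly_Mapping.lookup p m) * (\<Prod>i\<in>Poly_Mapping.keys m. \<phi> i ^ Poly_Mapping.lookup m i))"

definition GL :: "nat \<Rightarrow> 'k::field mat set" where
  "GL n = {g \<in> carrier_mat n n. invertible_mat g}"

text \<open>\<open>g\<close> acts by the \<open>k\<close>-algebra map with \<open>x\<^sub>j \<mapsto> \<Sum>\<^sub>i g\<^sub>i\<^sub>j x\<^sub>i\<close>.\<close>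

definition mat_act :: "nat \<Rightarrow> 'k::field mat \<Rightarrow> (nat, 'k) mpoly \<Rightarrow> (nat, 'k) mpoly" where
  "mat_act n g = subst_poly (Poly_Mapping.single 0)
     (\<lambda>j. \<Sum>i<n. Poly_Mapping.single (Poly_Mapping.single i 1) (g $$ (i, j)))"

text \<open>
  Open subsets of \<open>GL\<^sub>n(k)\<close> are the complements of the zero loci of sets of polynomials in
  the \<open>n\<^sup>2\<close> matrix entries.
\<close>

definition zariski_open_GL :: "nat \<Rightarrow> 'k::field mat set \<Rightarrow> bool" where
  "zariski_open_GL n U \<longleftrightarrow>
     (\<exists>P \<subseteq> mpolys_in ({..<n} \<times> {..<n}).
        U = {g \<in> GL n. \<exists>p\<in>P. subst_poly id (\<lambda>ij. g $$ ij) p \<noteq> 0})"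

definition gin :: "nat \<Rightarrow> (nat, 'k::field) mpoly set \<Rightarrow> (nat, 'k) mpoly set" where
  "gin n I = (THE M. \<exists>U. zariski_open_GL n U \<and> U \<noteq> {} \<and>
     (\<forall>g\<in>U. initial_ideal n (mat_act n g ` I) = M))"

text \<open>
  A tuple \<open>(\<alpha>\<^sub>1, \<dots>, \<alpha>\<^sub>i)\<close> is a list of length \<open>i\<close>, and \<open>Poly_Mapping.nth \<alpha>\<close> is the exponent
  vector of \<open>x\<^sub>1\<^bsup>\<alpha>\<^sub>1\<^esup> \<dots> x\<^sub>i\<^bsup>\<alpha>\<^sub>i\<^esup>\<close>. The value \<open>f\<^sub>i(\<alpha>\<^sub>1, \<dots>, \<alpha>\<^sub>i\<^sub>-\<^sub>1)\<close> is
  \<open>gin_min_exp n I [\<alpha>\<^sub>1, \<dots>, \<alpha>\<^sub>i\<^sub>-\<^sub>1]\<close>, the index \<open>i\<close> being the length of the list plus one;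
  \<open>f\<^sub>1\<close> is the value at the empty list.
\<close>

definition gin_min_exp :: "nat \<Rightarrow> (nat, 'k::field) mpoly set \<Rightarrow> nat list \<Rightarrow> nat" where
  "gin_min_exp n I \<alpha> = (LEAST s. monomial (Poly_Mapping.nth (\<alpha> @ [s])) \<in> gin n I)"

definition gin_index_set :: "nat \<Rightarrow> (nat, 'k::field) mpoly set \<Rightarrow> nat \<Rightarrow> nat list set" where
  "gin_index_set n I i =
     {\<alpha>. length \<alpha> = i \<and> (\<forall>j<i. \<alpha> ! j < gin_min_exp n I (take j \<alpha>))}"

end

theory Submission
  imports Defs "Jordan_Normal_Form.Determinant"
begin

text \<open>
  Let \<open>E\<close> be the set of monomials in \<open>in(g I)\<close>, that is, of leading monomials of \<open>g I\<close>, for an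
  invertible matrix \<open>g\<close>. In the reverse lexicographic order, a form is divisible by \<open>x\<^sub>n\<^sup>s\<close> as soon as its
  leading monomial is. Therefore multiplication by \<open>x\<^sub>n\<^sup>s\<close> from degree \<open>i\<close> to degree \<open>i + s\<close> of \<open>R/gI\<close>
  is bijective iff the same holds modulo the initial ideal, which is a condition on \<open>E\<close> alone: it
  sends the monomials outside \<open>E\<close> of degree \<open>i\<close> onto those of degree \<open>i + s\<close> (lemma
  \<open>mult_bijective_last_var_iff\<close>).

  The action of \<open>g\<close> identifies multiplication by \<open>x\<^sub>n\<close> on \<open>R/gI\<close> with multiplication by the linear form
  \<open>g\<^bsup>-1\<^esup> x\<^sub>n\<close> on \<open>R/I\<close>. So if a generic \<open>g\<close> satisfies the condition for \<open>s = t - 2 i\<close> and all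
  \<open>i \<le> t div 2\<close>, then \<open>R/I\<close> has the strong Stanley property. Conversely, let \<open>L\<close> be a linear form as in
  the strong Stanley property. Some matrix \<open>a\<close> moves \<open>L\<close> to \<open>x\<^sub>n\<close>
  (\<open>move_linear_form_to_last_var\<close>), so the condition holds for \<open>a\<close>, and it has to be carried over to a
  generic matrix. This is a matter of counting: in every degree the leading monomials of \<open>g I\<close> and
  \<open>a I\<close> are equally many, while in an initial segment of the order a generic \<open>g\<close> has the fewest
  leading monomials (\<open>lead_monoms_semicontinuous\<close>, \<open>gin_minimizes_downset_counts\<close>). The monomials divisible by
  \<open>x\<^sub>n\<^sup>s\<close> are the smallest ones of their degree, and the resulting inequality forces the condition for \<open>g\<close>
  (\<open>last_var_bijective_transfer\<close>). The same semicontinuity shows that the generic initial ideal exists, by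
  choosing a matrix that minimizes all the counts together (\<open>gin_generic\<close>).

  It remains to evaluate the condition. The monomials outside \<open>E\<close> form strings
  \<open>x\<^sup>\<alpha>, x\<^sup>\<alpha> x\<^sub>n, \<dots>\<close> occupying the degrees from \<open>\<bar>\<alpha>\<bar>\<close> to \<open>\<bar>\<alpha>\<bar> + f\<^sub>n(\<alpha>) - 1\<close>, one for each
  \<open>\<alpha>\<close> in the index set, and multiplication by \<open>x\<^sub>n\<close> moves along them. The powers of \<open>x\<^sub>n\<close> are bijective
  between the degrees \<open>i\<close> and \<open>t - i\<close> iff every string is symmetric about \<open>t/2\<close>, that is,
  \<open>2 \<bar>\<alpha>\<bar> + f\<^sub>n(\<alpha>) - 1 = t\<close> (\<open>last_var_bijective_iff_symmetric_strings\<close>).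
\<close>

abbreviation "lookup \<equiv> Poly_Mapping.lookup"
abbreviation "keys \<equiv> Poly_Mapping.keys"
abbreviation "single \<equiv> Poly_Mapping.single"

section \<open>Monomials and the reverse lexicographic order\<close>

lemma monom_deg_eq_sum:
  assumes "finite A" "keys m \<subseteq> A"
  shows "monom_deg m = (\<Sum>i\<in>A. lookup m i)"
  unfolding monom_deg_def
  by (rule sum.mono_neutral_left) (use assms in \<open>auto simp: in_keys_iff\<close>)

lemma keys_add_nat: "keys (m + k :: 'x \<Rightarrow>\<^sub>0 nat) = keys m \<union> keys k"
  by (auto simp: in_keys_iff lookup_add)

lemma monom_deg_add: "monom_deg (m + k) = monom_deg m + monom_deg k"
proof -
  have "finite (keys m \<union> keys k)"
    by simp
  then show ?thesis
    by (simp add: monom_deg_eq_sum[of "keys m \<union> keys k"] keys_add_nat lookup_add sum.distrib)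
qed

lemma monom_deg_zero [simp]: "monom_deg 0 = 0"
  by (simp add: monom_deg_def)

lemma monom_deg_single [simp]: "monom_deg (single i s) = s"
  by (cases "s = 0") (auto simp: monom_deg_def)

lemma lookup_le_monom_deg: "lookup m i \<le> monom_deg m"
proof (cases "i \<in> keys m")
  case True
  then show ?thesis
    unfolding monom_deg_def by (intro member_le_sum) auto
qed (simp add: in_keys_iff)

lemma monom_deg_eq_0_iff: "monom_deg m = 0 \<longleftrightarrow> m = 0"
proof
  assume "monom_deg m = 0"
  then have "lookup m i = 0" for i
    using lookup_le_monom_deg[of m i] by simp
  then show "m = 0"
    by (intro poly_mapping_eqI) simp
qed simp

lemma monom_split_nat:
  fixes m k :: "'x \<Rightarrow>\<^sub>0 nat"
  assumes "\<And>i. lookup k i \<le> lookup m i"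
  obtains l where "m = l + k"
proof
  show "m = (m - k) + k"
    by (rule poly_mapping_eqI) (simp add: lookup_add lookup_minus assms)
qed

definition monoms :: "nat \<Rightarrow> nat \<Rightarrow> (nat \<Rightarrow>\<^sub>0 nat) set" where
  "monoms n d = {m. keys m \<subseteq> {..<n} \<and> monom_deg m = d}"

lemma finite_bounded_monoms:
  fixes A :: "'x set"
  assumes "finite A"
  shows "finite {m :: 'x \<Rightarrow>\<^sub>0 nat. keys m \<subseteq> A \<and> monom_deg m \<le> d}" (is "finite ?M")
proof (rule finite_imageD)
  have "(\<lambda>m. restrict (lookup m) A) ` ?M \<subseteq> PiE A (\<lambda>_. {..d})"
    using lookup_le_monom_deg le_trans by fastforce
  then show "finite ((\<lambda>m. restrict (lookup m) A) ` ?M)"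
    by (rule finite_subset) (simp add: assms finite_PiE)
  show "inj_on (\<lambda>m. restrict (lookup m) A) ?M"
  proof (rule inj_onI, rule poly_mapping_eqI)
    fix m k i
    assume *: "m \<in> ?M" "k \<in> ?M" "restrict (lookup m) A = restrict (lookup k) A"
    show "lookup m i = lookup k i"
    proof (cases "i \<in> A")
      case True
      then show ?thesis using *(3) by (metis restrict_apply')
    next
      case False
      then have "i \<notin> keys m" "i \<notin> keys k" using * by auto
      then show ?thesis by (simp add: in_keys_iff)
    qed
  qed
qed

lemma finite_monoms [simp]: "finite (monoms n d)"
  by (rule finite_subset[OF _ finite_bounded_monoms[of "{..<n}" d]]) (auto simp: monoms_def)

lemma monoms_add: "m \<in> monoms n d \<Longrightarrow> k \<in> monoms n e \<Longrightarrow> m + k \<in> monoms n (d + e)"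
  by (simp add: monoms_def keys_add_nat monom_deg_add)

lemma revlex_less_irrefl [simp]: "\<not> revlex_less m m"
  by (simp add: revlex_less_def)

lemma revlex_less_trans:
  assumes "revlex_less a b" "revlex_less b c"
  shows "revlex_less a c"
proof (cases "monom_deg a = monom_deg b \<and> monom_deg b = monom_deg c")
  case True
  then obtain i j where i: "lookup b i < lookup a i" "\<And>l. l > i \<Longrightarrow> lookup a l = lookup b l"
    and j: "lookup c j < lookup b j" "\<And>l. l > j \<Longrightarrow> lookup b l = lookup c l"
    using assms unfolding revlex_less_def by auto
  have "lookup c (max i j) < lookup a (max i j)"
    using i j by (cases i j rule: linorder_cases) (auto simp: max_def)
  moreover have "\<forall>l > max i j. lookup a l = lookup c l"
    using i j by simp
  ultimately show ?thesis
    using True unfolding revlex_less_def by auto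
next
  case False
  then show ?thesis
    using assms unfolding revlex_less_def by auto
qed

lemma revlex_less_linear: "revlex_less a b \<or> a = b \<or> revlex_less b a"
proof (cases "a = b \<or> monom_deg a \<noteq> monom_deg b")
  case False
  define D where "D = {i. lookup a i \<noteq> lookup b i}"
  have "D \<subseteq> keys a \<union> keys b"
    by (auto simp: D_def in_keys_iff)
  then have fin: "finite D"
    by (rule finite_subset) simp
  have ne: "D \<noteq> {}"
    using False by (auto simp: D_def intro: poly_mapping_eqI)
  have "lookup a (Max D) \<noteq> lookup b (Max D)"
    using Max_in[OF fin ne] by (simp add: D_def)
  moreover have "\<forall>j > Max D. lookup a j = lookup b j"
    using Max_ge[OF fin] by (force simp: D_def)
  ultimately show ?thesis
    using False unfolding revlex_less_def by (metis linorder_neqE_nat)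
qed (auto simp: revlex_less_def)

lemma revlex_less_asym: "revlex_less a b \<Longrightarrow> \<not> revlex_less b a"
  using revlex_less_trans revlex_less_irrefl by blast

lemma revlex_less_add_left: "revlex_less (k + a) (k + b) \<longleftrightarrow> revlex_less a b"
  by (simp add: revlex_less_def monom_deg_add lookup_add)

lemma finite_revlex_greatest:
  assumes "finite A" "A \<noteq> {}"
  shows "\<exists>m\<in>A. \<forall>k\<in>A. k \<noteq> m \<longrightarrow> revlex_less k m"
  using assms
proof (induction A rule: finite_ne_induct)
  case (insert x F)
  then obtain m where "m \<in> F" "\<forall>k\<in>F. k \<noteq> m \<longrightarrow> revlex_less k m"
    by blast
  then show ?case
    using revlex_less_linear[of x m] revlex_less_trans by (metis insert_iff)
qed simp

text \<open>The characteristic property of the reverse lexicographic order: in a fixed degree it compares the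
  exponents at the last variable first, and the smaller exponent belongs to the greater monomial.\<close>

lemma revlex_less_last_exponent:
  assumes "m \<in> monoms n d" "k \<in> monoms n d" "lookup k (n - 1) < lookup m (n - 1)"
  shows "revlex_less m k"
proof -
  have "lookup m j = lookup k j" if "j > n - 1" for j
  proof -
    have "j \<notin> keys m" "j \<notin> keys k"
      using assms that by (auto simp: monoms_def)
    then show ?thesis by (simp add: in_keys_iff)
  qed
  then show ?thesis
    using assms unfolding revlex_less_def monoms_def by auto
qed

section \<open>Leading monomials\<close>

lemma lead_monom_props:
  assumes "p \<noteq> 0"
  shows "lead_monom p \<in> keys p"
    and "\<And>m. m \<in> keys p \<Longrightarrow> m \<noteq> lead_monom p \<Longrightarrow> revlex_less m (lead_monom p)"
proof -
  have "\<exists>!m. m \<in> keys p \<and> (\<forall>k\<in>keys p. k \<noteq> m \<longrightarrow> revlex_less k m)"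
  proof -
    obtain m where m: "m \<in> keys p" "\<forall>k\<in>keys p. k \<noteq> m \<longrightarrow> revlex_less k m"
      using finite_revlex_greatest[of "keys p"] assms by auto
    show ?thesis
    proof (rule ex1I[of _ m])
      fix k
      assume k: "k \<in> keys p \<and> (\<forall>l\<in>keys p. l \<noteq> k \<longrightarrow> revlex_less l k)"
      show "k = m"
      proof (rule ccontr)
        assume "k \<noteq> m"
        then have "revlex_less k m" "revlex_less m k"
          using k m by simp_all
        then show False
          using revlex_less_asym by simp
      qed
    qed (use m in simp)
  qed
  from theI'[OF this] show "lead_monom p \<in> keys p"
    "\<And>m. m \<in> keys p \<Longrightarrow> m \<noteq> lead_monom p \<Longrightarrow> revlex_less m (lead_monom p)"
    unfolding lead_monom_def by blast+
qed

lemma lead_monom_eqI: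
  assumes "m \<in> keys p" "\<And>k. k \<in> keys p \<Longrightarrow> k \<noteq> m \<Longrightarrow> revlex_less k m"
  shows "lead_monom p = m"
proof -
  have "p \<noteq> 0"
    using assms(1) by auto
  then show ?thesis
    using lead_monom_props[of p] assms(1) assms(2)[of "lead_monom p"] revlex_less_asym[of m "lead_monom p"]
    by blast
qed

definition lead_monoms :: "(nat, 'k::zero) mpoly set \<Rightarrow> (nat \<Rightarrow>\<^sub>0 nat) set" where
  "lead_monoms J = lead_monom ` (J - {0})"

lemma lead_monomsE:
  assumes "m \<in> lead_monoms J"
  obtains p where "p \<in> J" "p \<noteq> 0" "lead_monom p = m" "m \<in> keys p"
    "\<And>k. k \<in> keys p \<Longrightarrow> k \<noteq> m \<Longrightarrow> revlex_less k m"
  using assms lead_monom_props unfolding lead_monoms_def by blast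

lemma lead_monomsI:
  assumes "p \<in> J" "m \<in> keys p" "\<And>k. k \<in> keys p \<Longrightarrow> k \<noteq> m \<Longrightarrow> revlex_less k m"
  shows "m \<in> lead_monoms J"
proof -
  have "p \<noteq> 0" using assms(2) by auto
  then show ?thesis
    using assms lead_monom_eqI[of m p] unfolding lead_monoms_def by blast
qed

lemma lead_monom_in_lead_monoms: "p \<in> J \<Longrightarrow> p \<noteq> 0 \<Longrightarrow> lead_monom p \<in> lead_monoms J"
  by (simp add: lead_monoms_def)

lemma lead_monoms_subset_keys: "lead_monoms J \<subseteq> (\<Union>p\<in>J. keys p)"
  using lead_monom_props(1) by (fastforce simp: lead_monoms_def)

section \<open>Polynomials as families of coefficients\<close>

lemma poly_expand:
  assumes "finite A" "keys p \<subseteq> A"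
  shows "p = (\<Sum>m\<in>A. single m (lookup p m))"
proof (rule poly_mapping_eqI)
  fix k
  have "lookup (\<Sum>m\<in>A. single m (lookup p m)) k = (\<Sum>m\<in>A. if m = k then lookup p k else 0)"
    unfolding lookup_sum by (rule sum.cong) (auto simp: lookup_single)
  also have "\<dots> = lookup p k"
    using assms by (auto simp: in_keys_iff)
  finally show "lookup p k = lookup (\<Sum>m\<in>A. single m (lookup p m)) k" ..
qed

lemma single_sum: "single m (sum f A) = (\<Sum>i\<in>A. single m (f i))"
  by (induction A rule: infinite_finite_induct) (simp_all add: single_add)

text \<open>The convolution runs over all pairs with sum \<open>m\<close>, not over the supports of the factors. As the
  index set does not depend on \<open>p\<close> and \<open>q\<close>, the formula shows that the coefficients of a product
  are polynomial in the coefficients of the factors.\<close>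

lemma lookup_times:
  fixes p q :: "('x, 'k::comm_ring_1) mpoly"
  shows "lookup (p * q) m = (\<Sum>(a, b) \<in> {(a, b). a + b = m}. lookup p a * lookup q b)"
    and finite_antidiagonal: "finite {(a, b :: 'x \<Rightarrow>\<^sub>0 nat). a + b = m}"
proof -
  let ?D = "{(a, b :: 'x \<Rightarrow>\<^sub>0 nat). a + b = m}"
  let ?B = "{k :: 'x \<Rightarrow>\<^sub>0 nat. keys k \<subseteq> keys m \<and> monom_deg k \<le> monom_deg m}"
  have "?D \<subseteq> ?B \<times> ?B"
    by (auto simp: keys_add_nat monom_deg_add)
  then show fin: "finite ?D"
    by (rule finite_subset) (simp add: finite_bounded_monoms)
  have "p * q = (\<Sum>a\<in>keys p. single a (lookup p a)) * (\<Sum>b\<in>keys q. single b (lookup q b))"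
    using poly_expand[of "keys p" p] poly_expand[of "keys q" q] by simp
  also have "\<dots> = (\<Sum>(a, b)\<in>keys p \<times> keys q. single (a + b) (lookup p a * lookup q b))"
    by (simp add: sum_product sum.cartesian_product mult_single)
  finally have "lookup (p * q) m =
      (\<Sum>(a, b)\<in>keys p \<times> keys q. if (a, b) \<in> ?D then lookup p a * lookup q b else 0)"
    by (simp add: lookup_sum lookup_single when_def split_def)
  also have "\<dots> = (\<Sum>(a, b)\<in>(keys p \<times> keys q) \<inter> ?D. lookup p a * lookup q b)"
    by (subst sum.inter_restrict) (auto intro!: sum.cong)
  also have "\<dots> = (\<Sum>(a, b)\<in>?D. lookup p a * lookup q b)"
    by (rule sum.mono_neutral_left[OF fin]) (auto simp: in_keys_iff)
  finally show "lookup (p * q) m = (\<Sum>(a, b)\<in>?D. lookup p a * lookup q b)" .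
qed

lemma lookup_single_mult_add:
  fixes p :: "('x, 'k::comm_ring_1) mpoly"
  shows "lookup (single m c * p) (m + k) = c * lookup p k"
proof -
  have "lookup (single m c * p) (m + k) =
      (\<Sum>(a, b)\<in>{(m, k)}. lookup (single m c) a * lookup p b)"
    unfolding lookup_times
    by (rule sum.mono_neutral_right[OF finite_antidiagonal]) (auto simp: lookup_single when_def split: if_splits)
  then show ?thesis by simp
qed

lemma lookup_const_mult [simp]:
  fixes p :: "('x, 'k::comm_ring_1) mpoly"
  shows "lookup (single 0 c * p) k = c * lookup p k"
  using lookup_single_mult_add[of 0 c p k] by simp

lemma keys_single_mult:
  fixes p :: "('x, 'k::field) mpoly"
  assumes "c \<noteq> 0"
  shows "keys (single m c * p) = (+) m ` keys p"
proof
  show "keys (single m c * p) \<subseteq> (+) m ` keys p"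
    using keys_mult[of "single m c" p] by (auto split: if_splits)
  show "(+) m ` keys p \<subseteq> keys (single m c * p)"
    using assms by (auto simp: in_keys_iff lookup_single_mult_add)
qed

lemma lead_monom_single_mult:
  fixes p :: "(nat, 'k::field) mpoly"
  assumes "c \<noteq> 0" "p \<noteq> 0"
  shows "lead_monom (single m c * p) = m + lead_monom p"
  using lead_monom_props[OF assms(2)] assms(1)
  by (intro lead_monom_eqI) (auto simp: keys_single_mult revlex_less_add_left)

lemma mpolys_in_add: "p \<in> mpolys_in X \<Longrightarrow> q \<in> mpolys_in X \<Longrightarrow> p + q \<in> mpolys_in X"
  using keys_add[of p q] by (auto simp: mpolys_in_def)

lemma mpolys_in_mult:
  fixes p q :: "('x, 'k::comm_ring_1) mpoly"
  shows "p \<in> mpolys_in X \<Longrightarrow> q \<in> mpolys_in X \<Longrightarrow> p * q \<in> mpolys_in X"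
  using keys_mult[of p q] by (fastforce simp: mpolys_in_def keys_add_nat)

lemma mpolys_in_0 [simp]: "0 \<in> mpolys_in X"
  by (simp add: mpolys_in_def)

lemma mpolys_in_single: "keys m \<subseteq> X \<Longrightarrow> single m c \<in> mpolys_in X"
  by (auto simp: mpolys_in_def)

lemma mpolys_in_const [simp]: "single 0 c \<in> mpolys_in X"
  by (rule mpolys_in_single) simp

lemma mpolys_in_1 [simp]: "1 \<in> mpolys_in X"
  by (simp add: mpolys_in_def)

lemma mpolys_in_uminus: "p \<in> mpolys_in X \<Longrightarrow> - p \<in> mpolys_in X"
  for p :: "('x, 'k::comm_ring_1) mpoly"
  by (auto simp: mpolys_in_def in_keys_iff)

lemma mpolys_in_sum: "(\<And>i. i \<in> A \<Longrightarrow> f i \<in> mpolys_in X) \<Longrightarrow> sum f A \<in> mpolys_in X"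
  by (induction A rule: infinite_finite_induct) (auto intro: mpolys_in_add)

lemma mpolys_in_power:
  fixes p :: "('x, 'k::comm_ring_1) mpoly"
  shows "p \<in> mpolys_in X \<Longrightarrow> p ^ e \<in> mpolys_in X"
  by (induction e) (auto intro: mpolys_in_mult)

lemma poly_ring_simps [simp]:
  "carrier (poly_ring n) = mpolys_in {..<n}"
  "p \<otimes>\<^bsub>poly_ring n\<^esub> q = p * q"
  "\<one>\<^bsub>poly_ring n\<^esub> = 1"
  "\<zero>\<^bsub>poly_ring n\<^esub> = 0"
  "p \<oplus>\<^bsub>poly_ring n\<^esub> q = p + q"
  by (simp_all add: poly_ring_def)

lemma cring_poly_ring: "cring (poly_ring n :: (nat, 'k::field) mpoly ring)"
proof (rule cringI)
  show "abelian_group (poly_ring n :: (nat, 'k) mpoly ring)"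
  proof (rule abelian_groupI)
    fix p :: "(nat, 'k) mpoly"
    assume "p \<in> carrier (poly_ring n)"
    then show "\<exists>q\<in>carrier (poly_ring n). q \<oplus>\<^bsub>poly_ring n\<^esub> p = \<zero>\<^bsub>poly_ring n\<^esub>"
      by (intro bexI[of _ "- p"]) (auto intro: mpolys_in_uminus)
  qed (auto intro: mpolys_in_add simp: algebra_simps)
  show "comm_monoid (poly_ring n :: (nat, 'k) mpoly ring)"
    by (rule comm_monoidI) (auto intro: mpolys_in_mult simp: algebra_simps)
qed (simp add: algebra_simps)

text \<open>Additive inverses come for free, since \<open>- p = (- 1) p\<close>.\<close>

lemma ideal_poly_ring_iff:
  fixes J :: "(nat, 'k::field) mpoly set"
  shows "ideal J (poly_ring n) \<longleftrightarrow> J \<subseteq> mpolys_in {..<n} \<and> 0 \<in> J \<and>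
    (\<forall>p\<in>J. \<forall>q\<in>J. p + q \<in> J) \<and> (\<forall>p\<in>J. \<forall>q\<in>mpolys_in {..<n}. q * p \<in> J)"
    (is "?l \<longleftrightarrow> ?r")
proof
  interpret cring "poly_ring n :: (nat, 'k) mpoly ring"
    by (rule cring_poly_ring)
  {
    assume ?l
    then interpret ideal J "poly_ring n" .
    show ?r
      using a_subset additive_subgroup.zero_closed[OF is_additive_subgroup]
        additive_subgroup.a_closed[OF is_additive_subgroup] I_l_closed
      by simp
  }
  assume r: ?r
  have neg: "- p \<in> J" if "p \<in> J" for p
  proof -
    have "single 0 (- 1) * p \<in> J"
      using r that by simp
    then show ?thesis
      by (simp add: single_uminus)
  qed
  have inv: "\<ominus>\<^bsub>poly_ring n\<^esub> p = - p" if "p \<in> J" for p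
    using r that neg[OF that] by (intro minus_equality) auto
  show ?l
  proof (rule idealI)
    show "ring (poly_ring n :: (nat, 'k) mpoly ring)"
      by (rule ring_axioms)
    show "subgroup J (add_monoid (poly_ring n))"
    proof (rule add.subgroupI)
      show "J \<noteq> {}" using r by blast
    qed (use r neg inv in auto)
  qed (use r in \<open>auto simp: mult.commute\<close>)
qed

lemma ideal_poly_ringD:
  assumes "ideal J (poly_ring n)"
  shows "p \<in> J \<Longrightarrow> p \<in> mpolys_in {..<n}" "0 \<in> J" "p \<in> J \<Longrightarrow> q \<in> J \<Longrightarrow> p + q \<in> J"
    "p \<in> J \<Longrightarrow> q \<in> mpolys_in {..<n} \<Longrightarrow> q * p \<in> J"
    "p \<in> J \<Longrightarrow> q \<in> J \<Longrightarrow> p - q \<in> J"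
proof -
  show *: "p \<in> J \<Longrightarrow> p \<in> mpolys_in {..<n}" "0 \<in> J" "p \<in> J \<Longrightarrow> q \<in> J \<Longrightarrow> p + q \<in> J"
    "p \<in> J \<Longrightarrow> q \<in> mpolys_in {..<n} \<Longrightarrow> q * p \<in> J" for p q
    using assms unfolding ideal_poly_ring_iff by blast+
  have "single 0 (- 1) * q \<in> J" if "q \<in> J"
    using *(4)[OF that mpolys_in_const] .
  then show "p \<in> J \<Longrightarrow> q \<in> J \<Longrightarrow> p - q \<in> J"
    using *(3)[of p "- q"] by (simp add: single_uminus)
qed

lemma forms_iff: "p \<in> forms n d \<longleftrightarrow> keys p \<subseteq> monoms n d"
  by (auto simp: forms_def mpolys_in_def monoms_def)

lemma single_in_forms: "m \<in> monoms n d \<Longrightarrow> single m c \<in> forms n d"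
  by (simp add: forms_iff)

lemma forms_0 [simp]: "0 \<in> forms n d"
  by (simp add: forms_iff)

lemma forms_add: "p \<in> forms n d \<Longrightarrow> q \<in> forms n d \<Longrightarrow> p + q \<in> forms n d"
  using keys_add[of p q] by (auto simp: forms_iff)

lemma forms_diff: "p \<in> forms n d \<Longrightarrow> q \<in> forms n d \<Longrightarrow> p - q \<in> forms n d"
  using keys_diff[of p q] by (auto simp: forms_iff)

lemma forms_sum: "(\<And>i. i \<in> A \<Longrightarrow> f i \<in> forms n d) \<Longrightarrow> sum f A \<in> forms n d"
  by (induction A rule: infinite_finite_induct) (auto intro: forms_add)

lemma forms_mult:
  assumes "p \<in> forms n d" "q \<in> forms n e"
  shows "p * q \<in> forms n (d + e)"
  using assms keys_mult[of p q] by (fastforce simp: forms_iff intro: monoms_add)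

lemma forms_one: "1 \<in> forms n 0"
  by (simp add: forms_iff monoms_def)

lemma forms_power: "p \<in> forms n d \<Longrightarrow> p ^ e \<in> forms n (e * d)"
  by (induction e) (auto simp: forms_one intro: forms_mult)

lemma forms_prod: "(\<And>i. i \<in> A \<Longrightarrow> f i \<in> forms n (d i)) \<Longrightarrow> prod f A \<in> forms n (sum d A)"
  by (induction A rule: infinite_finite_induct) (auto simp: forms_one intro: forms_mult)

lemma forms_in_mpolys: "p \<in> forms n d \<Longrightarrow> p \<in> mpolys_in {..<n}"
  by (simp add: forms_def)

definition homog_part :: "nat \<Rightarrow> (nat, 'k::comm_ring_1) mpoly \<Rightarrow> (nat, 'k) mpoly" where
  "homog_part d p = (\<Sum>m\<in>{m\<in>keys p. monom_deg m = d}. single m (lookup p m))"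

lemma lookup_homog_part: "lookup (homog_part d p) m = (if monom_deg m = d then lookup p m else 0)"
proof -
  have "lookup (homog_part d p) m =
      (\<Sum>k\<in>{k\<in>keys p. monom_deg k = d}. if k = m then lookup p m else 0)"
    unfolding homog_part_def lookup_sum by (rule sum.cong) (auto simp: lookup_single)
  then show ?thesis
    by (auto simp: in_keys_iff)
qed

lemma keys_homog_part: "keys (homog_part d p) = {m \<in> keys p. monom_deg m = d}"
  by (auto simp: in_keys_iff lookup_homog_part split: if_splits)

lemma homog_part_forms:
  fixes p :: "(nat, 'k::field) mpoly"
  shows "p \<in> mpolys_in {..<n} \<Longrightarrow> homog_part d p \<in> forms n d"
  by (auto simp: forms_iff keys_homog_part monoms_def mpolys_in_def)

lemma homog_part_of_form:
  assumes "p \<in> forms n e"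
  shows "homog_part d p = (if d = e then p else 0)"
proof (rule poly_mapping_eqI)
  fix m
  have "lookup p m = 0" if "monom_deg m \<noteq> e"
    using assms that by (auto simp: forms_def in_keys_iff)
  then show "lookup (homog_part d p) m = lookup (if d = e then p else 0) m"
    by (auto simp: lookup_homog_part)
qed

lemma homog_part_add: "homog_part d (p + q) = homog_part d p + homog_part d q"
  by (rule poly_mapping_eqI) (simp add: lookup_homog_part lookup_add)

lemma homog_part_diff: "homog_part d (p - q) = homog_part d p - homog_part d q"
  by (rule poly_mapping_eqI) (simp add: lookup_homog_part lookup_minus)

lemma homog_part_sum: "homog_part d (sum f A) = (\<Sum>i\<in>A. homog_part d (f i))"
  by (rule poly_mapping_eqI) (simp add: lookup_homog_part lookup_sum)

lemma sum_homog_parts: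
  assumes "finite D" "monom_deg ` keys p \<subseteq> D"
  shows "(\<Sum>d\<in>D. homog_part d p) = p"
proof (rule poly_mapping_eqI)
  fix m
  have "m \<in> keys p \<Longrightarrow> monom_deg m \<in> D"
    using assms by blast
  then show "lookup (\<Sum>d\<in>D. homog_part d p) m = lookup p m"
    using assms by (auto simp: lookup_sum lookup_homog_part in_keys_iff)
qed

section \<open>Substitution and the action of matrices\<close>

definition mono_value :: "('x \<Rightarrow> 'b::comm_ring_1) \<Rightarrow> ('x \<Rightarrow>\<^sub>0 nat) \<Rightarrow> 'b" where
  "mono_value \<phi> m = (\<Prod>i\<in>keys m. \<phi> i ^ lookup m i)"

lemma mono_value_superset:
  assumes "finite A" "keys m \<subseteq> A"
  shows "mono_value \<phi> m = (\<Prod>i\<in>A. \<phi> i ^ lookup m i)"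
  unfolding mono_value_def
  by (rule prod.mono_neutral_left) (use assms in \<open>auto simp: in_keys_iff\<close>)

lemma mono_value_add: "mono_value \<phi> (m + k) = mono_value \<phi> m * mono_value \<phi> k"
proof -
  have "finite (keys m \<union> keys k)"
    by simp
  then show ?thesis
    by (simp add: mono_value_superset[of "keys m \<union> keys k"] keys_add_nat lookup_add power_add
        prod.distrib)
qed

lemma subst_poly_superset:
  assumes "comm_ring_hom c" "finite A" "keys p \<subseteq> A"
  shows "subst_poly c \<phi> p = (\<Sum>m\<in>A. c (lookup p m) * mono_value \<phi> m)"
proof -
  interpret comm_ring_hom c by fact
  show ?thesis
    unfolding subst_poly_def mono_value_def[symmetric]
    by (rule sum.mono_neutral_left) (use assms in \<open>auto simp: in_keys_iff\<close>)
qed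

lemma subst_poly_single:
  assumes "comm_ring_hom c"
  shows "subst_poly c \<phi> (single m a) = c a * mono_value \<phi> m"
  using subst_poly_superset[OF assms, of "{m}" "single m a"] by simp

lemma subst_poly_hom:
  fixes c :: "'k::comm_ring_1 \<Rightarrow> 'b::comm_ring_1" and \<phi> :: "'x \<Rightarrow> 'b"
  assumes "comm_ring_hom c"
  shows "comm_ring_hom (subst_poly c \<phi>)"
proof -
  interpret comm_ring_hom c by fact
  have add: "subst_poly c \<phi> (p + q) = subst_poly c \<phi> p + subst_poly c \<phi> q" for p q
  proof -
    have "finite (keys p \<union> keys q)"
      by simp
    then show ?thesis
      using keys_add[of p q]
      by (simp add: subst_poly_superset[OF assms, of "keys p \<union> keys q"] lookup_add hom_add
          algebra_simps sum.distrib)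
  qed
  have zero: "subst_poly c \<phi> 0 = 0"
    by (simp add: subst_poly_def)
  have sum: "subst_poly c \<phi> (sum f A) = (\<Sum>i\<in>A. subst_poly c \<phi> (f i))"
    for f :: "'i \<Rightarrow> ('x, 'k) mpoly" and A
    by (induction A rule: infinite_finite_induct) (simp_all add: add zero)
  have mult: "subst_poly c \<phi> (p * q) = subst_poly c \<phi> p * subst_poly c \<phi> q" for p q
  proof -
    have "p * q = (\<Sum>a\<in>keys p. single a (lookup p a)) * (\<Sum>b\<in>keys q. single b (lookup q b))"
      using poly_expand[of "keys p" p] poly_expand[of "keys q" q] by simp
    also have "\<dots> = (\<Sum>a\<in>keys p. \<Sum>b\<in>keys q. single (a + b) (lookup p a * lookup q b))"
      by (simp add: sum_product mult_single)
    finally have "subst_poly c \<phi> (p * q) = (\<Sum>a\<in>keys p. \<Sum>b\<in>keys q.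
        c (lookup p a) * mono_value \<phi> a * (c (lookup q b) * mono_value \<phi> b))"
      by (simp add: sum subst_poly_single[OF assms] hom_mult mono_value_add algebra_simps)
    then show ?thesis
      by (simp add: sum_product subst_poly_superset[OF assms, of "keys p" p]
          subst_poly_superset[OF assms, of "keys q" q])
  qed
  have "subst_poly c \<phi> 1 = 1"
    using subst_poly_single[OF assms, of \<phi> 0 1] by (simp add: mono_value_def)
  then show ?thesis
    by unfold_locales (simp_all add: add zero mult)
qed

lemma mono_value_single [simp]: "mono_value \<phi> (single i (Suc 0)) = \<phi> i"
  by (simp add: mono_value_def)

lemma comm_ring_hom_const: "comm_ring_hom (single 0 :: 'k::comm_ring_1 \<Rightarrow> ('x, 'k) mpoly)"
  by unfold_locales (simp_all add: single_add mult_single)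

lemma single_eq_mono_value:
  fixes c :: "'k::comm_ring_1" and m :: "'x \<Rightarrow>\<^sub>0 nat"
  shows "single m c = single 0 c * mono_value (\<lambda>i. single (single i 1) 1) m"
proof -
  have pow: "single (single i 1) (1::'k) ^ e = single (single i e) 1" for i :: 'x and e
    by (induction e) (simp_all add: mult_single single_add[symmetric])
  have "(\<Prod>i\<in>A. single (single i (lookup m i)) (1::'k)) =
      single (\<Sum>i\<in>A. single i (lookup m i)) 1" for A
    by (induction A rule: infinite_finite_induct) (simp_all add: mult_single)
  from this[of "keys m"] have "mono_value (\<lambda>i. single (single i 1) (1::'k)) m = single m 1"
    unfolding mono_value_def pow poly_expand[of "keys m" m, OF finite_keys order_refl, symmetric] .
  then show ?thesis
    by (simp add: mult_single)
qed

text \<open>Every term is a constant times a product of variables.\<close>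

lemma poly_hom_eqI:
  fixes h h' :: "('x, 'k::comm_ring_1) mpoly \<Rightarrow> 'b::comm_ring_1"
  assumes "comm_ring_hom h" "comm_ring_hom h'" "p \<in> mpolys_in X"
    and "\<And>c. h (single 0 c) = h' (single 0 c)"
    and "\<And>i. i \<in> X \<Longrightarrow> h (single (single i 1) 1) = h' (single (single i 1) 1)"
  shows "h p = h' p"
proof -
  interpret h: comm_ring_hom h by fact
  interpret h': comm_ring_hom h' by fact
  have "h (single m c) = h' (single m c)" if "keys m \<subseteq> X" for m c
    unfolding single_eq_mono_value[of m c] mono_value_def
    using that assms(4,5) by (auto simp: h.hom_mult h'.hom_mult h.hom_prod h'.hom_prod
        h.hom_power h'.hom_power intro!: arg_cong2[where f = "(*)"] prod.cong)
  then have "(\<Sum>m\<in>keys p. h (single m (lookup p m))) = (\<Sum>m\<in>keys p. h' (single m (lookup p m)))"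
    using assms(3) by (intro sum.cong) (auto simp: mpolys_in_def)
  then show ?thesis
    by (subst (1 2) poly_expand[of "keys p" p]) (simp_all add: h.hom_sum h'.hom_sum)
qed

abbreviation linear_form :: "nat \<Rightarrow> (nat \<Rightarrow> 'k::comm_ring_1) \<Rightarrow> (nat, 'k) mpoly" where
  "linear_form n c \<equiv> \<Sum>i<n. single (single i 1) (c i)"

lemma linear_form_in_forms: "linear_form n c \<in> forms n 1"
  by (intro forms_sum single_in_forms) (auto simp: monoms_def)

lemma mat_act_hom: "comm_ring_hom (mat_act n g)"
  unfolding mat_act_def by (rule subst_poly_hom[OF comm_ring_hom_const])

lemma mat_act_const [simp]: "mat_act n g (single 0 c) = single 0 c"
  unfolding mat_act_def by (simp add: subst_poly_single[OF comm_ring_hom_const] mono_value_def)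

lemma mat_act_var: "mat_act n g (single (single j 1) 1) = linear_form n (\<lambda>i. g $$ (i, j))"
  unfolding mat_act_def by (subst subst_poly_single[OF comm_ring_hom_const]) simp

lemma mat_act_linear_form:
  fixes c :: "nat \<Rightarrow> 'k::field"
  shows "mat_act n g (linear_form n c) = linear_form n (\<lambda>i. \<Sum>j<n. g $$ (i, j) * c j)"
proof -
  interpret comm_ring_hom "mat_act n g" by (rule mat_act_hom)
  have X: "single (single j 1) (c j) = single 0 (c j) * single (single j 1) 1" for j
    by (simp add: mult_single)
  have "mat_act n g (linear_form n c) =
      (\<Sum>j<n. single 0 (c j) * linear_form n (\<lambda>i. g $$ (i, j)))"
    by (simp only: X hom_sum hom_mult mat_act_const mat_act_var)
  also have "\<dots> = (\<Sum>j<n. \<Sum>i<n. single (single i 1) (g $$ (i, j) * c j))"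
    by (simp add: sum_distrib_left mult_single mult.commute)
  also have "\<dots> = (\<Sum>i<n. single (single i 1) (\<Sum>j<n. g $$ (i, j) * c j))"
    by (subst sum.swap) (simp add: single_sum)
  finally show ?thesis .
qed

text \<open>The action is compatible with the matrix product in this order because the columns of \<open>h\<close> hold the
  images of the variables.\<close>

lemma mat_act_mult:
  fixes g h :: "'k::field mat"
  assumes "g \<in> carrier_mat n n" "h \<in> carrier_mat n n" "p \<in> mpolys_in {..<n}"
  shows "mat_act n g (mat_act n h p) = mat_act n (g * h) p"
proof -
  interpret g: comm_ring_hom "mat_act n g" by (rule mat_act_hom)
  interpret h: comm_ring_hom "mat_act n h" by (rule mat_act_hom)
  have comp: "comm_ring_hom (\<lambda>p. mat_act n g (mat_act n h p))"
    by unfold_locales (simp_all add: g.hom_add g.hom_mult h.hom_add h.hom_mult)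
  show ?thesis
  proof (rule poly_hom_eqI[OF comp mat_act_hom assms(3)])
    fix j
    assume "j \<in> {..<n}"
    then have "(\<Sum>l<n. g $$ (i, l) * h $$ (l, j)) = (g * h) $$ (i, j)" if "i < n" for i
      using that assms(1,2) by (simp add: scalar_prod_def lessThan_atLeast0)
    then show "mat_act n g (mat_act n h (single (single j 1) 1)) =
        mat_act n (g * h) (single (single j 1) 1)"
      unfolding mat_act_var mat_act_linear_form by (intro sum.cong) auto
  qed simp
qed

lemma mat_act_one:
  fixes p :: "(nat, 'k::field) mpoly"
  assumes "p \<in> mpolys_in {..<n}"
  shows "mat_act n (1\<^sub>m n) p = p"
proof (rule poly_hom_eqI[OF mat_act_hom _ assms])
  show "comm_ring_hom (\<lambda>p :: (nat, 'k) mpoly. p)"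
    by unfold_locales simp_all
  fix j
  assume j: "j \<in> {..<n}"
  then have "linear_form n (\<lambda>i. 1\<^sub>m n $$ (i, j)) =
      (\<Sum>i<n. if i = j then single (single j 1) (1 :: 'k) else 0)"
    by (intro sum.cong) auto
  then show "mat_act n (1\<^sub>m n) (single (single j 1) 1) = single (single j 1) (1 :: 'k)"
    unfolding mat_act_var using j by simp
qed simp

lemma mat_act_forms:
  fixes p :: "(nat, 'k::field) mpoly"
  assumes "p \<in> forms n d"
  shows "mat_act n g p \<in> forms n d"
proof -
  have "mat_act n g p = (\<Sum>m\<in>keys p. single 0 (lookup p m) *
      mono_value (\<lambda>j. linear_form n (\<lambda>i. g $$ (i, j))) m)"
    by (simp add: mat_act_def subst_poly_def mono_value_def)
  also have "\<dots> \<in> forms n d"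
  proof (rule forms_sum)
    fix m
    assume m: "m \<in> keys p"
    have "mono_value (\<lambda>j. linear_form n (\<lambda>i. g $$ (i, j))) m \<in>
        forms n (\<Sum>i\<in>keys m. lookup m i * 1)"
      unfolding mono_value_def by (intro forms_prod forms_power linear_form_in_forms)
    moreover have "(\<Sum>i\<in>keys m. lookup m i * 1) = d"
      using m assms by (auto simp: forms_def monom_deg_def)
    ultimately have "mono_value (\<lambda>j. linear_form n (\<lambda>i. g $$ (i, j))) m \<in> forms n d"
      by simp
    moreover have "single 0 (lookup p m) \<in> forms n 0"
      by (intro single_in_forms) (simp add: monoms_def)
    ultimately show "single 0 (lookup p m) *
        mono_value (\<lambda>j. linear_form n (\<lambda>i. g $$ (i, j))) m \<in> forms n d"
      using forms_mult by fastforce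
  qed
  finally show ?thesis .
qed

lemma mat_act_in_mpolys_homog_part:
  fixes p :: "(nat, 'k::field) mpoly"
  assumes "p \<in> mpolys_in {..<n}"
  shows mat_act_in_mpolys: "mat_act n g p \<in> mpolys_in {..<n}"
    and homog_part_mat_act: "homog_part d (mat_act n g p) = mat_act n g (homog_part d p)"
proof -
  interpret comm_ring_hom "mat_act n g" by (rule mat_act_hom)
  let ?D = "insert d (monom_deg ` keys p)"
  have form: "mat_act n g (homog_part e p) \<in> forms n e" for e
    by (intro mat_act_forms homog_part_forms assms)
  have "p = (\<Sum>e\<in>?D. homog_part e p)"
    by (rule sum_homog_parts[symmetric]) auto
  then have eq: "mat_act n g p = (\<Sum>e\<in>?D. mat_act n g (homog_part e p))"
    by (metis hom_sum)
  show "mat_act n g p \<in> mpolys_in {..<n}"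
    unfolding eq by (intro mpolys_in_sum forms_in_mpolys[OF form])
  have "homog_part d (mat_act n g p) =
      (\<Sum>e\<in>?D. if e = d then mat_act n g (homog_part d p) else 0)"
    unfolding eq homog_part_sum by (intro sum.cong) (auto simp: homog_part_of_form[OF form])
  also have "\<dots> = mat_act n g (homog_part d p)"
    by (subst sum.delta) auto
  finally show "homog_part d (mat_act n g p) = mat_act n g (homog_part d p)" .
qed

lemma GL_inverse:
  assumes "g \<in> GL n"
  obtains h where "h \<in> GL n" "g * h = 1\<^sub>m n" "h * g = 1\<^sub>m n"
proof -
  have g: "g \<in> carrier_mat n n"
    using assms by (simp add: GL_def)
  obtain h where h: "g * h = 1\<^sub>m (dim_row g)" "h * g = 1\<^sub>m (dim_row h)"
    using assms by (auto simp: GL_def invertible_mat_def inverts_mat_def)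
  have "dim_col (g * h) = n" "dim_col (h * g) = dim_row h"
    using h g by simp_all
  then have "h \<in> carrier_mat n n"
    using g by auto
  then show thesis
    using h g by (intro that[of h]) (auto simp: GL_def invertible_mat_def inverts_mat_def)
qed

lemma GL_I:
  assumes "g \<in> carrier_mat n n" "h \<in> carrier_mat n n" "g * h = 1\<^sub>m n" "h * g = 1\<^sub>m n"
  shows "g \<in> GL n"
  using assms unfolding GL_def invertible_mat_def inverts_mat_def by auto

lemma GL_carrier: "g \<in> GL n \<Longrightarrow> g \<in> carrier_mat n n"
  by (simp add: GL_def)

lemma mat_act_inverse:
  fixes p :: "(nat, 'k::field) mpoly"
  assumes "h * g = 1\<^sub>m n" "h \<in> GL n" "g \<in> GL n" "p \<in> mpolys_in {..<n}"
  shows "mat_act n h (mat_act n g p) = p"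
  using assms mat_act_mult[of h n g p] mat_act_one[of p n] by (simp add: GL_carrier)

lemma ideal_mat_act:
  fixes J :: "(nat, 'k::field) mpoly set"
  assumes J: "ideal J (poly_ring n)" and g: "g \<in> GL n"
  shows "ideal (mat_act n g ` J) (poly_ring n)"
  unfolding ideal_poly_ring_iff
proof (intro conjI ballI)
  interpret comm_ring_hom "mat_act n g" by (rule mat_act_hom)
  note J' = ideal_poly_ringD[OF J]
  obtain h where h: "h \<in> GL n" "g * h = 1\<^sub>m n"
    using GL_inverse[OF g] by metis
  show "mat_act n g ` J \<subseteq> mpolys_in {..<n}"
    using J'(1) by (auto intro: mat_act_in_mpolys)
  show "0 \<in> mat_act n g ` J"
    using J'(2) by (metis hom_zero imageI)
  fix p assume "p \<in> mat_act n g ` J"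
  then obtain p' where p: "p' \<in> J" "p = mat_act n g p'" by blast
  {
    fix q assume "q \<in> mat_act n g ` J"
    then show "p + q \<in> mat_act n g ` J"
      using p J'(3) by (auto simp flip: hom_add)
  }
  fix q :: "(nat, 'k) mpoly"
  assume q: "q \<in> mpolys_in {..<n}"
  then have "q = mat_act n g (mat_act n h q)"
    using mat_act_inverse[OF h(2) g h(1)] by simp
  then have "q * p = mat_act n g (mat_act n h q * p')"
    using p by (simp add: hom_mult)
  then show "q * p \<in> mat_act n g ` J"
    using J'(4)[OF p(1) mat_act_in_mpolys[OF q]] by blast
qed

section \<open>Initial ideals\<close>

lemma lead_monoms_upward_closed:
  fixes J :: "(nat, 'k::field) mpoly set"
  assumes J: "ideal J (poly_ring n)" and "m \<in> lead_monoms J" "keys k \<subseteq> {..<n}"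
  shows "k + m \<in> lead_monoms J"
proof -
  obtain p where p: "p \<in> J" "p \<noteq> 0" "lead_monom p = m"
    using assms(2) by (rule lead_monomsE)
  have "single k 1 * p \<in> J"
    by (rule ideal_poly_ringD(4)[OF J p(1)]) (use assms(3) in \<open>simp add: mpolys_in_single\<close>)
  moreover have "single k 1 * p \<noteq> 0"
    using p(2) keys_single_mult[of 1 k p] by (metis image_is_empty keys_eq_empty one_neq_zero)
  ultimately show ?thesis
    using lead_monom_in_lead_monoms lead_monom_single_mult[of 1 p k] p by fastforce
qed

lemma lead_monoms_in_vars:
  assumes "ideal J (poly_ring n)" "m \<in> lead_monoms J"
  shows "keys m \<subseteq> {..<n}"
  using assms(2) ideal_poly_ringD(1)[OF assms(1)]
  by (elim lead_monomsE) (auto simp: mpolys_in_def)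

text \<open>The monomials in a monomial ideal are the multiples of its generators, and the leading
  monomials of an ideal are already closed under multiples.\<close>

lemma initial_ideal_eq:
  fixes J :: "(nat, 'k::field) mpoly set"
  assumes J: "ideal J (poly_ring n)"
  shows "initial_ideal n J = {p \<in> mpolys_in {..<n}. keys p \<subseteq> lead_monoms J}" (is "_ = ?M")
proof
  interpret cring "poly_ring n :: (nat, 'k) mpoly ring"
    by (rule cring_poly_ring)
  let ?S = "(\<lambda>p. monomial (lead_monom p)) ` (J - {0}) :: (nat, 'k) mpoly set"
  have S: "?S = monomial ` lead_monoms J"
    by (simp add: lead_monoms_def image_image)
  have vars: "?S \<subseteq> mpolys_in {..<n}"
    unfolding S using lead_monoms_in_vars[OF J] by (auto simp: monomial_def intro: mpolys_in_single)
  have "ideal ?M (poly_ring n)"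
    unfolding ideal_poly_ring_iff
  proof (intro conjI ballI)
    fix p q :: "(nat, 'k) mpoly"
    assume p: "p \<in> ?M" and q: "q \<in> mpolys_in {..<n}"
    have "keys (q * p) \<subseteq> lead_monoms J"
    proof
      fix m assume "m \<in> keys (q * p)"
      then obtain a b where "m = a + b" "a \<in> keys q" "b \<in> keys p"
        using keys_mult[of q p] by blast
      then show "m \<in> lead_monoms J"
        using p q lead_monoms_upward_closed[OF J, of b a] by (auto simp: mpolys_in_def)
    qed
    then show "q * p \<in> ?M"
      using p q by (simp add: mpolys_in_mult)
  next
    fix p q :: "(nat, 'k) mpoly"
    assume "p \<in> ?M" "q \<in> ?M"
    then show "p + q \<in> ?M"
      using keys_add[of p q] by (auto intro: mpolys_in_add)
  qed auto
  then show "initial_ideal n J \<subseteq> ?M"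
    unfolding initial_ideal_def
    by (rule genideal_minimal) (use vars in \<open>auto simp: S[unfolded monomial_def] monomial_def\<close>)
  have I: "ideal (initial_ideal n J) (poly_ring n)"
    unfolding initial_ideal_def by (rule genideal_ideal) (use vars in simp)
  show "?M \<subseteq> initial_ideal n J"
  proof
    fix p assume p: "p \<in> ?M"
    have summand: "single m (lookup p m) \<in> initial_ideal n J" if "m \<in> keys p" for m
    proof -
      have "monomial m \<in> ?S"
        using that p by (auto simp: S)
      then have "monomial m \<in> initial_ideal n J"
        unfolding initial_ideal_def using genideal_self[of ?S] vars by auto
      from ideal_poly_ringD(4)[OF I this, of "single 0 (lookup p m)"] show ?thesis
        by (simp add: monomial_def mult_single)
    qed
    have "(\<Sum>m\<in>A. single m (lookup p m)) \<in> initial_ideal n J" if "finite A" "A \<subseteq> keys p" for A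
      using that by (induction A rule: finite_induct) (auto simp: ideal_poly_ringD[OF I] summand)
    from this[of "keys p"] show "p \<in> initial_ideal n J"
      using poly_expand[of "keys p" p] by simp
  qed
qed

lemma monomial_in_initial_ideal_iff:
  fixes J :: "(nat, 'k::field) mpoly set"
  assumes "ideal J (poly_ring n)"
  shows "monomial m \<in> initial_ideal n J \<longleftrightarrow> m \<in> lead_monoms J"
  using lead_monoms_in_vars[OF assms]
  by (auto simp: initial_ideal_eq[OF assms] monomial_def mpolys_in_def)

section \<open>Counting leading monomials\<close>

definition poly_scale :: "'k::field \<Rightarrow> (nat, 'k) mpoly \<Rightarrow> (nat, 'k) mpoly" where
  "poly_scale c p = single 0 c * p"

lemma lookup_poly_scale [simp]: "lookup (poly_scale c p) m = c * lookup p m"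
  by (simp add: poly_scale_def)

interpretation poly_vs: vector_space poly_scale
  by unfold_locales (auto intro!: poly_mapping_eqI simp: lookup_add algebra_simps)

lemma lead_monoms_representatives:
  obtains w where "\<And>m. m \<in> lead_monoms W \<Longrightarrow> w m \<in> W \<and> w m \<noteq> 0 \<and> lead_monom (w m) = m"
  by (metis lead_monomsE)

text \<open>Among the polynomials with nonzero coefficient take the one with the greatest leading monomial: that
  monomial occurs in no other summand, so it cannot cancel.\<close>

lemma distinct_lead_monoms_independent:
  assumes "finite F" and w: "\<And>m. m \<in> F \<Longrightarrow> w m \<noteq> 0 \<and> lead_monom (w m) = m"
    and zero: "(\<Sum>m\<in>F. poly_scale (c m) (w m)) = 0" and "m \<in> F"
  shows "c m = 0"
proof (rule ccontr)
  assume "c m \<noteq> 0"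
  then obtain k where k: "k \<in> F" "c k \<noteq> 0"
    and great: "\<And>l. l \<in> F \<Longrightarrow> c l \<noteq> 0 \<Longrightarrow> l \<noteq> k \<Longrightarrow> revlex_less l k"
    using finite_revlex_greatest[of "{l\<in>F. c l \<noteq> 0}"] assms(1,4) by auto
  have other: "c l * lookup (w l) k = 0" if l: "l \<in> F" "l \<noteq> k" for l
  proof (cases "c l = 0")
    case False
    have "revlex_less l k"
      by (rule great[OF l(1) False l(2)])
    moreover have "revlex_less k l" if "k \<in> keys (w l)"
      using lead_monom_props(2)[of "w l" k] w[OF l(1)] that l(2) by auto
    ultimately have "k \<notin> keys (w l)"
      using revlex_less_asym by auto
    then show ?thesis by (simp add: in_keys_iff)
  qed simp
  have "lookup (\<Sum>m\<in>F. poly_scale (c m) (w m)) k = (\<Sum>l\<in>F. c l * lookup (w l) k)"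
    by (simp add: lookup_sum)
  also have "\<dots> = (\<Sum>l\<in>F. if l = k then c k * lookup (w k) k else 0)"
    by (rule sum.cong) (use other in auto)
  also have "\<dots> = c k * lookup (w k) k"
    using k(1) assms(1) by simp
  finally have "c k * lookup (w k) k = 0"
    using zero by simp
  then show False
    using k w[OF k(1)] lead_monom_props(1)[of "w k"] by (auto simp: in_keys_iff)
qed

text \<open>Gaussian elimination: subtracting a multiple of the representative with the same leading monomial
  lowers the leading monomial, and only finitely many leading monomials are available. So one
  representative for each leading monomial gives a basis.\<close>

lemma reduction_by_lead_monoms:
  fixes W :: "(nat, 'k::field) mpoly set"
  assumes W: "poly_vs.subspace W" and fin: "finite (lead_monoms W)"
    and w: "\<And>m. m \<in> lead_monoms W \<Longrightarrow> w m \<in> W \<and> w m \<noteq> 0 \<and> lead_monom (w m) = m"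
    and "p \<in> W"
  shows "\<exists>c. p = (\<Sum>m\<in>lead_monoms W. poly_scale (c m) (w m))"
  using assms(4)
proof (induction "card {m\<in>lead_monoms W. p \<noteq> 0 \<and> (revlex_less m (lead_monom p) \<or> m = lead_monom p)}"
    arbitrary: p rule: less_induct)
  case less
  show ?case
  proof (cases "p = 0")
    case True
    then show ?thesis
      by (intro exI[of _ "\<lambda>_. 0"]) simp
  next
    case False
    define m where "m = lead_monom p"
    have m: "m \<in> lead_monoms W"
      unfolding m_def by (rule lead_monom_in_lead_monoms) (use less False in auto)
    define a where "a = lookup p m / lookup (w m) m"
    define q where "q = p - poly_scale a (w m)"
    have wm: "w m \<in> W" "w m \<noteq> 0" "lead_monom (w m) = m"
      using w[OF m] by auto
    then have nz: "lookup (w m) m \<noteq> 0"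
      using lead_monom_props(1)[of "w m"] by (simp add: in_keys_iff)
    have q: "q \<in> W"
      unfolding q_def using W less wm(1) by (simp add: poly_vs.subspace_diff poly_vs.subspace_scale)
    have keys_q: "revlex_less k m" if "k \<in> keys q" for k
    proof -
      have "k \<noteq> m"
        using that nz by (auto simp: q_def a_def in_keys_iff lookup_minus)
      moreover have "k \<in> keys p \<or> k \<in> keys (w m)"
        using that by (auto simp: q_def in_keys_iff lookup_minus)
      ultimately show ?thesis
        using lead_monom_props(2)[OF False, of k] lead_monom_props(2)[OF wm(2), of k] wm(3)
        by (auto simp: m_def)
    qed
    have "\<exists>c. q = (\<Sum>m\<in>lead_monoms W. poly_scale (c m) (w m))"
    proof (rule less.hyps[OF _ q], rule psubset_card_mono)
      show "finite {k\<in>lead_monoms W. p \<noteq> 0 \<and> (revlex_less k (lead_monom p) \<or> k = lead_monom p)}"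
        using fin by simp
      have "revlex_less (lead_monom q) m" if "q \<noteq> 0"
        using keys_q lead_monom_props(1)[OF that] by blast
      then have "{k\<in>lead_monoms W. q \<noteq> 0 \<and> (revlex_less k (lead_monom q) \<or> k = lead_monom q)}
          \<subseteq> {k\<in>lead_monoms W. p \<noteq> 0 \<and> (revlex_less k m \<or> k = m)} - {m}"
        using False revlex_less_trans[of _ "lead_monom q" m] revlex_less_asym[of "lead_monom q" m] by auto
      then show "{k\<in>lead_monoms W. q \<noteq> 0 \<and> (revlex_less k (lead_monom q) \<or> k = lead_monom q)}
          \<subset> {k\<in>lead_monoms W. p \<noteq> 0 \<and> (revlex_less k (lead_monom p) \<or> k = lead_monom p)}"
        using m False unfolding m_def[symmetric] by auto
    qed
    then obtain c where c: "q = (\<Sum>m\<in>lead_monoms W. poly_scale (c m) (w m))"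
      by blast
    have "p = q + poly_scale a (w m)"
      by (simp add: q_def)
    also have "poly_scale a (w m) = (\<Sum>k\<in>lead_monoms W. poly_scale (if k = m then a else 0) (w k))"
      using fin m by (subst sum.remove[of _ m]) auto
    finally have "p = (\<Sum>k\<in>lead_monoms W. poly_scale (c k + (if k = m then a else 0)) (w k))"
      by (simp add: c poly_vs.scale_left_distrib sum.distrib)
    then show ?thesis
      by (intro exI[of _ "\<lambda>k. c k + (if k = m then a else 0)"])
  qed
qed

text \<open>The number of leading monomials of a subspace is its dimension, so a linear map that is injective
  on \<open>W\<close> cannot decrease it. This is the only use of dimensions: it is applied to the action of a matrix
  and to the restriction of polynomials to a set of monomials.\<close>

lemma card_lead_monoms_le:
  fixes W W' :: "(nat, 'k::field) mpoly set"
  assumes W: "poly_vs.subspace W" "finite (lead_monoms W)"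
    and W': "poly_vs.subspace W'" "finite (lead_monoms W')"
    and T: "Vector_Spaces.linear poly_scale poly_scale T" "T ` W \<subseteq> W'"
      "\<And>p. p \<in> W \<Longrightarrow> T p = 0 \<Longrightarrow> p = 0"
  shows "card (lead_monoms W) \<le> card (lead_monoms W')"
proof -
  interpret T: Vector_Spaces.linear poly_scale poly_scale T by fact
  obtain w where w: "\<And>m. m \<in> lead_monoms W \<Longrightarrow> w m \<in> W \<and> w m \<noteq> 0 \<and> lead_monom (w m) = m"
    using lead_monoms_representatives by metis
  obtain w' where w': "\<And>m. m \<in> lead_monoms W' \<Longrightarrow>
      w' m \<in> W' \<and> w' m \<noteq> 0 \<and> lead_monom (w' m) = m"
    using lead_monoms_representatives by metis
  let ?F = "lead_monoms W"
  have inj: "inj_on (\<lambda>m. T (w m)) ?F"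
  proof (rule inj_onI)
    fix m k assume mk: "m \<in> ?F" "k \<in> ?F" "T (w m) = T (w k)"
    then have "w m - w k \<in> W" "T (w m - w k) = 0"
      using w W by (auto simp: T.diff poly_vs.subspace_diff)
    then have "w m = w k"
      using T(3)[of "w m - w k"] by simp
    then show "m = k"
      using w mk by metis
  qed
  have "poly_vs.independent ((\<lambda>m. T (w m)) ` ?F)"
  proof (rule poly_vs.independent_if_scalars_zero)
    fix c v
    assume zero: "(\<Sum>v\<in>(\<lambda>m. T (w m)) ` ?F. poly_scale (c v) v) = 0" and v: "v \<in> (\<lambda>m. T (w m)) ` ?F"
    obtain k where k: "k \<in> ?F" "v = T (w k)"
      using v by blast
    let ?s = "\<Sum>m\<in>?F. poly_scale (c (T (w m))) (w m)"
    have "T ?s = 0"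
      using zero inj by (simp add: sum.reindex T.sum T.scale)
    moreover have "?s \<in> W"
      using W w by (intro poly_vs.subspace_sum poly_vs.subspace_scale) auto
    ultimately have "?s = 0"
      using T(3) by simp
    then show "c v = 0"
      unfolding k(2) by (rule distinct_lead_monoms_independent[rotated 2]) (use w W k in auto)
  qed (use W in simp)
  moreover have "(\<lambda>m. T (w m)) ` ?F \<subseteq> poly_vs.span (w' ` lead_monoms W')"
  proof (rule image_subsetI)
    fix m assume "m \<in> ?F"
    then have "T (w m) \<in> W'"
      using w T(2) by blast
    then obtain c where "T (w m) = (\<Sum>m\<in>lead_monoms W'. poly_scale (c m) (w' m))"
      using reduction_by_lead_monoms[OF W' w'] by blast
    then show "T (w m) \<in> poly_vs.span (w' ` lead_monoms W')"
      by (simp only:) (intro poly_vs.span_sum poly_vs.span_scale poly_vs.span_base imageI)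
  qed
  ultimately have "card ((\<lambda>m. T (w m)) ` ?F) \<le> card (w' ` lead_monoms W')"
    using poly_vs.independent_span_bound[of "w' ` lead_monoms W'"] W'(2) by blast
  also have "\<dots> \<le> card (lead_monoms W')"
    by (rule card_image_le[OF W'(2)])
  finally show ?thesis
    using inj by (simp add: card_image)
qed

section \<open>Polynomial functions of the matrix entries\<close>

text \<open>Polynomial functions on matrices; their nonvanishing loci in \<^term>\<open>GL n\<close> are the basic Zariski open
  sets.\<close>

definition entry_polynomial :: "nat \<Rightarrow> ('k::field mat \<Rightarrow> 'k) \<Rightarrow> bool" where
  "entry_polynomial n F \<longleftrightarrow>
     (\<exists>p\<in>mpolys_in ({..<n} \<times> {..<n}). \<forall>g. F g = subst_poly id (\<lambda>ij. g $$ ij) p)"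

lemma comm_ring_hom_id: "comm_ring_hom (id :: 'k::comm_ring_1 \<Rightarrow> 'k)"
  by unfold_locales simp_all

lemma entry_polynomial_const: "entry_polynomial n (\<lambda>g. c)"
  unfolding entry_polynomial_def
  by (rule bexI[of _ "single 0 c"]) (simp_all add: subst_poly_single comm_ring_hom_id mono_value_def)

lemma entry_polynomial_entry:
  assumes "i < n" "j < n"
  shows "entry_polynomial n (\<lambda>g. g $$ (i, j))"
  unfolding entry_polynomial_def
  by (rule bexI[of _ "single (single (i, j) 1) 1"])
    (use assms in \<open>auto simp: subst_poly_single comm_ring_hom_id intro: mpolys_in_single\<close>)

lemma entry_polynomial_add:
  assumes "entry_polynomial n F" "entry_polynomial n G"
  shows "entry_polynomial n (\<lambda>g. F g + G g)"
proof -
  obtain p q where p: "p \<in> mpolys_in ({..<n} \<times> {..<n})" "\<And>g. F g = subst_poly id (\<lambda>ij. g $$ ij) p"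
    and q: "q \<in> mpolys_in ({..<n} \<times> {..<n})" "\<And>g. G g = subst_poly id (\<lambda>ij. g $$ ij) q"
    using assms unfolding entry_polynomial_def by blast
  have "F g + G g = subst_poly id (\<lambda>ij. g $$ ij) (p + q)" for g
  proof -
    interpret comm_ring_hom "subst_poly id (\<lambda>ij. g $$ ij)"
      by (rule subst_poly_hom[OF comm_ring_hom_id])
    show ?thesis by (simp add: p q hom_add)
  qed
  then show ?thesis
    using mpolys_in_add[OF p(1) q(1)] unfolding entry_polynomial_def by blast
qed

lemma entry_polynomial_mult:
  assumes "entry_polynomial n F" "entry_polynomial n G"
  shows "entry_polynomial n (\<lambda>g. F g * G g)"
proof -
  obtain p q where p: "p \<in> mpolys_in ({..<n} \<times> {..<n})" "\<And>g. F g = subst_poly id (\<lambda>ij. g $$ ij) p"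
    and q: "q \<in> mpolys_in ({..<n} \<times> {..<n})" "\<And>g. G g = subst_poly id (\<lambda>ij. g $$ ij) q"
    using assms unfolding entry_polynomial_def by blast
  have "F g * G g = subst_poly id (\<lambda>ij. g $$ ij) (p * q)" for g
  proof -
    interpret comm_ring_hom "subst_poly id (\<lambda>ij. g $$ ij)"
      by (rule subst_poly_hom[OF comm_ring_hom_id])
    show ?thesis by (simp add: p q hom_mult)
  qed
  then show ?thesis
    using mpolys_in_mult[OF p(1) q(1)] unfolding entry_polynomial_def by blast
qed

lemma entry_polynomial_sum:
  "(\<And>i. i \<in> A \<Longrightarrow> entry_polynomial n (F i)) \<Longrightarrow> entry_polynomial n (\<lambda>g. \<Sum>i\<in>A. F i g)"
  by (induction A rule: infinite_finite_induct)
    (auto intro: entry_polynomial_const entry_polynomial_add)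

lemma entry_polynomial_prod:
  "(\<And>i. i \<in> A \<Longrightarrow> entry_polynomial n (F i)) \<Longrightarrow> entry_polynomial n (\<lambda>g. \<Prod>i\<in>A. F i g)"
  by (induction A rule: infinite_finite_induct)
    (auto intro: entry_polynomial_const entry_polynomial_mult)

lemma entry_polynomial_det:
  assumes "\<And>i j. i < r \<Longrightarrow> j < r \<Longrightarrow> entry_polynomial n (F i j)"
  shows "entry_polynomial n (\<lambda>g. det (mat r r (\<lambda>(i, j). F i j g)))"
proof -
  have "det (mat r r (\<lambda>(i, j). F i j g)) =
      (\<Sum>p\<in>{p. p permutes {0..<r}}. signof p * (\<Prod>i=0..<r. F i (p i) g))" for g
    by (subst det_def'[of _ r])
      (auto simp: permutes_in_image intro!: sum.cong arg_cong2[where f = "(*)"] prod.cong)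
  moreover have "entry_polynomial n
      (\<lambda>g. \<Sum>p\<in>{p. p permutes {0..<r}}. signof p * (\<Prod>i=0..<r. F i (p i) g))"
    using assms
    by (intro entry_polynomial_sum entry_polynomial_mult entry_polynomial_const
        entry_polynomial_prod) (auto simp: permutes_in_image)
  ultimately show ?thesis
    by simp
qed

lemma entry_polynomial_on_line:
  assumes "entry_polynomial n F"
  shows "\<exists>q. \<forall>s. F (mat n n (\<lambda>ij. A $$ ij + s * B $$ ij)) = poly q s"
proof -
  obtain p where p: "p \<in> mpolys_in ({..<n} \<times> {..<n})" "\<And>g. F g = subst_poly id (\<lambda>ij. g $$ ij) p"
    using assms unfolding entry_polynomial_def by blast
  have const: "comm_ring_hom (\<lambda>c :: 'a. [:c:])"
    by unfold_locales (simp_all add: one_pCons)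
  let ?h = "subst_poly (\<lambda>c. [:c:]) (\<lambda>ij. [:A $$ ij, B $$ ij:])"
  have h: "comm_ring_hom ?h"
    by (rule subst_poly_hom[OF const])
  have "subst_poly id (\<lambda>ij. mat n n (\<lambda>ij. A $$ ij + s * B $$ ij) $$ ij) p = poly (?h p) s" for s
  proof (rule poly_hom_eqI[OF subst_poly_hom[OF comm_ring_hom_id] _ p(1)])
    interpret comm_ring_hom ?h by fact
    show "comm_ring_hom (\<lambda>p. poly (?h p) s)"
      by unfold_locales (simp_all add: hom_add hom_mult)
  qed (auto simp: subst_poly_single comm_ring_hom_id const mono_value_def)
  then show ?thesis
    using p(2) by auto
qed

lemma GL_iff_det:
  fixes g :: "'k::field mat"
  shows "g \<in> GL n \<longleftrightarrow> g \<in> carrier_mat n n \<and> det g \<noteq> 0"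
proof
  assume g: "g \<in> GL n"
  obtain h where h: "h \<in> GL n" "g * h = 1\<^sub>m n"
    using GL_inverse[OF g] by metis
  have "det g * det h = 1"
    using det_mult[of g n h] h g by (simp add: GL_carrier)
  then show "g \<in> carrier_mat n n \<and> det g \<noteq> 0"
    using g by (auto simp: GL_carrier)
next
  assume g: "g \<in> carrier_mat n n \<and> det g \<noteq> 0"
  then have "g \<in> Units (ring_mat TYPE('k) n ())"
    by (intro det_non_zero_imp_unit) auto
  then obtain h where "h \<in> carrier_mat n n" "g * h = 1\<^sub>m n" "h * g = 1\<^sub>m n"
    unfolding Units_def ring_mat_simps by auto
  then show "g \<in> GL n"
    using g by (intro GL_I[of g n h]) auto
qed

text \<open>Two nonempty open sets meet because they meet on a line through a point of each, where their
  complements are given by the roots of nonzero polynomials in one variable.\<close>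

lemma nonempty_opens_meet:
  fixes F G :: "'k::field_char_0 mat \<Rightarrow> 'k"
  assumes F: "entry_polynomial n F" "a \<in> GL n" "F a \<noteq> 0"
    and G: "entry_polynomial n G" "b \<in> GL n" "G b \<noteq> 0"
  obtains g where "g \<in> GL n" "F g \<noteq> 0" "G g \<noteq> 0"
proof -
  have "entry_polynomial n (\<lambda>g :: 'k mat. det (mat n n (\<lambda>(i, j). g $$ (i, j))))"
    by (intro entry_polynomial_det entry_polynomial_entry)
  then have D: "entry_polynomial n (\<lambda>g :: 'k mat. det (mat n n (\<lambda>ij. g $$ ij)))"
    by (simp add: split_def)
  define l where "l s = mat n n (\<lambda>ij. a $$ ij + s * (b - a) $$ ij)" for s
  obtain f where f: "\<And>s. F (l s) = poly f s"
    using entry_polynomial_on_line[OF F(1)] unfolding l_def by blast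
  obtain h where h: "\<And>s. G (l s) = poly h s"
    using entry_polynomial_on_line[OF G(1)] unfolding l_def by blast
  obtain d where "\<And>s. det (mat n n (\<lambda>ij. l s $$ ij)) = poly d s"
    using entry_polynomial_on_line[OF D] unfolding l_def by blast
  moreover have "mat n n (\<lambda>ij. l s $$ ij) = l s" for s
    by (auto simp: l_def)
  ultimately have d: "\<And>s. det (l s) = poly d s"
    by simp
  have l: "l 0 = a" "l 1 = b"
    using GL_carrier[OF F(2)] GL_carrier[OF G(2)] by (auto simp: l_def intro!: eq_matI)
  have "poly f 0 \<noteq> 0" "poly h 1 \<noteq> 0" "poly d 0 \<noteq> 0"
    using F G by (simp_all add: l GL_iff_det flip: f h d)
  then have "f * h * d \<noteq> 0"
    by auto
  then have "finite {s. poly (f * h * d) s = 0}"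
    by (rule poly_roots_finite)
  then have "{s. poly (f * h * d) s = 0} \<noteq> UNIV"
    using infinite_UNIV_char_0[where 'a = 'k] by (metis (no_types))
  then obtain s where "poly (f * h * d) s \<noteq> 0"
    by blast
  then show thesis
    by (intro that[of "l s"]) (simp_all add: GL_iff_det f h d, simp add: l_def)
qed

text \<open>Families of polynomials whose coefficients are polynomial functions of \<open>g\<close> are closed under sums and
  products, and \<^const>\<open>mat_act\<close> is built from linear forms with entries of \<open>g\<close> as coefficients.\<close>

lemma entry_polynomial_coefficient:
  fixes p :: "(nat, 'k::field) mpoly"
  assumes "p \<in> mpolys_in {..<n}"
  shows "entry_polynomial n (\<lambda>g. lookup (mat_act n g p) m)"
proof -
  define reg :: "('k mat \<Rightarrow> (nat, 'k) mpoly) \<Rightarrow> bool"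
    where "reg H \<longleftrightarrow> (\<forall>m. entry_polynomial n (\<lambda>g. lookup (H g) m))" for H
  have const: "reg (\<lambda>g. q)" for q
    by (simp add: reg_def entry_polynomial_const)
  have mult: "reg (\<lambda>g. H g * K g)" if "reg H" "reg K" for H K
    using that unfolding reg_def lookup_times split_def
    by (intro allI entry_polynomial_sum entry_polynomial_mult) auto
  have sum: "reg (\<lambda>g. \<Sum>i\<in>A. H i g)" if "\<And>i. i \<in> A \<Longrightarrow> reg (H i)"
    for A :: "'i set" and H
    using that unfolding reg_def lookup_sum by (intro allI entry_polynomial_sum) auto
  have power: "reg (\<lambda>g. H g ^ e)" if "reg H" for H e
    by (induction e) (auto intro: const mult that)
  have prod: "reg (\<lambda>g. \<Prod>i\<in>A. H i g)" if "\<And>i. i \<in> A \<Longrightarrow> reg (H i)"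
    for A :: "nat set" and H
    using that by (induction A rule: infinite_finite_induct) (auto intro: const mult)
  have var: "reg (\<lambda>g. single m (g $$ (i, j)))" if "i < n" "j < n" for m i j
    unfolding reg_def
  proof
    fix k
    show "entry_polynomial n (\<lambda>g. lookup (single m (g $$ (i, j))) k)"
      using entry_polynomial_entry[OF that] entry_polynomial_const[of n 0]
      by (cases "m = k") (simp_all add: lookup_single)
  qed
  have "reg (\<lambda>g. mat_act n g p)"
    unfolding mat_act_def subst_poly_def
    using assms by (intro sum mult const prod power var) (auto simp: mpolys_in_def)
  then show ?thesis
    by (simp add: reg_def)
qed

section \<open>Semicontinuity of leading monomials\<close>

text \<open>Only monomials in the first \<open>n\<close> variables are compared: a monomial containing a variable of index
  at least \<open>n\<close> is smaller than every monomial of the same degree without such variables.\<close>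

definition revlex_downset :: "nat \<Rightarrow> (nat \<Rightarrow>\<^sub>0 nat) set \<Rightarrow> bool" where
  "revlex_downset n B \<longleftrightarrow>
     (\<forall>m\<in>B. \<forall>k. keys m \<subseteq> {..<n} \<longrightarrow> keys k \<subseteq> {..<n} \<longrightarrow> revlex_less k m \<longrightarrow> k \<in> B)"

text \<open>A polynomial whose leading monomial lies in an initial segment is supported in that segment. Hence
  counting leading monomials in \<open>B\<close> means computing the dimension of a subspace.\<close>

lemma lead_monoms_supported_in_downset:
  assumes "W \<subseteq> mpolys_in {..<n}" "revlex_downset n B"
  shows "lead_monoms {p\<in>W. keys p \<subseteq> B} = lead_monoms W \<inter> B"
proof (intro equalityI subsetI)
  fix m assume "m \<in> lead_monoms {p\<in>W. keys p \<subseteq> B}"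
  then show "m \<in> lead_monoms W \<inter> B"
    by (elim lead_monomsE) (auto intro: lead_monomsI)
next
  fix m assume m: "m \<in> lead_monoms W \<inter> B"
  then obtain p where p: "p \<in> W" "m \<in> keys p" "\<And>k. k \<in> keys p \<Longrightarrow> k \<noteq> m \<Longrightarrow> revlex_less k m"
    using lead_monomsE[of m W] by blast
  have "k \<in> B" if "k \<in> keys p" for k
  proof (cases "k = m")
    case False
    have "keys m \<subseteq> {..<n}" "keys k \<subseteq> {..<n}"
      using p(1,2) that assms(1) by (auto simp: mpolys_in_def)
    then show ?thesis
      using assms(2) m p(3)[OF that False] unfolding revlex_downset_def by blast
  qed (use m in simp)
  then show "m \<in> lead_monoms {p\<in>W. keys p \<subseteq> B}"
    using p by (intro lead_monomsI[of p]) auto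
qed

lemma revlex_downset_bounded: "revlex_downset n {m. monom_deg m \<le> D}"
  by (auto simp: revlex_downset_def revlex_less_def)

lemma finite_lead_monoms_bounded:
  assumes "W \<subseteq> mpolys_in {..<n}"
  shows "finite (lead_monoms W \<inter> {m. monom_deg m \<le> D})"
proof (rule finite_subset)
  show "lead_monoms W \<inter> {m. monom_deg m \<le> D} \<subseteq> {m. keys m \<subseteq> {..<n} \<and> monom_deg m \<le> D}"
    using assms lead_monoms_subset_keys[of W] unfolding mpolys_in_def by blast
qed (simp add: finite_bounded_monoms)

lemma mat_act_degree_le:
  fixes p :: "(nat, 'k::field) mpoly"
  assumes "p \<in> mpolys_in {..<n}" "keys p \<subseteq> {m. monom_deg m \<le> D}"
  shows "keys (mat_act n g p) \<subseteq> {m. monom_deg m \<le> D}"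
proof
  interpret comm_ring_hom "mat_act n g" by (rule mat_act_hom)
  fix m assume "m \<in> keys (mat_act n g p)"
  then have "homog_part (monom_deg m) (mat_act n g p) \<noteq> 0"
    by (metis (mono_tags) keys_homog_part keys_zero empty_iff mem_Collect_eq)
  then have "homog_part (monom_deg m) p \<noteq> 0"
    unfolding homog_part_mat_act[OF assms(1)] by auto
  then have "keys (homog_part (monom_deg m) p) \<noteq> {}"
    by simp
  then show "m \<in> {m. monom_deg m \<le> D}"
    using assms(2) by (auto simp: keys_homog_part)
qed

lemma linear_mat_act: "Vector_Spaces.linear poly_scale poly_scale (mat_act n g)"
proof -
  interpret comm_ring_hom "mat_act n g" by (rule mat_act_hom)
  show ?thesis
    by unfold_locales (simp_all add: hom_add hom_mult poly_scale_def)
qed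

lemma subspace_ideal:
  assumes "ideal J (poly_ring n)"
  shows "poly_vs.subspace J"
  by (rule poly_vs.subspaceI)
    (use ideal_poly_ringD[OF assms] in \<open>auto simp: poly_scale_def\<close>)

lemma subspace_supported_in:
  assumes "poly_vs.subspace W"
  shows "poly_vs.subspace {p\<in>W. keys p \<subseteq> B}"
proof (rule poly_vs.subspaceI)
  fix p q assume "p \<in> {p\<in>W. keys p \<subseteq> B}" "q \<in> {p\<in>W. keys p \<subseteq> B}"
  then show "p + q \<in> {p\<in>W. keys p \<subseteq> B}"
    using keys_add[of p q] poly_vs.subspace_add[OF assms] by auto
next
  fix c p assume "p \<in> {p\<in>W. keys p \<subseteq> B}"
  then show "poly_scale c p \<in> {p\<in>W. keys p \<subseteq> B}"
    using poly_vs.subspace_scale[OF assms] by (auto simp: in_keys_iff)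
qed (use poly_vs.subspace_0[OF assms] in simp)

lemma det_eq_0_iff_kernel:
  fixes A :: "nat \<Rightarrow> nat \<Rightarrow> 'k::field"
  shows "det (mat r r (\<lambda>(i, j). A i j)) = 0 \<longleftrightarrow>
    (\<exists>v. (\<exists>j<r. v j \<noteq> 0) \<and> (\<forall>i<r. (\<Sum>j<r. A i j * v j) = 0))"
proof -
  let ?A = "mat r r (\<lambda>(i, j). A i j)"
  have "det ?A = 0 \<longleftrightarrow> (\<exists>v. v \<in> carrier_vec r \<and> v \<noteq> 0\<^sub>v r \<and> ?A *\<^sub>v v = 0\<^sub>v r)"
    by (rule det_0_iff_vec_prod_zero) simp
  also have "\<dots> \<longleftrightarrow> (\<exists>v. (\<exists>j<r. v j \<noteq> 0) \<and> (\<forall>i<r. (\<Sum>j<r. A i j * v j) = 0))"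
  proof
    assume "\<exists>v. v \<in> carrier_vec r \<and> v \<noteq> 0\<^sub>v r \<and> ?A *\<^sub>v v = 0\<^sub>v r"
    then obtain v where v: "v \<in> carrier_vec r" "v \<noteq> 0\<^sub>v r" "?A *\<^sub>v v = 0\<^sub>v r"
      by blast
    have "\<exists>j<r. v $ j \<noteq> 0"
      using v(1,2) by (metis carrier_vecD eq_vecI index_zero_vec)
    moreover have "(\<Sum>j<r. A i j * v $ j) = 0" if "i < r" for i
      using arg_cong[OF v(3), of "\<lambda>w. w $ i"] that v(1)
      by (simp add: scalar_prod_def lessThan_atLeast0)
    ultimately show "\<exists>v. (\<exists>j<r. v j \<noteq> 0) \<and> (\<forall>i<r. (\<Sum>j<r. A i j * v j) = 0)"
      by blast
  next
    assume "\<exists>v. (\<exists>j<r. v j \<noteq> 0) \<and> (\<forall>i<r. (\<Sum>j<r. A i j * v j) = 0)"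
    then obtain v j where v: "j < r" "v j \<noteq> 0" "\<And>i. i < r \<Longrightarrow> (\<Sum>j<r. A i j * v j) = 0"
      by blast
    have "vec r v \<noteq> 0\<^sub>v r"
      using v(1,2) by (metis index_vec index_zero_vec(1))
    moreover have "?A *\<^sub>v vec r v = 0\<^sub>v r"
      by (rule eq_vecI) (auto simp: scalar_prod_def lessThan_atLeast0[symmetric] v(3))
    ultimately show "\<exists>v. v \<in> carrier_vec r \<and> v \<noteq> 0\<^sub>v r \<and> ?A *\<^sub>v v = 0\<^sub>v r"
      by (intro exI[of _ "vec r v"]) auto
  qed
  finally show ?thesis .
qed

text \<open>Let \<open>S\<close> be the set of leading monomials of \<open>a I\<close> up to degree \<open>D\<close>, and let \<open>f m\<close>, for \<open>m\<close> in \<open>S\<close>, be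
  elements of \<open>I\<close> whose images under \<open>a\<close> have these leading monomials; they form a basis of the part of
  \<open>I\<close> of degree at most \<open>D\<close>. The function \<open>F g\<close> is the minor formed by the coefficients of the
  polynomials \<open>g (f m)\<close> at the monomials in \<open>S\<close>. Where it does not vanish, an element of \<open>g I\<close> of
  degree at most \<open>D\<close> is determined by its coefficients at \<open>S\<close>. For the elements supported in an initial
  segment \<open>B\<close> these coefficients live on the intersection of \<open>S\<close> with \<open>B\<close>, so that \<open>g I\<close> has at most
  as many leading monomials in \<open>B\<close> as \<open>a I\<close>.\<close>

lemma lead_monoms_semicontinuous:
  fixes I :: "(nat, 'k::field) mpoly set"
  assumes I: "ideal I (poly_ring n)" and a: "a \<in> GL n"
  obtains F where "entry_polynomial n F" "F a \<noteq> 0"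
    "\<And>g B. g \<in> GL n \<Longrightarrow> F g \<noteq> 0 \<Longrightarrow> revlex_downset n B \<Longrightarrow> B \<subseteq> {m. monom_deg m \<le> D} \<Longrightarrow>
      card (lead_monoms (mat_act n g ` I) \<inter> B) \<le> card (lead_monoms (mat_act n a ` I) \<inter> B)"
proof -
  let ?D = "{m :: nat \<Rightarrow>\<^sub>0 nat. monom_deg m \<le> D}"
  define W where "W g = {p \<in> mat_act n g ` I. keys p \<subseteq> ?D}" for g
  define S where "S = lead_monoms (mat_act n a ` I) \<inter> ?D"
  have gI: "ideal (mat_act n g ` I) (poly_ring n)" if "g \<in> GL n" for g
    by (rule ideal_mat_act[OF I that])
  have gI_vars: "mat_act n g ` I \<subseteq> mpolys_in {..<n}" if "g \<in> GL n" for g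
    using ideal_poly_ringD(1)[OF gI[OF that]] by blast
  have S: "S = lead_monoms (W a)"
    unfolding S_def W_def
    using lead_monoms_supported_in_downset[OF gI_vars[OF a] revlex_downset_bounded] by simp
  have fin: "finite S"
    unfolding S_def by (rule finite_lead_monoms_bounded[OF gI_vars[OF a]])
  have W: "poly_vs.subspace (W g)" if "g \<in> GL n" for g
    unfolding W_def by (intro subspace_supported_in subspace_ideal[OF gI[OF that]])
  have pull_back: "q \<in> I" "q \<in> mpolys_in {..<n}" "mat_act n b (mat_act n g q) = q"
      "keys q \<subseteq> ?D" if "mat_act n g q \<in> W g" "q \<in> I" "b * g = 1\<^sub>m n" "b \<in> GL n" "g \<in> GL n"
    for g b q
  proof -
    show "q \<in> I" by fact
    show q: "q \<in> mpolys_in {..<n}"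
      using I that(2) by (rule ideal_poly_ringD)
    show eq: "mat_act n b (mat_act n g q) = q"
      by (rule mat_act_inverse[OF that(3-5) q])
    show "keys q \<subseteq> ?D"
      using mat_act_degree_le[OF mat_act_in_mpolys[OF q], of g D b] that(1)
      unfolding eq W_def by simp
  qed
  obtain w where w: "\<And>m. m \<in> S \<Longrightarrow> w m \<in> W a \<and> w m \<noteq> 0 \<and> lead_monom (w m) = m"
    unfolding S using lead_monoms_representatives by metis
  have "\<exists>q\<in>I. mat_act n a q = w m" if "m \<in> S" for m
    using w[OF that] by (auto simp: W_def)
  then obtain f where f: "\<And>m. m \<in> S \<Longrightarrow> f m \<in> I \<and> mat_act n a (f m) = w m"
    by metis
  obtain e where e: "bij_betw e {..<card S} S"
    using ex_bij_betw_nat_finite[OF fin] by (auto simp: lessThan_atLeast0)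
  let ?r = "card S"
  define c where "c g i j = lookup (mat_act n g (f (e j))) (e i)" for g i j
  define F where "F g = det (mat ?r ?r (\<lambda>(i, j). c g i j))" for g
  have eS: "e i \<in> S" if "i < ?r" for i
    using e that by (auto simp: bij_betw_def)
  show thesis
  proof
    show "entry_polynomial n F"
      unfolding F_def c_def
      by (intro entry_polynomial_det entry_polynomial_coefficient)
        (use f eS ideal_poly_ringD(1)[OF I] in auto)
    \<comment> \<open>A kernel vector would give an element of \<open>a I\<close> without monomials in \<open>S\<close>, although its leading
      monomial has to be one of them.\<close>
    show "F a \<noteq> 0"
    proof
      assume "F a = 0"
      then obtain v i where v: "i < ?r" "v i \<noteq> 0" "\<And>i. i < ?r \<Longrightarrow> (\<Sum>j<?r. c a i j * v j) = 0"
        unfolding F_def det_eq_0_iff_kernel by blast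
      define u where "u m = v (inv_into {..<?r} e m)" for m
      have u: "u (e j) = v j" if "j < ?r" for j
        using e that by (simp add: u_def bij_betw_def)
      define h where "h = (\<Sum>m\<in>S. poly_scale (u m) (w m))"
      have "h \<in> W a"
        unfolding h_def using W[OF a] w
        by (intro poly_vs.subspace_sum poly_vs.subspace_scale) auto
      have "lookup h m = 0" if "m \<in> S" for m
      proof -
        obtain i where i: "i < ?r" "m = e i"
          using e \<open>m \<in> S\<close> by (auto simp: bij_betw_def)
        have "lookup h m = (\<Sum>k\<in>S. u k * lookup (w k) m)"
          by (simp add: h_def lookup_sum)
        also have "\<dots> = (\<Sum>j<?r. u (e j) * lookup (w (e j)) m)"
          by (rule sum.reindex_bij_betw[OF e, symmetric])
        also have "\<dots> = (\<Sum>j<?r. c a i j * v j)"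
          by (rule sum.cong) (use u f eS in \<open>auto simp: c_def i(2)\<close>)
        finally show ?thesis
          using v(3)[OF i(1)] by simp
      qed
      then have "h = 0"
        using lead_monom_in_lead_monoms[OF \<open>h \<in> W a\<close>] lead_monom_props(1)[of h]
        by (auto simp: S in_keys_iff)
      then have "u (e i) = 0"
        using distinct_lead_monoms_independent[OF fin, of w u "e i"] w eS[OF v(1)]
        by (auto simp: h_def)
      then show False
        using v u by simp
    qed
    fix g B
    assume g: "g \<in> GL n" "F g \<noteq> 0" and B: "revlex_downset n B" "B \<subseteq> ?D"
    \<comment> \<open>Restriction to \<open>S\<close> maps \<open>?W\<close> injectively to the polynomials supported in \<open>S \<inter> B\<close>.\<close>
    let ?W = "{p \<in> mat_act n g ` I. keys p \<subseteq> B}"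
    let ?W' = "{p \<in> UNIV :: (nat, 'k) mpoly set. keys p \<subseteq> S \<inter> B}"
    define T where "T p = (\<Sum>m\<in>S. single m (lookup p m))" for p :: "(nat, 'k) mpoly"
    have T: "lookup (T p) m = (if m \<in> S then lookup p m else 0)" for p m
      using fin by (simp add: T_def lookup_sum lookup_single when_def)
    have LM: "lead_monoms ?W = lead_monoms (mat_act n g ` I) \<inter> B"
      by (rule lead_monoms_supported_in_downset[OF gI_vars[OF g(1)] B(1)])
    have LM': "lead_monoms ?W' \<subseteq> S \<inter> B"
      using lead_monoms_subset_keys[of ?W'] by auto
    have "card (lead_monoms ?W) \<le> card (lead_monoms ?W')"
    proof (rule card_lead_monoms_le[where T = T])
      show "finite (lead_monoms ?W)"
        unfolding LM
        by (rule finite_subset[OF _ finite_lead_monoms_bounded[OF gI_vars[OF g(1)], of D]])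
          (use B(2) in auto)
      show "finite (lead_monoms ?W')"
        using LM' fin by (auto intro: finite_subset)
      show "poly_vs.subspace ?W"
        by (intro subspace_supported_in subspace_ideal[OF gI[OF g(1)]])
      show "poly_vs.subspace ?W'"
        by (intro subspace_supported_in poly_vs.subspace_UNIV)
      show "Vector_Spaces.linear poly_scale poly_scale T"
        by unfold_locales (auto intro!: poly_mapping_eqI simp: T lookup_add)
      show "T ` ?W \<subseteq> ?W'"
        by (auto simp: in_keys_iff T split: if_splits)
    next
      fix p assume p: "p \<in> ?W" "T p = 0"
      obtain q where q: "q \<in> I" "p = mat_act n g q"
        using p(1) by blast
      interpret A: Vector_Spaces.linear poly_scale poly_scale "mat_act n a"
        by (rule linear_mat_act)
      interpret G: Vector_Spaces.linear poly_scale poly_scale "mat_act n g"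
        by (rule linear_mat_act)
      obtain b where b: "b \<in> GL n" "b * g = 1\<^sub>m n"
        using GL_inverse[OF g(1)] by metis
      obtain b' where b': "b' \<in> GL n" "b' * a = 1\<^sub>m n"
        using GL_inverse[OF a] by metis
      have "mat_act n g q \<in> W g"
        using p(1) B(2) by (auto simp: W_def q(2))
      note qD = pull_back[OF this q(1) b(2,1) g(1)]
      have "mat_act n a q \<in> W a"
        using q(1) mat_act_degree_le[OF qD(2,4)] by (auto simp: W_def)
      then obtain u where u: "mat_act n a q = (\<Sum>m\<in>S. poly_scale (u m) (w m))"
        using reduction_by_lead_monoms[OF W[OF a] _ w[unfolded S], of "mat_act n a q"] fin
        by (auto simp: S)
      let ?s = "\<Sum>m\<in>S. poly_scale (u m) (f m)"
      have s: "?s \<in> I"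
        using f by (intro poly_vs.subspace_sum poly_vs.subspace_scale subspace_ideal[OF I]) auto
      have "mat_act n a q = mat_act n a ?s"
        using f by (simp add: u A.sum A.scale)
      then have "q = ?s"
        using mat_act_inverse[OF b'(2,1) a] ideal_poly_ringD(1)[OF I] q(1) s by metis
      then have p_eq: "p = (\<Sum>m\<in>S. poly_scale (u m) (mat_act n g (f m)))"
        by (simp add: q(2) G.sum G.scale)
      have zero: "(\<Sum>j<?r. c g i j * u (e j)) = 0" if "i < ?r" for i
      proof -
        have "lookup p (e i) = 0"
          using T[of p "e i"] p(2) eS[OF that] by simp
        also have "lookup p (e i) = (\<Sum>m\<in>S. u m * lookup (mat_act n g (f m)) (e i))"
          by (simp add: p_eq lookup_sum)
        also have "\<dots> = (\<Sum>j<?r. u (e j) * lookup (mat_act n g (f (e j))) (e i))"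
          by (rule sum.reindex_bij_betw[OF e, symmetric])
        finally show ?thesis
          by (simp add: c_def mult.commute)
      qed
      have "u (e j) = 0" if "j < ?r" for j
      proof (rule ccontr)
        assume "u (e j) \<noteq> 0"
        then have "F g = 0"
          unfolding F_def det_eq_0_iff_kernel using zero that by (intro exI[of _ "\<lambda>j. u (e j)"]) auto
        then show False
          using g(2) by simp
      qed
      moreover have "m \<in> e ` {..<?r}" if "m \<in> S" for m
        using e that by (simp add: bij_betw_def)
      ultimately have "u m = 0" if "m \<in> S" for m
        using that by blast
      then show "p = 0"
        by (simp add: p_eq)
    qed
    also have "\<dots> \<le> card (S \<inter> B)"
      by (rule card_mono) (use LM' fin in auto)
    also have "S \<inter> B = lead_monoms (mat_act n a ` I) \<inter> B"
      using B(2) by (auto simp: S_def)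
    finally show "card (lead_monoms (mat_act n g ` I) \<inter> B) \<le>
        card (lead_monoms (mat_act n a ` I) \<inter> B)"
      unfolding LM .
  qed
qed

section \<open>The generic initial ideal\<close>

lemma one_in_GL: "1\<^sub>m n \<in> GL n"
  by (rule GL_I[of _ n "1\<^sub>m n"]) auto

text \<open>Uniqueness in the definition of \<^const>\<open>gin\<close>: two nonempty open sets meet, so two ideals that are both
  generic initial ideals are realized by a common matrix.\<close>

lemma gin_eqI:
  fixes I :: "(nat, 'k::field_char_0) mpoly set"
  assumes F: "entry_polynomial n F" "a \<in> GL n" "F a \<noteq> 0"
    and M: "\<And>g. g \<in> GL n \<Longrightarrow> F g \<noteq> 0 \<Longrightarrow> initial_ideal n (mat_act n g ` I) = M"
  shows "gin n I = M"
  unfolding gin_def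
proof (rule the_equality)
  obtain p where p: "p \<in> mpolys_in ({..<n} \<times> {..<n})" "\<And>g. F g = subst_poly id (\<lambda>ij. g $$ ij) p"
    using F(1) unfolding entry_polynomial_def by blast
  let ?U = "{g \<in> GL n. F g \<noteq> 0}"
  have "zariski_open_GL n ?U"
    unfolding zariski_open_GL_def by (rule exI[of _ "{p}"]) (use p in auto)
  then show "\<exists>U. zariski_open_GL n U \<and> U \<noteq> {} \<and> (\<forall>g\<in>U. initial_ideal n (mat_act n g ` I) = M)"
    using F M by (intro exI[of _ ?U]) auto
next
  fix M'
  assume "\<exists>U. zariski_open_GL n U \<and> U \<noteq> {} \<and>
    (\<forall>g\<in>U. initial_ideal n (mat_act n g ` I) = M')"
  then obtain U where U: "zariski_open_GL n U" "U \<noteq> {}"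
    "\<And>g. g \<in> U \<Longrightarrow> initial_ideal n (mat_act n g ` I) = M'"
    by blast
  obtain P where P: "P \<subseteq> mpolys_in ({..<n} \<times> {..<n})"
    "U = {g \<in> GL n. \<exists>p\<in>P. subst_poly id (\<lambda>ij. g $$ ij) p \<noteq> 0}"
    using U(1) unfolding zariski_open_GL_def by blast
  obtain b where "b \<in> U"
    using U(2) by blast
  then obtain q where q: "b \<in> GL n" "q \<in> P" "subst_poly id (\<lambda>ij. b $$ ij) q \<noteq> 0"
    unfolding P by blast
  have "entry_polynomial n (\<lambda>g. subst_poly id (\<lambda>ij. g $$ ij) q)"
    unfolding entry_polynomial_def using q(2) P(1) by blast
  from nonempty_opens_meet[OF F this q(1,3)] obtain g
    where g: "g \<in> GL n" "F g \<noteq> 0" "subst_poly id (\<lambda>ij. g $$ ij) q \<noteq> 0"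
    by blast
  then have "g \<in> U"
    using q(2) unfolding P by blast
  then show "M' = M"
    using U(3) M g by metis
qed

lemma revlex_downset_less: "revlex_downset n {k. revlex_less k m}"
  using revlex_less_trans by (auto simp: revlex_downset_def)

lemma revlex_downset_le: "revlex_downset n {k. revlex_less k m \<or> k = m}"
  using revlex_less_trans by (auto simp: revlex_downset_def)

lemma lead_monoms_contain_high_degrees:
  fixes I :: "(nat, 'k::field) mpoly set"
  assumes I: "ideal I (poly_ring n)" and g: "g \<in> GL n"
    and "forms n d \<subseteq> I" and m: "m \<in> monoms n d"
  shows "m \<in> lead_monoms (mat_act n g ` I)"
proof -
  obtain b where b: "b \<in> GL n" "g * b = 1\<^sub>m n"
    using GL_inverse[OF g] by metis
  have m': "single m 1 \<in> forms n d"
    by (rule single_in_forms[OF m])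
  then have "mat_act n b (single m 1) \<in> I"
    using mat_act_forms[OF m'] assms(3) by blast
  moreover have "mat_act n g (mat_act n b (single m 1)) = (single m 1 :: (nat, 'k) mpoly)"
    by (rule mat_act_inverse[OF b(2) g b(1) forms_in_mpolys[OF m']])
  ultimately have "(single m 1 :: (nat, 'k) mpoly) \<in> mat_act n g ` I"
    by (metis image_eqI)
  then show ?thesis
    by (rule lead_monomsI) auto
qed

text \<open>Choose \<open>a\<close> such that the total number \<open>N a\<close> of leading monomials in all initial segments is minimal. By
  semicontinuity every single count can only drop on a neighbourhood of \<open>a\<close>; by minimality none drops.
  A monomial is a leading monomial iff the counts in the segments below it, with and without the
  monomial itself, differ. Hence the leading monomials are the same on the whole neighbourhood. Only finitely
  many monomials have to be controlled, because all those of degree above \<open>D\<close> are leading monomials.\<close>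

lemma gin_generic:
  fixes I :: "(nat, 'k::field_char_0) mpoly set"
  assumes I: "ideal I (poly_ring n)" and D: "\<And>d. d > D \<Longrightarrow> forms n d \<subseteq> I"
  obtains F a where "entry_polynomial n F" "a \<in> GL n" "F a \<noteq> 0"
    "\<And>g. g \<in> GL n \<Longrightarrow> F g \<noteq> 0 \<Longrightarrow> initial_ideal n (mat_act n g ` I) = gin n I"
proof -
  define L where "L g = lead_monoms (mat_act n g ` I)" for g
  let ?B = "{m. keys m \<subseteq> {..<n} \<and> monom_deg m \<le> D}"
  let ?lt = "\<lambda>m. {k. revlex_less k m}" and ?le = "\<lambda>m. {k. revlex_less k m \<or> k = m}"
  define N where "N g = (\<Sum>m\<in>?B. card (L g \<inter> ?lt m) + card (L g \<inter> ?le m))" for g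
  have finB: "finite ?B"
    by (simp add: finite_bounded_monoms)
  obtain a where a: "a \<in> GL n" "\<And>g. g \<in> GL n \<Longrightarrow> N a \<le> N g"
    using ex_has_least_nat[of "\<lambda>g. g \<in> GL n" "1\<^sub>m n" N] one_in_GL by blast
  obtain F where F: "entry_polynomial n F" "F a \<noteq> 0"
    and semi: "\<And>g B. g \<in> GL n \<Longrightarrow> F g \<noteq> 0 \<Longrightarrow> revlex_downset n B \<Longrightarrow>
      B \<subseteq> {m. monom_deg m \<le> D} \<Longrightarrow> card (L g \<inter> B) \<le> card (L a \<inter> B)"
    unfolding L_def by (rule lead_monoms_semicontinuous[OF I a(1), of D]) blast
  have gI: "ideal (mat_act n g ` I) (poly_ring n)" if "g \<in> GL n" for g
    by (rule ideal_mat_act[OF I that])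
  have same: "L g = L a" if g: "g \<in> GL n" "F g \<noteq> 0" for g
  proof -
    have sub: "?lt m \<subseteq> {m. monom_deg m \<le> D}" "?le m \<subseteq> {m. monom_deg m \<le> D}"
      if "m \<in> ?B" for m
      using that by (auto simp: revlex_less_def)
    have le: "card (L g \<inter> ?lt m) \<le> card (L a \<inter> ?lt m)" "card (L g \<inter> ?le m) \<le> card (L a \<inter> ?le m)"
      if "m \<in> ?B" for m
      using semi[OF g revlex_downset_less sub(1)[OF that]]
        semi[OF g revlex_downset_le sub(2)[OF that]] by auto
    have eq: "card (L g \<inter> ?lt m) + card (L g \<inter> ?le m) = card (L a \<inter> ?lt m) + card (L a \<inter> ?le m)"
      if "m \<in> ?B" for m
    proof (rule ccontr)
      assume "\<not> ?thesis"
      then have "\<exists>m\<in>?B. card (L g \<inter> ?lt m) + card (L g \<inter> ?le m) <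
          card (L a \<inter> ?lt m) + card (L a \<inter> ?le m)"
        using le[OF that] that by (intro bexI[of _ m]) auto
      then have "N g < N a"
        unfolding N_def using le finB by (intro sum_strict_mono_ex1) (auto intro: add_mono)
      then show False
        using a(2)[OF g(1)] by simp
    qed
    have count: "card (L h \<inter> ?le m) = card (L h \<inter> ?lt m) + (if m \<in> L h then 1 else 0)"
      if "m \<in> ?B" "h \<in> GL n" for m h
    proof -
      have "finite (L h \<inter> ?lt m)"
      proof (rule finite_subset)
        show "finite (L h \<inter> {m. monom_deg m \<le> D})"
          unfolding L_def
          by (rule finite_lead_monoms_bounded) (use ideal_poly_ringD(1)[OF gI[OF that(2)]] in blast)
      qed (use sub(1)[OF that(1)] in blast)
      moreover have "L h \<inter> ?le m = (if m \<in> L h then insert m (L h \<inter> ?lt m) else L h \<inter> ?lt m)"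
        by auto
      ultimately show ?thesis
        by simp
    qed
    have bounded: "m \<in> L g \<longleftrightarrow> m \<in> L a" if "m \<in> ?B" for m
    proof -
      have "card (L g \<inter> ?lt m) = card (L a \<inter> ?lt m)" "card (L g \<inter> ?le m) = card (L a \<inter> ?le m)"
        using eq[OF that] le[OF that] by linarith+
      then show ?thesis
        using count[OF that g(1)] count[OF that a(1)] by (simp split: if_splits)
    qed
    have high: "m \<in> L h" if "keys m \<subseteq> {..<n}" "monom_deg m > D" "h \<in> GL n" for m h
      unfolding L_def
      by (rule lead_monoms_contain_high_degrees[OF I that(3) D[OF that(2)]])
        (use that in \<open>simp add: monoms_def\<close>)
    have vars: "keys m \<subseteq> {..<n}" if "m \<in> L h" "h \<in> GL n" for m h
      using lead_monoms_in_vars[OF gI[OF that(2)]] that(1) unfolding L_def .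
    show "L g = L a"
    proof (rule Set.set_eqI)
      fix m
      show "m \<in> L g \<longleftrightarrow> m \<in> L a"
      proof (cases "keys m \<subseteq> {..<n}")
        case True
        then show ?thesis
          using bounded[of m] high[of m g] high[of m a] g(1) a(1) by (cases "monom_deg m \<le> D") auto
      qed (use vars g(1) a(1) in blast)
    qed
  qed
  have "initial_ideal n (mat_act n g ` I) = initial_ideal n (mat_act n a ` I)"
    if "g \<in> GL n" "F g \<noteq> 0" for g
    using same[OF that] gI[OF that(1)] gI[OF a(1)] by (simp add: initial_ideal_eq L_def)
  moreover from this have "gin n I = initial_ideal n (mat_act n a ` I)"
    by (rule gin_eqI[OF F(1) a(1) F(2)])
  ultimately show thesis
    using that[OF F(1) a(1) F(2)] by simp
qed

text \<open>The neighbourhood of \<open>a\<close> on which all counts are at most those of \<open>a\<close> meets the open set of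
  matrices that realize the generic initial ideal.\<close>

lemma gin_minimizes_downset_counts:
  fixes I :: "(nat, 'k::field_char_0) mpoly set"
  assumes I: "ideal I (poly_ring n)" and D: "\<And>d. d > D \<Longrightarrow> forms n d \<subseteq> I" and a: "a \<in> GL n"
  obtains g where "g \<in> GL n" "initial_ideal n (mat_act n g ` I) = gin n I"
    "\<And>B. revlex_downset n B \<Longrightarrow> B \<subseteq> {m. monom_deg m \<le> D} \<Longrightarrow>
      card (lead_monoms (mat_act n g ` I) \<inter> B) \<le> card (lead_monoms (mat_act n a ` I) \<inter> B)"
proof -
  obtain F b where F: "entry_polynomial n F" "b \<in> GL n" "F b \<noteq> 0"
    "\<And>g. g \<in> GL n \<Longrightarrow> F g \<noteq> 0 \<Longrightarrow> initial_ideal n (mat_act n g ` I) = gin n I"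
    using gin_generic[OF I D] by blast
  obtain G where G: "entry_polynomial n G" "G a \<noteq> 0"
    "\<And>g B. g \<in> GL n \<Longrightarrow> G g \<noteq> 0 \<Longrightarrow> revlex_downset n B \<Longrightarrow> B \<subseteq> {m. monom_deg m \<le> D} \<Longrightarrow>
      card (lead_monoms (mat_act n g ` I) \<inter> B) \<le> card (lead_monoms (mat_act n a ` I) \<inter> B)"
    by (rule lead_monoms_semicontinuous[OF I a, of D]) blast
  obtain g where "g \<in> GL n" "F g \<noteq> 0" "G g \<noteq> 0"
    using nonempty_opens_meet[OF F(1-3) G(1) a G(2)] by blast
  then show thesis
    using that F(4) G(3) by blast
qed

text \<open>The number of leading monomials of degree at most \<open>D\<close> is the dimension of that part of the
  ideal, and the action maps it isomorphically to the corresponding part of the image.\<close>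

lemma card_lead_monoms_mat_act:
  fixes I :: "(nat, 'k::field) mpoly set"
  assumes I: "ideal I (poly_ring n)" and g: "g \<in> GL n"
  shows "card (lead_monoms (mat_act n g ` I) \<inter> {m. monom_deg m \<le> D}) =
    card (lead_monoms I \<inter> {m. monom_deg m \<le> D})"
proof -
  let ?B = "{m :: nat \<Rightarrow>\<^sub>0 nat. monom_deg m \<le> D}"
  have le: "card (lead_monoms J \<inter> ?B) \<le> card (lead_monoms (mat_act n h ` J) \<inter> ?B)"
    if J: "ideal J (poly_ring n)" and h: "h \<in> GL n" for J :: "(nat, 'k) mpoly set" and h
  proof -
    let ?W = "{p \<in> J. keys p \<subseteq> ?B}" and ?W' = "{p \<in> mat_act n h ` J. keys p \<subseteq> ?B}"
    note hJ = ideal_mat_act[OF J h]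
    have vars: "J \<subseteq> mpolys_in {..<n}" "mat_act n h ` J \<subseteq> mpolys_in {..<n}"
      using ideal_poly_ringD(1)[OF J] ideal_poly_ringD(1)[OF hJ] by blast+
    note LM = lead_monoms_supported_in_downset[OF vars(1) revlex_downset_bounded, of D]
      lead_monoms_supported_in_downset[OF vars(2) revlex_downset_bounded, of D]
    obtain b where b: "b \<in> GL n" "b * h = 1\<^sub>m n"
      using GL_inverse[OF h] by metis
    have "card (lead_monoms ?W) \<le> card (lead_monoms ?W')"
    proof (rule card_lead_monoms_le[OF _ _ _ _ linear_mat_act[of n h]])
      show "poly_vs.subspace ?W" "poly_vs.subspace ?W'"
        by (intro subspace_supported_in subspace_ideal[OF J] subspace_ideal[OF hJ])+
      show "finite (lead_monoms ?W)" "finite (lead_monoms ?W')"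
        unfolding LM
        by (rule finite_lead_monoms_bounded[OF vars(1)], rule finite_lead_monoms_bounded[OF vars(2)])
      show "mat_act n h ` ?W \<subseteq> ?W'"
        using vars(1) mat_act_degree_le[of _ n D h] by blast
      fix p assume p: "p \<in> ?W" "mat_act n h p = 0"
      interpret comm_ring_hom "mat_act n b" by (rule mat_act_hom)
      have "p = mat_act n b (mat_act n h p)"
        using mat_act_inverse[OF b(2,1) h] p(1) vars(1) by auto
      then show "p = 0"
        using p(2) by simp
    qed
    then show ?thesis
      unfolding LM .
  qed
  obtain b where b: "b \<in> GL n" "b * g = 1\<^sub>m n"
    using GL_inverse[OF g] by metis
  have "mat_act n b ` mat_act n g ` I = I"
    using mat_act_inverse[OF b(2,1) g] ideal_poly_ringD(1)[OF I] by (simp add: image_image)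
  then show ?thesis
    using le[OF I g] le[OF ideal_mat_act[OF I g] b(1)] by simp
qed

section \<open>Graded ideals and their quotients\<close>

lemma homog_part_mult_form:
  fixes p q :: "(nat, 'k::field) mpoly"
  assumes "q \<in> forms n a" "p \<in> mpolys_in {..<n}"
  shows "homog_part d (q * p) = (if a \<le> d then q * homog_part (d - a) p else 0)"
proof -
  let ?D = "insert (d - a) (monom_deg ` keys p)"
  have fin: "finite ?D"
    by simp
  have form: "q * homog_part e p \<in> forms n (a + e)" for e
    using forms_mult[OF assms(1) homog_part_forms[OF assms(2)]] .
  have "q * p = (\<Sum>e\<in>?D. q * homog_part e p)"
    using sum_homog_parts[OF fin subset_insertI, symmetric] by (simp only: sum_distrib_left[symmetric])
  then have "homog_part d (q * p) = (\<Sum>e\<in>?D. homog_part d (q * homog_part e p))"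
    by (simp only: homog_part_sum)
  also have "\<dots> = (\<Sum>e\<in>?D. if e = d - a then
      (if a \<le> d then q * homog_part (d - a) p else 0) else 0)"
    by (rule sum.cong) (auto simp: homog_part_of_form[OF form])
  also have "\<dots> = (if a \<le> d then q * homog_part (d - a) p else 0)"
    using fin by (subst sum.delta) auto
  finally show ?thesis .
qed

text \<open>An ideal generated by forms contains the homogeneous parts of its elements: the polynomials
  all of whose homogeneous parts lie in the ideal form an ideal that contains the generators.\<close>

lemma homogeneous_ideal_homog_part:
  fixes I :: "(nat, 'k::field) mpoly set"
  assumes "homogeneous_ideal n I" "p \<in> I"
  shows "homog_part d p \<in> I"
proof -
  interpret cring "poly_ring n :: (nat, 'k) mpoly ring"
    by (rule cring_poly_ring)
  have I: "ideal I (poly_ring n)"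
    using assms(1) unfolding homogeneous_ideal_def by blast
  obtain S where S: "S \<subseteq> (\<Union>d. forms n d)" "I = genideal (poly_ring n) S"
    using assms(1) unfolding homogeneous_ideal_def by blast
  have S_carrier: "S \<subseteq> carrier (poly_ring n)"
    using S(1) by (auto dest: forms_in_mpolys)
  let ?K = "{p \<in> mpolys_in {..<n}. \<forall>d. homog_part d p \<in> I}"
  have "ideal ?K (poly_ring n)"
    unfolding ideal_poly_ring_iff
  proof (intro conjI ballI)
    show "0 \<in> ?K"
      using ideal_poly_ringD(2)[OF I] by (simp add: homog_part_def)
    fix p assume p: "p \<in> ?K"
    {
      fix q assume "q \<in> ?K"
      then show "p + q \<in> ?K"
        using p ideal_poly_ringD(3)[OF I] by (simp add: homog_part_add mpolys_in_add)
    }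
    fix q :: "(nat, 'k) mpoly"
    assume q: "q \<in> mpolys_in {..<n}"
    have part: "homog_part d (homog_part a q * p) \<in> I" for a d
      using p ideal_poly_ringD(2,4)[OF I] homog_part_forms[OF q, of a]
      by (simp add: homog_part_mult_form[of _ n a] forms_in_mpolys)
    have "q = (\<Sum>a\<in>monom_deg ` keys q. homog_part a q)"
      by (rule sum_homog_parts[symmetric]) auto
    then have "q * p = (\<Sum>a\<in>monom_deg ` keys q. homog_part a q * p)"
      by (metis sum_distrib_right)
    then have "homog_part d (q * p) = (\<Sum>a\<in>monom_deg ` keys q. homog_part d (homog_part a q * p))" for d
      by (simp add: homog_part_sum)
    moreover have "(\<Sum>a\<in>A. homog_part d (homog_part a q * p)) \<in> I" if "finite A" for A d
      using that by (induction A rule: finite_induct) (auto simp: ideal_poly_ringD[OF I] part)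
    ultimately show "q * p \<in> ?K"
      using p q by (simp add: mpolys_in_mult)
  qed auto
  moreover have "S \<subseteq> ?K"
  proof
    fix s assume s: "s \<in> S"
    then obtain e where e: "s \<in> forms n e"
      using S(1) by blast
    have "s \<in> I"
      using genideal_self[OF S_carrier] s S(2) by auto
    then show "s \<in> ?K"
      using ideal_poly_ringD(1,2)[OF I] by (simp add: homog_part_of_form[OF e])
  qed
  ultimately have "I \<subseteq> ?K"
    unfolding S(2) by (rule genideal_minimal)
  then show ?thesis
    using assms(2) by blast
qed

context
  fixes n :: nat and I :: "(nat, 'k::field) mpoly set"
  assumes I: "ideal I (poly_ring n)"
begin

lemma quot_class_image: "quot_class n I p = (\<lambda>h. h + p) ` I"
  unfolding quot_class_def a_r_coset_def' by auto

lemma quot_class_eq_iff: "quot_class n I p = quot_class n I q \<longleftrightarrow> p - q \<in> I"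
proof
  assume "quot_class n I p = quot_class n I q"
  moreover have "p \<in> quot_class n I p"
    unfolding quot_class_image using ideal_poly_ringD(2)[OF I] by force
  ultimately show "p - q \<in> I"
    unfolding quot_class_image by auto
next
  assume pq: "p - q \<in> I"
  have "h + p \<in> (\<lambda>h. h + q) ` I" "h + q \<in> (\<lambda>h. h + p) ` I" if "h \<in> I" for h
  proof -
    have "h + (p - q) \<in> I" "h - (p - q) \<in> I"
      using that pq ideal_poly_ringD[OF I] by blast+
    then show "h + p \<in> (\<lambda>h. h + q) ` I" "h + q \<in> (\<lambda>h. h + p) ` I"
      by (intro image_eqI[of _ _ "h + (p - q)"] image_eqI[of _ _ "h - (p - q)"]; simp)+
  qed
  then show "quot_class n I p = quot_class n I q"
    unfolding quot_class_image by auto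
qed

lemma quot_class_zero: "\<zero>\<^bsub>quot_alg n I\<^esub> = quot_class n I 0"
  unfolding quot_class_image by (simp add: quot_alg_def FactRing_def)

lemma quot_class_one: "\<one>\<^bsub>quot_alg n I\<^esub> = quot_class n I 1"
  by (simp add: quot_alg_def FactRing_def quot_class_def)

lemma quot_class_mult:
  assumes "p \<in> mpolys_in {..<n}" "q \<in> mpolys_in {..<n}"
  shows "quot_class n I p \<otimes>\<^bsub>quot_alg n I\<^esub> quot_class n I q = quot_class n I (p * q)"
  using ideal.rcoset_mult_add[OF I, of p q] assms
  by (simp add: quot_alg_def FactRing_def quot_class_def)

lemma quot_class_power:
  assumes p: "p \<in> mpolys_in {..<n}"
  shows "quot_class n I p [^]\<^bsub>quot_alg n I\<^esub> (e :: nat) = quot_class n I (p ^ e)"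
proof -
  interpret ring "quot_alg n I"
    unfolding quot_alg_def by (rule ideal.quotient_is_ring[OF I])
  show ?thesis
    by (induction e)
      (simp_all add: quot_class_one quot_class_mult[OF mpolys_in_power[OF p] p] mult.commute)
qed

lemma quot_part_nonzero_iff: "quot_part n I d \<noteq> {\<zero>\<^bsub>quot_alg n I\<^esub>} \<longleftrightarrow> \<not> forms n d \<subseteq> I"
proof -
  have "quot_part n I d = {\<zero>\<^bsub>quot_alg n I\<^esub>} \<longleftrightarrow> (\<forall>p\<in>forms n d. quot_class n I p = quot_class n I 0)"
    unfolding quot_part_def quot_class_zero using forms_0[of n d] by blast
  then show ?thesis
    by (auto simp: quot_class_eq_iff)
qed

end

text \<open>Bijectivity of multiplication by \<open>L\<^sup>s\<close> between two graded pieces of \<open>R/J\<close>, expressed on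
  representatives.\<close>

definition mult_bijective ::
  "nat \<Rightarrow> (nat, 'k::field) mpoly set \<Rightarrow> (nat, 'k) mpoly \<Rightarrow> nat \<Rightarrow> nat \<Rightarrow> bool" where
  "mult_bijective n J L i s \<longleftrightarrow>
     (\<forall>p\<in>forms n i. L ^ s * p \<in> J \<longrightarrow> p \<in> J) \<and>
     (\<forall>q\<in>forms n (i + s). \<exists>p\<in>forms n i. q - L ^ s * p \<in> J)"

lemma bij_betw_quot_part_iff:
  fixes I :: "(nat, 'k::field) mpoly set"
  assumes I: "ideal I (poly_ring n)" and L: "L \<in> forms n 1"
  shows "bij_betw (\<lambda>a. (quot_class n I L [^]\<^bsub>quot_alg n I\<^esub> s) \<otimes>\<^bsub>quot_alg n I\<^esub> a)
      (quot_part n I i) (quot_part n I (i + s)) \<longleftrightarrow> mult_bijective n I L i s"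
proof -
  let ?c = "quot_class n I"
  let ?f = "\<lambda>a. (?c L [^]\<^bsub>quot_alg n I\<^esub> s) \<otimes>\<^bsub>quot_alg n I\<^esub> a"
  note L' = forms_in_mpolys[OF L]
  have f: "?f (?c p) = ?c (L ^ s * p)" if "p \<in> forms n i" for p
    by (simp add: quot_class_power[OF I L'] quot_class_mult[OF I] mpolys_in_power[OF L']
        forms_in_mpolys[OF that])
  have form: "L ^ s * p \<in> forms n (i + s)" if "p \<in> forms n i" for p
    using forms_mult[OF forms_power[OF L, of s] that] by (simp add: add.commute)
  have eq: "?c p = ?c q \<longleftrightarrow> p - q \<in> I" for p q
    by (rule quot_class_eq_iff[OF I])
  have inj: "inj_on ?f (quot_part n I i) \<longleftrightarrow> (\<forall>p\<in>forms n i. L ^ s * p \<in> I \<longrightarrow> p \<in> I)"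
  proof
    assume inj: "inj_on ?f (quot_part n I i)"
    show "\<forall>p\<in>forms n i. L ^ s * p \<in> I \<longrightarrow> p \<in> I"
    proof (intro ballI impI)
      fix p assume p: "p \<in> forms n i" "L ^ s * p \<in> I"
      have "?f (?c p) = ?f (?c 0)"
        using p(2) by (simp add: f[OF p(1)] f[OF forms_0] eq)
      then have "?c p = ?c 0"
        by (rule inj_onD[OF inj]) (use p(1) in \<open>auto simp: quot_part_def\<close>)
      then show "p \<in> I"
        by (simp add: eq)
    qed
  next
    assume *: "\<forall>p\<in>forms n i. L ^ s * p \<in> I \<longrightarrow> p \<in> I"
    show "inj_on ?f (quot_part n I i)"
    proof (rule inj_onI)
      fix x y assume "x \<in> quot_part n I i" "y \<in> quot_part n I i" and xy: "?f x = ?f y"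
      then obtain p q where pq: "p \<in> forms n i" "x = ?c p" "q \<in> forms n i" "y = ?c q"
        unfolding quot_part_def by blast
      then have "L ^ s * (p - q) \<in> I"
        using xy by (simp add: f eq algebra_simps)
      then show "x = y"
        using * forms_diff[OF pq(1,3)] pq by (simp add: eq)
    qed
  qed
  have img: "?f ` quot_part n I i = ?c ` ((\<lambda>p. L ^ s * p) ` forms n i)"
    unfolding quot_part_def image_image by (rule image_cong) (auto simp: f)
  have "?f ` quot_part n I i = quot_part n I (i + s) \<longleftrightarrow>
      (\<forall>q\<in>forms n (i + s). \<exists>p\<in>forms n i. q - L ^ s * p \<in> I)"
  proof
    assume surj: "?f ` quot_part n I i = quot_part n I (i + s)"
    have *: "?c q \<in> ?c ` ((\<lambda>p. L ^ s * p) ` forms n i)" if "q \<in> forms n (i + s)" for q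
    proof -
      have "?c q \<in> quot_part n I (i + s)"
        unfolding quot_part_def using that by (rule imageI)
      then show ?thesis
        unfolding surj[symmetric] img .
    qed
    show "\<forall>q\<in>forms n (i + s). \<exists>p\<in>forms n i. q - L ^ s * p \<in> I"
    proof
      fix q :: "(nat, 'k) mpoly"
      assume "q \<in> forms n (i + s)"
      from *[OF this] obtain p where "p \<in> forms n i" "?c q = ?c (L ^ s * p)"
        by blast
      then show "\<exists>p\<in>forms n i. q - L ^ s * p \<in> I"
        unfolding eq by blast
    qed
  next
    assume "\<forall>q\<in>forms n (i + s). \<exists>p\<in>forms n i. q - L ^ s * p \<in> I"
    then have *: "\<exists>p\<in>forms n i. ?c q = ?c (L ^ s * p)" if "q \<in> forms n (i + s)" for q
      using that by (simp add: eq)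
    have "?c ` ((\<lambda>p. L ^ s * p) ` forms n i) = ?c ` forms n (i + s)"
    proof
      show "?c ` ((\<lambda>p. L ^ s * p) ` forms n i) \<subseteq> ?c ` forms n (i + s)"
        by (intro image_mono image_subsetI form)
      show "?c ` forms n (i + s) \<subseteq> ?c ` ((\<lambda>p. L ^ s * p) ` forms n i)"
      proof (rule image_subsetI)
        fix q :: "(nat, 'k) mpoly"
        assume "q \<in> forms n (i + s)"
        from *[OF this] obtain p where "p \<in> forms n i" "?c q = ?c (L ^ s * p)"
          by blast
        then show "?c q \<in> ?c ` ((\<lambda>p. L ^ s * p) ` forms n i)"
          by (simp only: imageI)
      qed
    qed
    then show "?f ` quot_part n I i = quot_part n I (i + s)"
      unfolding img by (simp only: quot_part_def)
  qed
  with inj show ?thesis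
    unfolding bij_betw_def mult_bijective_def by blast
qed

lemma strong_stanley_iff:
  fixes I :: "(nat, 'k::field) mpoly set"
  assumes "ideal I (poly_ring n)" and t: "t = top_degree n I"
  shows "strong_stanley n I \<longleftrightarrow>
    (\<exists>L\<in>forms n 1. \<forall>i\<le>t div 2. mult_bijective n I L i (t - 2 * i))"
proof -
  have "bij_betw (\<lambda>a. (quot_class n I L [^]\<^bsub>quot_alg n I\<^esub> (t - 2 * i)) \<otimes>\<^bsub>quot_alg n I\<^esub> a)
      (quot_part n I i) (quot_part n I (t - i)) \<longleftrightarrow> mult_bijective n I L i (t - 2 * i)"
    if "L \<in> forms n 1" "i \<le> t div 2" for L i
  proof -
    have *: "t - i = i + (t - 2 * i)"
      using that(2) by linarith
    show ?thesis
      unfolding * by (rule bij_betw_quot_part_iff[OF assms(1) that(1)])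
  qed
  then show ?thesis
    unfolding strong_stanley_def Let_def t[symmetric] by blast
qed

text \<open>The ideals \<open>K i\<close> generated by \<open>I\<close> and all forms of degree at least \<open>i\<close> give a descending chain in
  the quotient; where it is stationary, forms of degree \<open>i\<close> lie in \<open>I\<close> plus higher degrees, and by
  homogeneity in \<open>I\<close>.\<close>

lemma artinian_high_degrees:
  fixes I :: "(nat, 'k::field) mpoly set"
  assumes hom: "homogeneous_ideal n I" and art: "artinian (quot_alg n I)"
  obtains N where "\<And>d. d \<ge> N \<Longrightarrow> forms n d \<subseteq> I"
proof -
  have I: "ideal I (poly_ring n)"
    using hom unfolding homogeneous_ideal_def by blast
  interpret cring "poly_ring n :: (nat, 'k) mpoly ring"
    by (rule cring_poly_ring)
  define K where "K i = {p \<in> mpolys_in {..<n}. \<exists>h\<in>I. keys (p - h) \<subseteq> {m. i \<le> monom_deg m}}" for i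
  have K: "ideal (K i) (poly_ring n)" for i
    unfolding ideal_poly_ring_iff
  proof (intro conjI ballI)
    show "0 \<in> K i"
      using ideal_poly_ringD(2)[OF I] unfolding K_def by (auto intro!: bexI[of _ 0])
    fix p assume "p \<in> K i"
    then obtain h where p: "p \<in> mpolys_in {..<n}" "h \<in> I" "keys (p - h) \<subseteq> {m. i \<le> monom_deg m}"
      unfolding K_def by blast
    {
      fix q assume "q \<in> K i"
      then obtain h' where q: "q \<in> mpolys_in {..<n}" "h' \<in> I" "keys (q - h') \<subseteq> {m. i \<le> monom_deg m}"
        unfolding K_def by blast
      have *: "p + q - (h + h') = (p - h) + (q - h')"
        by simp
      have "keys (p + q - (h + h')) \<subseteq> {m. i \<le> monom_deg m}"
        unfolding * by (intro order_trans[OF keys_add] Un_least p(3) q(3))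
      then show "p + q \<in> K i"
        unfolding K_def using mpolys_in_add[OF p(1) q(1)] ideal_poly_ringD(3)[OF I p(2) q(2)]
        by (intro CollectI conjI bexI[of _ "h + h'"])
    }
    fix q :: "(nat, 'k) mpoly"
    assume q: "q \<in> mpolys_in {..<n}"
    have "keys (q * (p - h)) \<subseteq> {m. i \<le> monom_deg m}"
      using keys_mult[of q "p - h"] p(3) by (fastforce simp: monom_deg_add)
    then have "keys (q * p - q * h) \<subseteq> {m. i \<le> monom_deg m}"
      by (simp add: algebra_simps)
    then show "q * p \<in> K i"
      unfolding K_def using mpolys_in_mult[OF q p(1)] ideal_poly_ringD(4)[OF I p(2) q]
      by (intro CollectI conjI bexI[of _ "q * h"])
  qed (auto simp: K_def)
  define J where "J i = quot_class n I ` K i" for i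
  have "ideal (J i) (quot_alg n I)" for i
    using ring_ideal_imp_quot_ideal[OF I K] unfolding J_def quot_class_def quot_alg_def by simp
  moreover have "J (Suc i) \<subseteq> J i" for i
    unfolding J_def K_def by (rule image_mono) (auto dest: Suc_leD)
  ultimately obtain N where N: "\<And>i. i \<ge> N \<Longrightarrow> J i = J N"
    using art unfolding artinian_def by meson
  show thesis
  proof
    fix d assume d: "d \<ge> N"
    show "forms n d \<subseteq> I"
    proof
      fix f :: "(nat, 'k) mpoly"
      assume f: "f \<in> forms n d"
      then have "f \<in> K d"
        unfolding K_def using ideal_poly_ringD(2)[OF I]
        by (auto simp: forms_def intro!: bexI[of _ 0])
      then have "quot_class n I f \<in> J (Suc d)"
        using N[of d] N[of "Suc d"] d unfolding J_def by auto
      then obtain p where p: "p \<in> K (Suc d)" "f - p \<in> I"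
        unfolding J_def by (auto simp: quot_class_eq_iff[OF I])
      then obtain h where h: "h \<in> I" "keys (p - h) \<subseteq> {m. Suc d \<le> monom_deg m}"
        unfolding K_def by blast
      have "f - (p - h) \<in> I"
        using ideal_poly_ringD(3)[OF I p(2) h(1)] by (simp add: algebra_simps)
      then have "homog_part d (f - (p - h)) \<in> I"
        by (rule homogeneous_ideal_homog_part[OF hom])
      moreover have "homog_part d (p - h) = 0"
        using h(2) by (intro poly_mapping_eqI) (auto simp: lookup_homog_part in_keys_iff)
      ultimately show "f \<in> I"
        by (simp add: homog_part_diff homog_part_of_form[OF f])
    qed
  qed
qed

lemma forms_above_top_degree:
  fixes I :: "(nat, 'k::field) mpoly set"
  assumes hom: "homogeneous_ideal n I" and art: "artinian (quot_alg n I)"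
    and "d > top_degree n I"
  shows "forms n d \<subseteq> I"
proof (rule ccontr)
  have I: "ideal I (poly_ring n)"
    using hom unfolding homogeneous_ideal_def by blast
  obtain N where N: "\<And>d. d \<ge> N \<Longrightarrow> forms n d \<subseteq> I"
    using artinian_high_degrees[OF hom art] by blast
  have "{d. quot_part n I d \<noteq> {\<zero>\<^bsub>quot_alg n I\<^esub>}} \<subseteq> {..<N}"
  proof (rule subsetI, rule ccontr)
    fix d assume "d \<in> {d. quot_part n I d \<noteq> {\<zero>\<^bsub>quot_alg n I\<^esub>}}" "d \<notin> {..<N}"
    then show False
      using N[of d] by (simp add: quot_part_nonzero_iff[OF I])
  qed
  then have fin: "finite {d. quot_part n I d \<noteq> {\<zero>\<^bsub>quot_alg n I\<^esub>}}"
    by (rule finite_subset) simp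
  assume "\<not> forms n d \<subseteq> I"
  then have "d \<in> {d. quot_part n I d \<noteq> {\<zero>\<^bsub>quot_alg n I\<^esub>}}"
    by (simp add: quot_part_nonzero_iff[OF I])
  then have "d \<le> top_degree n I"
    unfolding top_degree_def by (rule Max_ge[OF fin])
  then show False
    using assms(3) by simp
qed

section \<open>Multiplication by the last variable and leading monomials\<close>

abbreviation last_var :: "nat \<Rightarrow> (nat, 'k::field) mpoly" where
  "last_var n \<equiv> single (single (n - 1) 1) 1"

lemma last_var_power: "last_var n ^ s = single (single (n - 1) s) 1"
  by (induction s) (simp_all add: mult_single single_add[symmetric])

text \<open>The bijectivity of multiplication by \<open>x\<^sub>n\<^sup>s\<close> in terms of the set \<open>E\<close> of monomials of the initial ideal:
  monomials outside \<open>E\<close> of degree \<open>i\<close> stay outside \<open>E\<close> after multiplication, and those of degree \<open>i + s\<close>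
  arise in this way. The quotient by \<open>x\<^sub>n\<^sup>s\<close> is then outside \<open>E\<close> again, because \<open>E\<close> contains the multiples
  of its elements.\<close>

definition last_var_bijective :: "nat \<Rightarrow> (nat \<Rightarrow>\<^sub>0 nat) set \<Rightarrow> nat \<Rightarrow> nat \<Rightarrow> bool" where
  "last_var_bijective n E i s \<longleftrightarrow>
     (\<forall>m\<in>monoms n i. m + single (n - 1) s \<in> E \<longrightarrow> m \<in> E) \<and>
     (\<forall>m\<in>monoms n (i + s). m \<notin> E \<longrightarrow> s \<le> lookup m (n - 1))"

lemma divide_form_by_var_power:
  fixes h :: "(nat, 'k::field) mpoly"
  assumes h: "h \<in> forms n (i + s)" and "j < n" and div: "\<And>k. k \<in> keys h \<Longrightarrow> s \<le> lookup k j"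
  obtains p where "p \<in> forms n i" "h = single (single j s) 1 * p"
proof
  let ?e = "single j s"
  let ?p = "\<Sum>k\<in>keys h. single (k - ?e) (lookup h k)"
  have k: "?e + (k - ?e) = k" if "k \<in> keys h" for k
    using div[OF that] by (intro poly_mapping_eqI) (auto simp: lookup_add lookup_minus lookup_single when_def)
  show "?p \<in> forms n i"
  proof (intro forms_sum single_in_forms)
    fix l assume l: "l \<in> keys h"
    then have "?e + (l - ?e) \<in> monoms n (i + s)"
      using h k[OF l] by (auto simp: forms_iff)
    then show "l - ?e \<in> monoms n i"
      by (simp add: monoms_def monom_deg_add keys_add_nat)
  qed
  have "single ?e 1 * ?p = (\<Sum>k\<in>keys h. single k (lookup h k))"
    unfolding sum_distrib_left by (rule sum.cong) (simp_all add: mult_single k)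
  then show "h = single ?e 1 * ?p"
    using poly_expand[of "keys h" h] by simp
qed

context
  fixes n :: nat and J :: "(nat, 'k::field) mpoly set"
  assumes J: "ideal J (poly_ring n)"
    and graded: "\<And>p d. p \<in> J \<Longrightarrow> homog_part d p \<in> J"
begin

lemma lead_monom_of_form:
  assumes "m \<in> lead_monoms J" "m \<in> monoms n d"
  obtains h where "h \<in> J" "h \<in> forms n d" "m \<in> keys h"
    "\<And>k. k \<in> keys h \<Longrightarrow> k \<noteq> m \<Longrightarrow> revlex_less k m"
proof -
  obtain p where p: "p \<in> J" "m \<in> keys p" "\<And>k. k \<in> keys p \<Longrightarrow> k \<noteq> m \<Longrightarrow> revlex_less k m"
    using assms(1) lead_monomsE by metis
  show thesis
  proof (rule that[of "homog_part d p"])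
    show "homog_part d p \<in> J"
      by (rule graded[OF p(1)])
    show "homog_part d p \<in> forms n d"
      by (rule homog_part_forms[OF ideal_poly_ringD(1)[OF J p(1)]])
  qed (use p assms(2) in \<open>auto simp: keys_homog_part monoms_def\<close>)
qed

text \<open>Division by \<open>J\<close>: either the leading monomial can be cancelled by an element of \<open>J\<close>, or it is split
  off into the remainder. Both times the leading monomial of what is left is smaller.\<close>

lemma reduced_representative:
  assumes "f \<in> forms n d"
  shows "\<exists>r\<in>forms n d. f - r \<in> J \<and> keys r \<inter> lead_monoms J = {}"
  using assms
proof (induction "card {k\<in>monoms n d. \<exists>m\<in>keys f. k = m \<or> revlex_less k m}"
    arbitrary: f rule: less_induct)
  case less
  show ?case
  proof (cases "f = 0")
    case True
    then show ?thesis
      using ideal_poly_ringD(2)[OF J] by (intro bexI[of _ 0]) auto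
  next
    case False
    define m where "m = lead_monom f"
    have m: "m \<in> keys f" "\<And>k. k \<in> keys f \<Longrightarrow> k \<noteq> m \<Longrightarrow> revlex_less k m"
      using lead_monom_props[OF False] by (auto simp: m_def)
    have m_deg: "m \<in> monoms n d"
      using m(1) less.prems by (auto simp: forms_iff)
    have step: "\<exists>r\<in>forms n d. f - h - r \<in> J \<and> keys r \<inter> lead_monoms J = {}"
      if h: "h \<in> forms n d" "lookup h m = lookup f m"
        "\<And>k. k \<in> keys h \<Longrightarrow> k \<noteq> m \<Longrightarrow> revlex_less k m" for h
    proof (rule less.hyps)
      show "f - h \<in> forms n d"
        by (rule forms_diff[OF less.prems h(1)])
      have below: "revlex_less k m" if "k \<in> keys (f - h)" for k
      proof -
        have "k \<noteq> m"
          using that h(2) by (auto simp: in_keys_iff lookup_minus)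
        moreover have "k \<in> keys f \<or> k \<in> keys h"
          using that by (auto simp: in_keys_iff lookup_minus)
        ultimately show ?thesis
          using m(2) h(3) by blast
      qed
      show "card {k\<in>monoms n d. \<exists>m\<in>keys (f - h). k = m \<or> revlex_less k m}
          < card {k\<in>monoms n d. \<exists>m\<in>keys f. k = m \<or> revlex_less k m}"
      proof (rule psubset_card_mono)
        have "revlex_less k m" if "l \<in> keys (f - h)" "k = l \<or> revlex_less k l" for k l
          using below[OF that(1)] revlex_less_trans[of k l m] that(2) by auto
        then have "{k\<in>monoms n d. \<exists>m\<in>keys (f - h). k = m \<or> revlex_less k m}
            \<subseteq> {k\<in>monoms n d. revlex_less k m}"
          by auto
        moreover have "{k\<in>monoms n d. revlex_less k m}
            \<subset> {k\<in>monoms n d. \<exists>m\<in>keys f. k = m \<or> revlex_less k m}"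
        proof (rule psubsetI)
          have "m \<in> {k\<in>monoms n d. \<exists>m\<in>keys f. k = m \<or> revlex_less k m}"
            using m(1) m_deg by auto
          moreover have "m \<notin> {k\<in>monoms n d. revlex_less k m}"
            by simp
          ultimately show "{k\<in>monoms n d. revlex_less k m}
              \<noteq> {k\<in>monoms n d. \<exists>m\<in>keys f. k = m \<or> revlex_less k m}"
            by blast
        qed (use m(1) in auto)
        ultimately show "{k\<in>monoms n d. \<exists>m\<in>keys (f - h). k = m \<or> revlex_less k m}
            \<subset> {k\<in>monoms n d. \<exists>m\<in>keys f. k = m \<or> revlex_less k m}"
          by (rule subset_psubset_trans)
      qed simp
    qed
    show ?thesis
    proof (cases "m \<in> lead_monoms J")
      case True
      then obtain h where h: "h \<in> J" "h \<in> forms n d" "m \<in> keys h"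
        "\<And>k. k \<in> keys h \<Longrightarrow> k \<noteq> m \<Longrightarrow> revlex_less k m"
        using lead_monom_of_form m_deg by blast
      define a where "a = lookup f m / lookup h m"
      let ?h = "single 0 a * h"
      have sub: "keys ?h \<subseteq> keys h"
        by (auto simp: in_keys_iff)
      have "?h \<in> forms n d"
        using h(2) sub by (auto simp: forms_iff)
      moreover have "lookup ?h m = lookup f m"
        using h(3) by (simp add: a_def in_keys_iff)
      ultimately obtain r where r: "r \<in> forms n d" "f - ?h - r \<in> J" "keys r \<inter> lead_monoms J = {}"
        using step[of ?h] h(4) sub by blast
      have "?h \<in> J"
        by (rule ideal_poly_ringD(4)[OF J h(1)]) simp
      from ideal_poly_ringD(3)[OF J r(2) this] have "f - r \<in> J"
        by (simp add: algebra_simps)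
      then show ?thesis
        using r by blast
    next
      case False
      let ?h = "single m (lookup f m)"
      have "\<exists>r\<in>forms n d. f - ?h - r \<in> J \<and> keys r \<inter> lead_monoms J = {}"
        by (rule step) (auto simp: single_in_forms[OF m_deg] split: if_splits)
      then obtain r where r: "r \<in> forms n d" "f - ?h - r \<in> J" "keys r \<inter> lead_monoms J = {}"
        by blast
      have "keys (?h + r) \<inter> lead_monoms J = {}"
        using r(3) False keys_add[of ?h r] by (auto split: if_splits)
      then show ?thesis
        using r forms_add[OF single_in_forms[OF m_deg] r(1)]
        by (intro bexI[of _ "?h + r"]) (auto simp: algebra_simps)
    qed
  qed
qed

text \<open>Divisibility of a form by a power of the last variable can be read off its leading monomial,
  since all other monomials of the form are smaller and therefore have at least the same exponent
  at the last variable. This turns injectivity and surjectivity on \<open>R/J\<close> into conditions on the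
  monomials outside the initial ideal.\<close>

lemma mult_bijective_last_var_iff:
  assumes n: "0 < n"
  shows "mult_bijective n J (last_var n) i s \<longleftrightarrow> last_var_bijective n (lead_monoms J) i s"
proof -
  let ?e = "single (n - 1) s" and ?X = "single (single (n - 1) s) 1 :: (nat, 'k) mpoly"
  have X: "?X \<in> mpolys_in {..<n}"
    using n by (intro mpolys_in_single) auto
  have inj: "(\<forall>p\<in>forms n i. ?X * p \<in> J \<longrightarrow> p \<in> J) \<longleftrightarrow>
      (\<forall>m\<in>monoms n i. m + ?e \<in> lead_monoms J \<longrightarrow> m \<in> lead_monoms J)"
  proof (intro iffI ballI impI)
    fix m
    assume inj: "\<forall>p\<in>forms n i. ?X * p \<in> J \<longrightarrow> p \<in> J"
      and m: "m \<in> monoms n i" "m + ?e \<in> lead_monoms J"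
    have me: "m + ?e \<in> monoms n (i + s)"
      by (rule monoms_add[OF m(1)]) (use n in \<open>auto simp: monoms_def\<close>)
    obtain h where h: "h \<in> J" "h \<in> forms n (i + s)" "m + ?e \<in> keys h"
      "\<And>k. k \<in> keys h \<Longrightarrow> k \<noteq> m + ?e \<Longrightarrow> revlex_less k (m + ?e)"
      using lead_monom_of_form[OF m(2) me] by blast
    have "s \<le> lookup k (n - 1)" if k: "k \<in> keys h" for k
    proof (rule ccontr)
      assume "\<not> s \<le> lookup k (n - 1)"
      then have "lookup k (n - 1) < lookup (m + ?e) (n - 1)"
        by (simp add: lookup_add)
      moreover have "k \<in> monoms n (i + s)"
        using h(2) k by (auto simp: forms_iff)
      ultimately have "revlex_less (m + ?e) k"
        using revlex_less_last_exponent[OF me] by simp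
      then show False
        using h(4)[OF k] revlex_less_asym[of "m + ?e" k] by auto
    qed
    then obtain p where p: "p \<in> forms n i" "h = ?X * p"
      using divide_form_by_var_power[OF h(2), of "n - 1"] n by auto
    then have "p \<in> J"
      using inj h(1) by simp
    moreover have keys: "keys h = (+) ?e ` keys p"
      unfolding p(2) by (rule keys_single_mult) simp
    then obtain l where "l \<in> keys p" "m + ?e = ?e + l"
      using h(3) by blast
    then have "m \<in> keys p"
      by (simp add: add.commute)
    moreover have "revlex_less k m" if "k \<in> keys p" "k \<noteq> m" for k
      using h(4)[of "?e + k"] that keys revlex_less_add_left[of ?e k m]
      by (auto simp: add.commute)
    ultimately show "m \<in> lead_monoms J"
      by (rule lead_monomsI)
  next
    fix p
    assume inj: "\<forall>m\<in>monoms n i. m + ?e \<in> lead_monoms J \<longrightarrow> m \<in> lead_monoms J"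
      and p: "p \<in> forms n i" "?X * p \<in> J"
    obtain r where r: "r \<in> forms n i" "p - r \<in> J" "keys r \<inter> lead_monoms J = {}"
      using reduced_representative[OF p(1)] by blast
    have "?X * p - ?X * (p - r) \<in> J"
      using p(2) ideal_poly_ringD(4)[OF J r(2) X] by (rule ideal_poly_ringD(5)[OF J])
    then have Xr: "?X * r \<in> J"
      by (simp add: algebra_simps)
    have "r = 0"
    proof (rule ccontr)
      assume r0: "r \<noteq> 0"
      have lr: "lead_monom r \<in> keys r"
        by (rule lead_monom_props(1)[OF r0])
      have "?X * r \<noteq> 0"
        using keys_single_mult[of "1::'k" ?e r] lr by auto
      then have "lead_monom r + ?e \<in> lead_monoms J"
        using lead_monom_in_lead_monoms[OF Xr] lead_monom_single_mult[of "1::'k" r ?e] r0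
        by (simp add: add.commute)
      then have "lead_monom r \<in> lead_monoms J"
        using inj lr r(1) by (auto simp: forms_iff)
      then show False
        using r(3) lr by blast
    qed
    then show "p \<in> J"
      using r(2) by simp
  qed
  have surj: "(\<forall>q\<in>forms n (i + s). \<exists>p\<in>forms n i. q - ?X * p \<in> J) \<longleftrightarrow>
      (\<forall>m\<in>monoms n (i + s). m \<notin> lead_monoms J \<longrightarrow> s \<le> lookup m (n - 1))"
  proof (intro iffI ballI impI)
    fix m
    assume surj: "\<forall>q\<in>forms n (i + s). \<exists>p\<in>forms n i. q - ?X * p \<in> J"
      and m: "m \<in> monoms n (i + s)" "m \<notin> lead_monoms J"
    show "s \<le> lookup m (n - 1)"
    proof (rule ccontr)
      assume *: "\<not> s \<le> lookup m (n - 1)"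
      obtain p where p: "p \<in> forms n i" "single m 1 - ?X * p \<in> J"
        using surj single_in_forms[OF m(1)] by blast
      have keys: "keys (?X * p) = (+) ?e ` keys p"
        by (rule keys_single_mult) simp
      have "s \<le> lookup k (n - 1)" if "k \<in> keys (?X * p)" for k
        using that unfolding keys by (auto simp: lookup_add)
      then have m_key: "m \<notin> keys (?X * p)"
        using * by blast
      have "m \<in> lead_monoms J"
      proof (rule lead_monomsI[OF p(2)])
        show "m \<in> keys (single m 1 - ?X * p)"
          using m_key by (simp add: in_keys_iff lookup_minus)
        fix k assume k: "k \<in> keys (single m 1 - ?X * p)" "k \<noteq> m"
        then have "k \<in> keys (?X * p)"
          by (auto simp: in_keys_iff lookup_minus lookup_single)
        then obtain l where l: "l \<in> keys p" "k = ?e + l"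
          unfolding keys by blast
        have "l \<in> monoms n i"
          using l(1) p(1) by (auto simp: forms_iff)
        then have "k \<in> monoms n (i + s)"
          using n unfolding l(2) by (auto simp: monoms_def monom_deg_add keys_add_nat)
        moreover have "lookup m (n - 1) < lookup k (n - 1)"
          using * by (simp add: l(2) lookup_add)
        ultimately show "revlex_less k m"
          using m(1) by (intro revlex_less_last_exponent[of k n "i + s" m])
      qed
      then show False
        using m(2) by simp
    qed
  next
    fix q :: "(nat, 'k) mpoly"
    assume surj: "\<forall>m\<in>monoms n (i + s). m \<notin> lead_monoms J \<longrightarrow> s \<le> lookup m (n - 1)"
      and q: "q \<in> forms n (i + s)"
    obtain r where r: "r \<in> forms n (i + s)" "q - r \<in> J" "keys r \<inter> lead_monoms J = {}"
      using reduced_representative[OF q] by blast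
    have "s \<le> lookup k (n - 1)" if "k \<in> keys r" for k
      using surj r(1,3) that by (auto simp: forms_iff)
    then obtain p where "p \<in> forms n i" "r = ?X * p"
      using divide_form_by_var_power[OF r(1), of "n - 1"] n by auto
    then show "\<exists>p\<in>forms n i. q - ?X * p \<in> J"
      using r(2) by blast
  qed
  show ?thesis
    unfolding mult_bijective_def last_var_bijective_def last_var_power inj surj ..
qed

end

text \<open>The matrix \<open>a\<close> induces a graded isomorphism from \<open>R/I\<close> to \<open>R/aI\<close> that maps the class of \<open>L\<close> to the
  class of \<open>a L\<close>.\<close>

lemma mult_bijective_mat_act:
  fixes I :: "(nat, 'k::field) mpoly set"
  assumes I: "ideal I (poly_ring n)" and a: "a \<in> GL n" and L: "L \<in> mpolys_in {..<n}"
    and bij: "mult_bijective n I L i s"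
  shows "mult_bijective n (mat_act n a ` I) (mat_act n a L) i s"
proof -
  interpret A: comm_ring_hom "mat_act n a" by (rule mat_act_hom)
  obtain b where b: "b \<in> GL n" "a * b = 1\<^sub>m n" "b * a = 1\<^sub>m n"
    using GL_inverse[OF a] by metis
  interpret B: comm_ring_hom "mat_act n b" by (rule mat_act_hom)
  have ab: "mat_act n a (mat_act n b p) = p" if "p \<in> forms n d" for p d
    by (rule mat_act_inverse[OF b(2) a b(1) forms_in_mpolys[OF that]])
  have ba: "mat_act n b (mat_act n a p) = p" if "p \<in> mpolys_in {..<n}" for p
    by (rule mat_act_inverse[OF b(3,1) a that])
  have pull_back: "p \<in> I" if "mat_act n a p \<in> mat_act n a ` I" "p \<in> mpolys_in {..<n}" for p
    using that(1) ba[OF that(2)] ba ideal_poly_ringD(1)[OF I] by (metis imageE)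
  show ?thesis
    unfolding mult_bijective_def
  proof (intro conjI ballI impI)
    fix p assume p: "p \<in> forms n i" "mat_act n a L ^ s * p \<in> mat_act n a ` I"
    let ?p = "mat_act n b p"
    have p': "?p \<in> forms n i"
      by (rule mat_act_forms[OF p(1)])
    have "mat_act n a (L ^ s * ?p) \<in> mat_act n a ` I"
      using p(2) by (simp add: A.hom_mult A.hom_power ab[OF p(1)])
    then have "L ^ s * ?p \<in> I"
      by (rule pull_back) (intro mpolys_in_mult mpolys_in_power L forms_in_mpolys[OF p'])
    then have "?p \<in> I"
      using bij p' unfolding mult_bijective_def by blast
    then show "p \<in> mat_act n a ` I"
      using ab[OF p(1)] by (metis imageI)
  next
    fix q :: "(nat, 'k) mpoly"
    assume q: "q \<in> forms n (i + s)"
    obtain p where p: "p \<in> forms n i" "mat_act n b q - L ^ s * p \<in> I"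
      using bij mat_act_forms[OF q] unfolding mult_bijective_def by blast
    have "mat_act n a (mat_act n b q - L ^ s * p) \<in> mat_act n a ` I"
      using p(2) by (rule imageI)
    then have "q - mat_act n a L ^ s * mat_act n a p \<in> mat_act n a ` I"
      by (simp add: A.hom_minus A.hom_mult A.hom_power ab[OF q])
    then show "\<exists>p\<in>forms n i. q - mat_act n a L ^ s * p \<in> mat_act n a ` I"
      using mat_act_forms[OF p(1)] by blast
  qed
qed

lemma mat_act_graded:
  fixes I :: "(nat, 'k::field) mpoly set"
  assumes I: "ideal I (poly_ring n)" and graded: "\<And>p d. p \<in> I \<Longrightarrow> homog_part d p \<in> I"
    and "p \<in> mat_act n a ` I"
  shows "homog_part d p \<in> mat_act n a ` I"
  using assms(3) graded ideal_poly_ringD(1)[OF I] homog_part_mat_act[of _ n d a] by fastforce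

section \<open>Moving a linear form to the last variable\<close>

text \<open>The matrix \<open>1 + x u w\<^sup>T\<close>.\<close>

definition rank_one_update :: "nat \<Rightarrow> (nat \<Rightarrow> 'k::field) \<Rightarrow> (nat \<Rightarrow> 'k) \<Rightarrow> 'k \<Rightarrow> 'k mat" where
  "rank_one_update n u w x = mat n n (\<lambda>(i, j). (if i = j then 1 else 0) + x * (u i * w j))"

lemma rank_one_update_mult:
  "rank_one_update n u w x * rank_one_update n u w y =
    rank_one_update n u w (x + y + x * y * (\<Sum>l<n. w l * u l))"
proof (rule eq_matI)
  let ?\<delta> = "\<lambda>i j :: nat. if i = j then 1 else 0 :: 'a"
  fix i j
  assume "i < dim_row (rank_one_update n u w (x + y + x * y * (\<Sum>l<n. w l * u l)))"
    "j < dim_col (rank_one_update n u w (x + y + x * y * (\<Sum>l<n. w l * u l)))"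
  then have ij: "i < n" "j < n"
    by (simp_all add: rank_one_update_def)
  have "(rank_one_update n u w x * rank_one_update n u w y) $$ (i, j) =
      (\<Sum>l<n. (?\<delta> i l + x * (u i * w l)) * (?\<delta> l j + y * (u l * w j)))"
    using ij by (simp add: rank_one_update_def scalar_prod_def lessThan_atLeast0)
  also have "\<dots> = (\<Sum>l<n. ?\<delta> i l * ?\<delta> l j) + (\<Sum>l<n. if i = l then y * (u l * w j) else 0)
      + (\<Sum>l<n. if l = j then x * (u i * w l) else 0) + x * y * (u i * w j) * (\<Sum>l<n. w l * u l)"
    unfolding sum_distrib_left sum.distrib[symmetric]
    by (rule sum.cong) (auto simp: algebra_simps)
  also have "(\<Sum>l<n. ?\<delta> i l * ?\<delta> l j) = (\<Sum>l<n. if i = l then ?\<delta> i j else 0)"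
    by (rule sum.cong) auto
  finally show "(rank_one_update n u w x * rank_one_update n u w y) $$ (i, j) =
      rank_one_update n u w (x + y + x * y * (\<Sum>l<n. w l * u l)) $$ (i, j)"
    using ij by (simp add: rank_one_update_def algebra_simps)
qed (simp_all add: rank_one_update_def)

text \<open>Products of updates along the same \<open>u\<close> and \<open>w\<close> are again of this form, so the inverse is the update
  with the factor that makes the product trivial (the Sherman-Morrison formula).\<close>

lemma rank_one_update_GL:
  assumes "1 + (\<Sum>l<n. w l * u l) \<noteq> 0"
  shows "rank_one_update n u w 1 \<in> GL n"
proof -
  let ?\<sigma> = "\<Sum>l<n. w l * u l"
  define y where "y = - 1 / (1 + ?\<sigma>)"
  have "1 + y + y * ?\<sigma> = 0"
    using assms by (simp add: y_def field_simps)
  moreover have "rank_one_update n u w 0 = 1\<^sub>m n"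
    by (rule eq_matI) (auto simp: rank_one_update_def)
  ultimately show ?thesis
    by (intro GL_I[of _ n "rank_one_update n u w y"])
      (simp_all add: rank_one_update_mult add.commute[of y], simp_all add: rank_one_update_def)
qed

lemma form_1_eq_linear_form:
  fixes L :: "(nat, 'k::field) mpoly"
  assumes "L \<in> forms n 1"
  shows "L = linear_form n (\<lambda>j. lookup L (single j 1))"
proof -
  have sub: "keys L \<subseteq> (\<lambda>j. single j 1) ` {..<n}"
  proof
    fix m assume "m \<in> keys L"
    then have m: "keys m \<subseteq> {..<n}" "monom_deg m = 1"
      using assms by (auto simp: forms_iff monoms_def)
    then have "keys m \<noteq> {}"
      by (auto simp: monom_deg_def)
    then obtain j where j: "j \<in> keys m"
      by blast
    then have "lookup (single j 1) i \<le> lookup m i" for i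
      by (auto simp: lookup_single when_def in_keys_iff Suc_le_eq)
    then obtain l where l: "m = l + single j 1"
      using monom_split_nat by metis
    then have "l = 0"
      using m(2) by (simp add: monom_deg_add monom_deg_eq_0_iff)
    then show "m \<in> (\<lambda>j. single j 1) ` {..<n}"
      using l j m(1) by auto
  qed
  have "inj_on (\<lambda>j. single j (1::nat)) {..<n}"
    by (rule inj_onI) (metis keys_single one_neq_zero singleton_inject)
  then show ?thesis
    using poly_expand[OF _ sub] by (simp add: sum.reindex)
qed

text \<open>A matrix \<open>1 + u w\<^sup>T\<close> with \<open>w\<close> equal to \<open>1\<close> at the last index maps the last variable to the linear
  form with coefficients \<open>u + e\<^sub>n\<close>; it is invertible as soon as \<open>w\<close> is not orthogonal to those
  coefficients.\<close>

lemma move_linear_form_to_last_var: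
  fixes L :: "(nat, 'k::field) mpoly"
  assumes L: "L \<in> forms n 1" "L \<noteq> 0" and n: "0 < n"
  obtains a where "a \<in> GL n" "mat_act n a L = last_var n"
proof -
  define c where "c j = lookup L (single j 1)" for j
  have L_c: "L = linear_form n c"
    unfolding c_def by (rule form_1_eq_linear_form[OF L(1)])
  have "\<exists>k<n. c k \<noteq> 0"
  proof (rule ccontr)
    assume "\<not> (\<exists>k<n. c k \<noteq> 0)"
    then have "linear_form n c = 0"
      by simp
    then show False
      using L(2) L_c by simp
  qed
  then obtain k where k: "k < n" "c k \<noteq> 0"
    by blast
  \<comment> \<open>The vector \<open>w\<close> must be \<open>1\<close> at the last index and satisfy \<open>w\<^sup>T c \<noteq> 0\<close>; if the last coefficient of \<open>L\<close>
    vanishes, a second nonzero entry at \<open>k\<close> achieves the latter.\<close>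
  define w where "w j = (if j = n - 1 then 1 else if j = k \<and> c (n - 1) = 0 then 1 / c k else 0)" for j
  define u where "u j = c j - (if j = n - 1 then 1 else 0)" for j
  have wc: "(\<Sum>j<n. w j * c j) \<noteq> 0"
  proof (cases "c (n - 1) = 0")
    case True
    then have "(\<Sum>j<n. w j * c j) = (\<Sum>j<n. if j = k then 1 else 0)"
      using k(2) by (intro sum.cong) (auto simp: w_def)
    then show ?thesis
      using k(1) by simp
  next
    case False
    then have "(\<Sum>j<n. w j * c j) = (\<Sum>j<n. if j = n - 1 then c (n - 1) else 0)"
      by (intro sum.cong) (auto simp: w_def)
    then show ?thesis
      using False n by simp
  qed
  have "(\<Sum>j<n. w j * u j) = (\<Sum>j<n. w j * c j) - (\<Sum>j<n. if j = n - 1 then w (n - 1) else 0)"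
    unfolding sum_subtractf[symmetric] by (rule sum.cong) (auto simp: u_def algebra_simps)
  also have "(\<Sum>j<n. if j = n - 1 then w (n - 1) else 0) = 1"
    using n by (simp add: w_def)
  finally have h: "rank_one_update n u w 1 \<in> GL n"
    using wc by (intro rank_one_update_GL) simp
  have "linear_form n (\<lambda>i. rank_one_update n u w 1 $$ (i, n - 1)) = linear_form n c"
    using n by (intro sum.cong) (auto simp: rank_one_update_def u_def w_def)
  then have "mat_act n (rank_one_update n u w 1) (last_var n) = L"
    unfolding mat_act_var L_c .
  moreover obtain a where a: "a \<in> GL n" "a * rank_one_update n u w 1 = 1\<^sub>m n"
    using GL_inverse[OF h] by metis
  moreover have "last_var n \<in> mpolys_in {..<n}"
    using n by (intro mpolys_in_single) simp
  ultimately have "mat_act n a L = last_var n"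
    using mat_act_inverse[OF a(2,1) h] by metis
  then show thesis
    using that a(1) by blast
qed

section \<open>From one invertible matrix to a generic one\<close>

text \<open>In each degree, the monomials divisible by a fixed power of the last variable are the smallest
  ones, so adding all smaller degrees gives an initial segment.\<close>

lemma revlex_downset_last_exponent:
  "revlex_downset n {m. monom_deg m < d \<or> (monom_deg m = d \<and> s \<le> lookup m (n - 1))}"
  unfolding revlex_downset_def
proof (intro ballI allI impI)
  fix m k
  assume m: "m \<in> {m. monom_deg m < d \<or> (monom_deg m = d \<and> s \<le> lookup m (n - 1))}"
    and vars: "keys m \<subseteq> {..<n}" "keys k \<subseteq> {..<n}" and less: "revlex_less k m"
  show "k \<in> {m. monom_deg m < d \<or> (monom_deg m = d \<and> s \<le> lookup m (n - 1))}"
  proof (rule ccontr)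
    assume k: "\<not> ?thesis"
    have "monom_deg k \<le> monom_deg m"
      using less by (auto simp: revlex_less_def)
    then have "m \<in> monoms n d" "k \<in> monoms n d" "lookup k (n - 1) < lookup m (n - 1)"
      using m k vars by (auto simp: monoms_def)
    then have "revlex_less m k"
      by (rule revlex_less_last_exponent)
    then show False
      using less revlex_less_asym[of m k] by simp
  qed
qed

text \<open>If the leading monomials \<open>E\<close> have in each degree as many elements as \<open>E'\<close>, but not more
  elements divisible by \<open>x\<^sub>n\<^sup>s\<close>, then bijectivity passes from \<open>E'\<close> to \<open>E\<close>: the multiples of the monomials
  of degree \<open>i\<close> in \<open>E\<close> leave no room for further elements of \<open>E\<close> divisible by \<open>x\<^sub>n\<^sup>s\<close>, and the
  monomials of degree \<open>i + s\<close> in \<open>E\<close> not divisible by \<open>x\<^sub>n\<^sup>s\<close> are as numerous as possible.\<close>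

lemma last_var_bijective_transfer:
  assumes n: "0 < n"
    and up: "\<And>m. m \<in> monoms n i \<Longrightarrow> m \<in> E \<Longrightarrow> m + single (n - 1) s \<in> E"
    and card_i: "card (E \<inter> monoms n i) = card (E' \<inter> monoms n i)"
    and card_d: "card (E \<inter> monoms n (i + s)) = card (E' \<inter> monoms n (i + s))"
    and card_div: "card {m \<in> E \<inter> monoms n (i + s). s \<le> lookup m (n - 1)}
      \<le> card {m \<in> E' \<inter> monoms n (i + s). s \<le> lookup m (n - 1)}"
    and bij: "last_var_bijective n E' i s"
  shows "last_var_bijective n E i s"
proof -
  let ?e = "single (n - 1) s"
  define V where "V F = {m \<in> F \<inter> monoms n (i + s). s \<le> lookup m (n - 1)}" for F
  define P where "P F = {m \<in> monoms n i. m + ?e \<in> F}" for F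
  have finV: "finite (V F)" for F
    by (simp add: V_def)
  have finP: "finite (P F)" for F
    by (simp add: P_def)
  have e: "?e \<in> monoms n s"
    using n by (auto simp: monoms_def)
  have PV: "card (P F) = card (V F)" for F
  proof (rule bij_betw_same_card[of "\<lambda>m. m + ?e"])
    have "V F \<subseteq> (\<lambda>m. m + ?e) ` P F"
    proof
      fix m assume m: "m \<in> V F"
      then have "lookup ?e k \<le> lookup m k" for k
        by (auto simp: V_def lookup_single when_def)
      then obtain l where l: "m = l + ?e"
        using monom_split_nat by metis
      have "l \<in> monoms n i"
        using m unfolding l by (auto simp: V_def monoms_def monom_deg_add keys_add_nat)
      then show "m \<in> (\<lambda>m. m + ?e) ` P F"
        using m l by (auto simp: V_def P_def)
    qed
    moreover have "(\<lambda>m. m + ?e) ` P F \<subseteq> V F"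
      using monoms_add[OF _ e] by (auto simp: V_def P_def lookup_add)
    ultimately show "bij_betw (\<lambda>m. m + ?e) (P F) (V F)"
      by (auto simp: bij_betw_def inj_on_def)
  qed
  have "P E' \<subseteq> E' \<inter> monoms n i"
    using bij by (auto simp: P_def last_var_bijective_def)
  then have "card (P E') \<le> card (E' \<inter> monoms n i)"
    by (rule card_mono[rotated]) simp
  then have "card (P E) \<le> card (E \<inter> monoms n i)"
    using card_div card_i by (simp add: PV V_def)
  moreover have "E \<inter> monoms n i \<subseteq> P E"
    using up by (auto simp: P_def)
  ultimately have inj: "P E = E \<inter> monoms n i"
    using card_seteq[OF finP] by metis
  have split: "card (F \<inter> monoms n (i + s) - V F) = card (F \<inter> monoms n (i + s)) - card (V F)" for F
    by (rule card_Diff_subset[OF finV]) (auto simp: V_def)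
  let ?N = "{m \<in> monoms n (i + s). \<not> s \<le> lookup m (n - 1)}"
  have "?N \<subseteq> E' \<inter> monoms n (i + s) - V E'"
    using bij by (auto simp: V_def last_var_bijective_def)
  then have "card ?N \<le> card (E' \<inter> monoms n (i + s) - V E')"
    by (rule card_mono[rotated]) simp
  also have "\<dots> \<le> card (E \<inter> monoms n (i + s) - V E)"
    using card_d card_div by (simp add: split) (simp add: V_def)
  finally have "card ?N \<le> card (E \<inter> monoms n (i + s) - V E)" .
  moreover have "E \<inter> monoms n (i + s) - V E \<subseteq> ?N"
    by (auto simp: V_def)
  ultimately have "E \<inter> monoms n (i + s) - V E = ?N"
    using card_seteq[of ?N] by simp
  then have "m \<in> E" if "m \<in> ?N" for m
    using that by blast
  then show ?thesis
    unfolding last_var_bijective_def using inj by (auto simp: P_def)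
qed

text \<open>Passes from the dimensions of the parts of degree at most \<open>D\<close>, which the action preserves, to
  single degrees.\<close>

lemma card_bounded_eq_degreewise:
  assumes fin: "\<And>D. finite (E \<inter> {m. monom_deg m \<le> D})" "\<And>D. finite (E' \<inter> {m. monom_deg m \<le> D})"
    and eq: "\<And>D. card (E \<inter> {m. monom_deg m \<le> D}) = card (E' \<inter> {m. monom_deg m \<le> D})"
  shows "card (E \<inter> {m. monom_deg m < d}) = card (E' \<inter> {m. monom_deg m < d})"
    and "card (E \<inter> {m. monom_deg m = d}) = card (E' \<inter> {m. monom_deg m = d})"
proof -
  show less: "card (E \<inter> {m. monom_deg m < d}) = card (E' \<inter> {m. monom_deg m < d})"
    using eq[of "d - 1"] by (cases d) (simp_all add: less_Suc_eq_le)
  have split: "card (F \<inter> {m. monom_deg m \<le> d}) =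
      card (F \<inter> {m. monom_deg m < d}) + card (F \<inter> {m. monom_deg m = d})"
    if "finite (F \<inter> {m. monom_deg m \<le> d})" for F
  proof -
    have "F \<inter> {m. monom_deg m \<le> d} = F \<inter> {m. monom_deg m < d} \<union> F \<inter> {m. monom_deg m = d}"
      by auto
    then show ?thesis
      using that by (simp add: card_Un_disjoint disjoint_iff)
  qed
  show "card (E \<inter> {m. monom_deg m = d}) = card (E' \<inter> {m. monom_deg m = d})"
    using split[OF fin(1)] split[OF fin(2)] eq[of d] less by simp
qed

text \<open>Pulling \<open>x\<^sub>n\<close> back along a generic matrix gives one direction. For the other, a linear form \<open>L\<close> as in
  the strong Stanley property is moved to \<open>x\<^sub>n\<close> by some matrix \<open>a\<close>, and the combinatorial conditions for the
  initial ideal of \<open>a I\<close> are transferred to the generic initial ideal by comparing cardinalities.\<close>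

lemma strong_stanley_iff_gin:
  fixes I :: "(nat, 'k::field_char_0) mpoly set"
  assumes hom: "homogeneous_ideal n I" and proper: "I \<noteq> carrier (poly_ring n)"
    and art: "artinian (quot_alg n I)" and t: "t = top_degree n I" and n: "0 < n"
  shows "strong_stanley n I \<longleftrightarrow>
    (\<forall>i\<le>t div 2. last_var_bijective n {m. monomial m \<in> gin n I} i (t - 2 * i))"
proof -
  have I: "ideal I (poly_ring n)"
    using hom unfolding homogeneous_ideal_def by blast
  have graded: "\<And>p d. p \<in> I \<Longrightarrow> homog_part d p \<in> I"
    by (rule homogeneous_ideal_homog_part[OF hom])
  have above: "\<And>d. d > t \<Longrightarrow> forms n d \<subseteq> I"
    using forms_above_top_degree[OF hom art] t by blast
  have X: "last_var n \<in> forms n 1"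
    using n by (intro single_in_forms) (auto simp: monoms_def)
  have gI: "ideal (mat_act n g ` I) (poly_ring n)" if "g \<in> GL n" for g
    by (rule ideal_mat_act[OF I that])
  have last_var_iff: "mult_bijective n (mat_act n g ` I) (last_var n) i s \<longleftrightarrow>
      last_var_bijective n (lead_monoms (mat_act n g ` I)) i s" if "g \<in> GL n" for g i s
    by (rule mult_bijective_last_var_iff[OF gI[OF that] mat_act_graded[OF I graded] n])
  have gin: "{m. monomial m \<in> gin n I} = lead_monoms (mat_act n g ` I)"
    if "g \<in> GL n" "initial_ideal n (mat_act n g ` I) = gin n I" for g
    unfolding that(2)[symmetric] by (simp add: monomial_in_initial_ideal_iff[OF gI[OF that(1)]])
  show ?thesis
  proof
    assume "strong_stanley n I"
    then obtain L where L: "L \<in> forms n 1" "\<And>i. i \<le> t div 2 \<Longrightarrow> mult_bijective n I L i (t - 2 * i)"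
      unfolding strong_stanley_iff[OF I t] by blast
    \<comment> \<open>The form \<open>L = 0\<close> is possible only for \<open>t = 0\<close>, when only \<open>L\<^sup>0\<close> occurs and any other linear
      form does as well.\<close>
    obtain L' where L': "L' \<in> forms n 1" "L' \<noteq> 0"
      "\<And>i. i \<le> t div 2 \<Longrightarrow> mult_bijective n I L' i (t - 2 * i)"
    proof (cases "L = 0")
      case True
      have one: "1 \<notin> I"
      proof
        assume "1 \<in> I"
        then have "p \<in> I" if "p \<in> mpolys_in {..<n}" for p
          using ideal_poly_ringD(4)[OF I _ that] by fastforce
        then show False
          using proper ideal_poly_ringD(1)[OF I] by auto
      qed
      have "t = 0"
      proof (rule ccontr)
        assume "t \<noteq> 0"
        then have "L ^ (t - 2 * 0) * 1 \<in> I"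
          using True ideal_poly_ringD(2)[OF I] by (cases t) simp_all
        then have "1 \<in> I"
          using L(2)[of 0] forms_one unfolding mult_bijective_def by blast
        then show False
          using one by simp
      qed
      then have "mult_bijective n I (last_var n) i (t - 2 * i)" if "i \<le> t div 2" for i
        using L(2)[OF that] that by (simp add: mult_bijective_def)
      moreover have "last_var n \<noteq> (0 :: (nat, 'k) mpoly)"
        by (metis keys_single keys_zero insert_not_empty one_neq_zero)
      ultimately show thesis
        using that X by blast
    qed (use L that in blast)
    obtain a where a: "a \<in> GL n" "mat_act n a L' = last_var n"
      using move_linear_form_to_last_var[OF L'(1,2) n] by blast
    obtain g where g: "g \<in> GL n" "initial_ideal n (mat_act n g ` I) = gin n I"
      and min: "\<And>B. revlex_downset n B \<Longrightarrow> B \<subseteq> {m. monom_deg m \<le> t} \<Longrightarrow>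
        card (lead_monoms (mat_act n g ` I) \<inter> B) \<le> card (lead_monoms (mat_act n a ` I) \<inter> B)"
      using gin_minimizes_downset_counts[OF I above a(1)] by blast
    define E where "E = lead_monoms (mat_act n g ` I)"
    define E' where "E' = lead_monoms (mat_act n a ` I)"
    have vars: "keys m \<subseteq> {..<n}" if "m \<in> E \<or> m \<in> E'" for m
      using that lead_monoms_in_vars[OF gI[OF g(1)]] lead_monoms_in_vars[OF gI[OF a(1)]]
      unfolding E_def E'_def by blast
    have fin: "finite (E \<inter> {m. monom_deg m \<le> D})" "finite (E' \<inter> {m. monom_deg m \<le> D})" for D
      unfolding E_def E'_def
      by (rule finite_lead_monoms_bounded; use ideal_poly_ringD(1)[OF gI[OF g(1)]]
          ideal_poly_ringD(1)[OF gI[OF a(1)]] in blast)+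
    have card_le: "card (E \<inter> {m. monom_deg m \<le> D}) = card (E' \<inter> {m. monom_deg m \<le> D})" for D
      unfolding E_def E'_def card_lead_monoms_mat_act[OF I g(1)] card_lead_monoms_mat_act[OF I a(1)] ..
    note card_deg = card_bounded_eq_degreewise[OF fin card_le]
    have monoms: "E \<inter> {m. monom_deg m = d} = E \<inter> monoms n d"
      "E' \<inter> {m. monom_deg m = d} = E' \<inter> monoms n d" for d
      using vars by (auto simp: monoms_def)
    show "\<forall>i\<le>t div 2. last_var_bijective n {m. monomial m \<in> gin n I} i (t - 2 * i)"
    proof (intro allI impI)
      fix i assume i: "i \<le> t div 2"
      let ?s = "t - 2 * i"
      let ?d = "i + ?s"
      have d: "?d \<le> t"
        using i by linarith
      have "last_var_bijective n E i ?s"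
      proof (rule last_var_bijective_transfer[OF n])
        fix m assume "m \<in> E"
        then show "m + single (n - 1) ?s \<in> E"
          using lead_monoms_upward_closed[OF gI[OF g(1)], of m "single (n - 1) ?s"] n
          unfolding E_def by (simp add: add.commute)
      next
        show "card (E \<inter> monoms n i) = card (E' \<inter> monoms n i)"
          "card (E \<inter> monoms n ?d) = card (E' \<inter> monoms n ?d)"
          using card_deg(2) unfolding monoms by blast+
      next
        \<comment> \<open>The smaller degrees are added to obtain an initial segment; they contribute equally on both
          sides.\<close>
        let ?B = "{m. monom_deg m < ?d \<or> (monom_deg m = ?d \<and> ?s \<le> lookup m (n - 1))}"
        have split: "card (F \<inter> ?B) = card (F \<inter> {m. monom_deg m < ?d}) +
            card {m \<in> F \<inter> monoms n ?d. ?s \<le> lookup m (n - 1)}"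
          if F: "\<And>D. finite (F \<inter> {m. monom_deg m \<le> D})"
            "F \<inter> {m. monom_deg m = ?d} = F \<inter> monoms n ?d" for F
        proof -
          have "F \<inter> ?B = F \<inter> {m. monom_deg m < ?d} \<union> {m \<in> F \<inter> monoms n ?d. ?s \<le> lookup m (n - 1)}"
            unfolding F(2)[symmetric] by auto
          moreover have "finite (F \<inter> {m. monom_deg m < ?d})"
            by (rule finite_subset[OF _ F(1)[of ?d]]) auto
          moreover have "finite {m \<in> F \<inter> monoms n ?d. ?s \<le> lookup m (n - 1)}"
            by simp
          moreover have "F \<inter> {m. monom_deg m < ?d} \<inter>
              {m \<in> F \<inter> monoms n ?d. ?s \<le> lookup m (n - 1)} = {}"
            by (auto simp: monoms_def)
          ultimately show ?thesis
            by (simp only: card_Un_disjoint)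
        qed
        have "card (E \<inter> ?B) \<le> card (E' \<inter> ?B)"
          unfolding E_def E'_def
          by (rule min[OF revlex_downset_last_exponent]) (use d in auto)
        then show "card {m \<in> E \<inter> monoms n ?d. ?s \<le> lookup m (n - 1)}
            \<le> card {m \<in> E' \<inter> monoms n ?d. ?s \<le> lookup m (n - 1)}"
          unfolding split[OF fin(1) monoms(1)] split[OF fin(2) monoms(2)] card_deg(1) by simp
      next
        have "mult_bijective n (mat_act n a ` I) (mat_act n a L') i ?s"
          by (rule mult_bijective_mat_act[OF I a(1) forms_in_mpolys[OF L'(1)] L'(3)[OF i]])
        then show "last_var_bijective n E' i ?s"
          unfolding a(2) last_var_iff[OF a(1)] E'_def .
      qed
      then show "last_var_bijective n {m. monomial m \<in> gin n I} i ?s"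
        unfolding gin[OF g] E_def .
    qed
  next
    assume bij: "\<forall>i\<le>t div 2. last_var_bijective n {m. monomial m \<in> gin n I} i (t - 2 * i)"
    obtain g where g: "g \<in> GL n" "initial_ideal n (mat_act n g ` I) = gin n I"
      using gin_generic[OF I above] by metis
    obtain b where b: "b \<in> GL n" "b * g = 1\<^sub>m n"
      using GL_inverse[OF g(1)] by metis
    have bg: "mat_act n b ` mat_act n g ` I = I"
      using mat_act_inverse[OF b(2,1) g(1)] ideal_poly_ringD(1)[OF I] by (simp add: image_image)
    have "mult_bijective n I (mat_act n b (last_var n)) i (t - 2 * i)" if i: "i \<le> t div 2" for i
    proof -
      have "mult_bijective n (mat_act n g ` I) (last_var n) i (t - 2 * i)"
        using bij i unfolding gin[OF g] last_var_iff[OF g(1)] by blast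
      from mult_bijective_mat_act[OF gI[OF g(1)] b(1) forms_in_mpolys[OF X] this]
      show ?thesis
        unfolding bg .
    qed
    then show "strong_stanley n I"
      unfolding strong_stanley_iff[OF I t] using mat_act_forms[OF X] by blast
  qed
qed

section \<open>Strings of standard monomials\<close>

lemma lookup_nth_list: "lookup (Poly_Mapping.nth xs) k = (if k < length xs then xs ! k else 0)"
  by (simp add: nth_default_def)

lemma nth_append_single:
  "Poly_Mapping.nth (xs @ [s]) = Poly_Mapping.nth xs + single (length xs) s"
  by (rule poly_mapping_eqI)
    (auto simp: lookup_nth_list lookup_add lookup_single nth_append when_def simp del: lookup_nth)

lemma keys_nth_list: "keys (Poly_Mapping.nth xs) \<subseteq> {..<length xs}"
  by (auto simp: in_keys_iff lookup_nth_list simp del: lookup_nth keys_nth split: if_splits)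

lemma monom_deg_nth: "monom_deg (Poly_Mapping.nth xs) = sum_list xs"
  by (induction xs rule: rev_induct) (simp_all add: nth_append_single monom_deg_add)

lemma monom_eq_nth_plus_last:
  fixes m :: "nat \<Rightarrow>\<^sub>0 nat"
  assumes "keys m \<subseteq> {..<n}" "0 < n"
  obtains \<alpha> where "length \<alpha> = n - 1"
    "m = Poly_Mapping.nth \<alpha> + single (n - 1) (lookup m (n - 1))"
proof
  show "m = Poly_Mapping.nth (map (lookup m) [0..<n - 1]) + single (n - 1) (lookup m (n - 1))"
  proof (rule poly_mapping_eqI)
    fix k
    have "lookup m k = 0" if "k \<ge> n"
      using assms that by (force simp: in_keys_iff)
    then show "lookup m k = lookup (Poly_Mapping.nth (map (lookup m) [0..<n - 1])
        + single (n - 1) (lookup m (n - 1))) k"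
      using assms(2)
      by (cases "k < n - 1"; cases "k = n - 1")
        (auto simp: lookup_add lookup_nth_list lookup_single_not_eq simp del: lookup_nth)
  qed
qed simp

text \<open>The monomials outside \<open>E\<close> fall into strings \<open>x\<^sup>\<alpha>, x\<^sup>\<alpha> x\<^sub>n, \<dots>\<close>, of length \<open>f\<^sub>n(\<alpha>)\<close> and starting
  in degree \<open>\<bar>\<alpha>\<bar>\<close>. Multiplication by \<open>x\<^sub>n\<close> moves along the strings, so bijectivity between the degrees \<open>i\<close>
  and \<open>t - i\<close> means that a string meets both of them or neither.\<close>

lemma last_var_bijective_iff_symmetric_strings:
  fixes E :: "(nat \<Rightarrow>\<^sub>0 nat) set"
  assumes n: "0 < n"
    and string: "\<And>\<alpha> s. length \<alpha> = n - 1 \<Longrightarrow>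
      Poly_Mapping.nth \<alpha> + single (n - 1) s \<in> E \<longleftrightarrow> f \<alpha> \<le> s"
    and top: "\<And>m. keys m \<subseteq> {..<n} \<Longrightarrow> m \<notin> E \<Longrightarrow> monom_deg m \<le> t"
  shows "(\<forall>i\<le>t div 2. last_var_bijective n E i (t - 2 * i)) \<longleftrightarrow>
    (\<forall>\<alpha>. length \<alpha> = n - 1 \<and> Poly_Mapping.nth \<alpha> \<notin> E \<longrightarrow>
      int (f \<alpha>) = int t - 2 * int (sum_list \<alpha>) + 1)"
    (is "?bij \<longleftrightarrow> ?sym")
proof
  define x where "x \<alpha> s = Poly_Mapping.nth \<alpha> + single (n - 1) s" for \<alpha> :: "nat list" and s
  have x_deg: "x \<alpha> s \<in> monoms n (sum_list \<alpha> + s)" if "length \<alpha> = n - 1" for \<alpha> s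
    using keys_nth_list[of \<alpha>] that n
    by (fastforce simp: x_def monoms_def monom_deg_add monom_deg_nth keys_add_nat simp del: keys_nth)
  have x_last: "lookup (x \<alpha> s) (n - 1) = s" if "length \<alpha> = n - 1" for \<alpha> s
    using that by (simp add: x_def lookup_add lookup_nth_list del: lookup_nth)
  have x_in: "x \<alpha> s \<in> E \<longleftrightarrow> f \<alpha> \<le> s" if "length \<alpha> = n - 1" for \<alpha> s
    unfolding x_def by (rule string[OF that])
  have x_0: "x \<alpha> 0 = Poly_Mapping.nth \<alpha>" for \<alpha>
    by (simp add: x_def)
  have x_add: "x \<alpha> s + single (n - 1) r = x \<alpha> (s + r)" for \<alpha> s r
    by (simp add: x_def single_add algebra_simps)
  {
    assume bij: ?bij
    have inj: "m \<in> E" if "m \<in> monoms n i" "m + single (n - 1) (t - 2 * i) \<in> E" "i \<le> t div 2" for m i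
      using bij that unfolding last_var_bijective_def by blast
    have surj: "t - 2 * i \<le> lookup m (n - 1)" if "m \<in> monoms n (t - i)" "m \<notin> E" "i \<le> t div 2" for m i
    proof -
      have "i + (t - 2 * i) = t - i"
        using that(3) by linarith
      then show ?thesis
        using bij that unfolding last_var_bijective_def by auto
    qed
    show ?sym
    proof (intro allI impI, elim conjE)
      fix \<alpha> assume \<alpha>: "length \<alpha> = n - 1" "Poly_Mapping.nth \<alpha> \<notin> E"
      let ?c = "sum_list \<alpha>"
      have pos: "0 < f \<alpha>"
        using x_in[OF \<alpha>(1), of 0] \<alpha>(2) by (simp add: x_0)
      have deg: "?c + s \<le> t" if "s < f \<alpha>" for s
        using top[of "x \<alpha> s"] x_deg[OF \<alpha>(1), of s] x_in[OF \<alpha>(1), of s] that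
        by (auto simp: monoms_def)
      show "int (f \<alpha>) = int t - 2 * int ?c + 1"
      \<comment> \<open>A string starting at or below the middle must reach at least the mirror image of its first degree,
        by injectivity, and cannot go beyond, by surjectivity.\<close>
      proof (cases "2 * ?c \<le> t")
        case True
        have "\<not> f \<alpha> \<le> t - 2 * ?c"
        proof
          assume "f \<alpha> \<le> t - 2 * ?c"
          then have "x \<alpha> 0 + single (n - 1) (t - 2 * ?c) \<in> E"
            unfolding x_add x_in[OF \<alpha>(1)] by simp
          then have "x \<alpha> 0 \<in> E"
            by (rule inj[rotated]) (use True x_deg[OF \<alpha>(1), of 0] in auto)
          then show False
            using \<alpha>(2) by (simp add: x_0)
        qed
        moreover have "\<not> f \<alpha> > t - 2 * ?c + 1"
        proof
          assume long: "f \<alpha> > t - 2 * ?c + 1"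
          define i where "i = t - (?c + (f \<alpha> - 1))"
          have i: "?c + (f \<alpha> - 1) = t - i" "i \<le> t div 2"
            using long True deg[of "f \<alpha> - 1"] pos by (auto simp: i_def)
          have "x \<alpha> (f \<alpha> - 1) \<in> monoms n (t - i)" "x \<alpha> (f \<alpha> - 1) \<notin> E"
            using x_deg[OF \<alpha>(1), of "f \<alpha> - 1"] x_in[OF \<alpha>(1)] pos i(1) by auto
          from surj[OF this i(2)] have "t - 2 * i \<le> f \<alpha> - 1"
            unfolding x_last[OF \<alpha>(1)] .
          then show False
            using i long True by linarith
        qed
        ultimately show ?thesis
          using True by linarith
      next
        \<comment> \<open>A string cannot start above the middle: its first monomial is not divisible by \<open>x\<^sub>n\<close>, contrary to
          surjectivity.\<close>
        case False
        have "?c \<le> t"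
          using deg[of 0] pos by simp
        then have "x \<alpha> 0 \<in> monoms n (t - (t - ?c))"
          using x_deg[OF \<alpha>(1), of 0] by simp
        moreover have "x \<alpha> 0 \<notin> E"
          using \<alpha>(2) by (simp add: x_0)
        ultimately have "t - 2 * (t - ?c) \<le> lookup (x \<alpha> 0) (n - 1)"
          by (rule surj) (use False in linarith)
        then show ?thesis
          using False \<open>?c \<le> t\<close> unfolding x_last[OF \<alpha>(1)] by linarith
      qed
    qed
  }
  assume sym: ?sym
  have standard: "\<exists>\<alpha> e. length \<alpha> = n - 1 \<and> m = x \<alpha> e \<and> lookup m (n - 1) = e \<and> e < f \<alpha> \<and>
      d = sum_list \<alpha> + e \<and> int (f \<alpha>) = int t - 2 * int (sum_list \<alpha>) + 1"
    if m: "m \<in> monoms n d" "m \<notin> E" for m d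
  proof -
    obtain \<alpha> where \<alpha>: "length \<alpha> = n - 1" "m = x \<alpha> (lookup m (n - 1))"
      using monom_eq_nth_plus_last[of m n] m(1) n by (auto simp: monoms_def x_def)
    have less: "lookup m (n - 1) < f \<alpha>"
      using m(2) x_in[OF \<alpha>(1), of "lookup m (n - 1)"] \<alpha>(2) by simp
    then have "Poly_Mapping.nth \<alpha> \<notin> E"
      using x_in[OF \<alpha>(1), of 0] by (simp add: x_0)
    moreover have "d = sum_list \<alpha> + lookup m (n - 1)"
      using m(1) x_deg[OF \<alpha>(1), of "lookup m (n - 1)"] \<alpha>(2) by (simp add: monoms_def)
    ultimately show ?thesis
      using \<alpha> less sym by blast
  qed
  show ?bij
    unfolding last_var_bijective_def
  proof (intro allI impI conjI ballI)
    fix i m assume i: "i \<le> t div 2" and m: "m \<in> monoms n i" "m + single (n - 1) (t - 2 * i) \<in> E"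
    show "m \<in> E"
    proof (rule ccontr)
      assume "m \<notin> E"
      from standard[OF m(1) this] obtain \<alpha> e where \<alpha>: "length \<alpha> = n - 1" "m = x \<alpha> e"
        "i = sum_list \<alpha> + e" "int (f \<alpha>) = int t - 2 * int (sum_list \<alpha>) + 1"
        by blast
      have "f \<alpha> \<le> e + (t - 2 * i)"
        using m(2) unfolding \<alpha>(2) x_add x_in[OF \<alpha>(1)] .
      then show False
        using \<alpha>(3,4) i by linarith
    qed
  next
    fix i m assume i: "i \<le> t div 2" and m: "m \<in> monoms n (i + (t - 2 * i))" "m \<notin> E"
    from standard[OF m] obtain \<alpha> e where "lookup m (n - 1) = e" "e < f \<alpha>"
      "i + (t - 2 * i) = sum_list \<alpha> + e" "int (f \<alpha>) = int t - 2 * int (sum_list \<alpha>) + 1"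
      by blast
    then show "t - 2 * i \<le> lookup m (n - 1)"
      using i by linarith
  qed
qed

theorem theorem3p10:
  fixes I :: "(nat, 'k::field_char_0) mpoly set" and n t :: nat
  assumes "n \<ge> 2"
    and "homogeneous_ideal n I"
    and "I \<noteq> carrier (poly_ring n)"
    and "artinian (quot_alg n I)"
    and "t = top_degree n I"
  shows "strong_stanley n I \<longleftrightarrow>
    (\<forall>\<alpha>\<in>gin_index_set n I (n - 1).
       int (gin_min_exp n I \<alpha>) = int t - 2 * int (sum_list \<alpha>) + 1)"
proof -
  have I: "ideal I (poly_ring n)"
    using assms(2) unfolding homogeneous_ideal_def by blast
  have above: "\<And>d. d > t \<Longrightarrow> forms n d \<subseteq> I"
    using forms_above_top_degree[OF assms(2,4)] assms(5) by blast
  obtain g where g: "g \<in> GL n" "initial_ideal n (mat_act n g ` I) = gin n I"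
    using gin_generic[OF I above] by metis
  define E where "E = {m. monomial m \<in> gin n I}"
  let ?f = "gin_min_exp n I"
  note gI = ideal_mat_act[OF I g(1)]
  have E: "E = lead_monoms (mat_act n g ` I)"
    unfolding E_def g(2)[symmetric] by (simp add: monomial_in_initial_ideal_iff[OF gI])
  have up: "m + k \<in> E" if "m \<in> E" "keys k \<subseteq> {..<n}" for m k
    using lead_monoms_upward_closed[OF gI, of m k] that by (simp add: E add.commute)
  have high: "m \<in> E" if "keys m \<subseteq> {..<n}" "monom_deg m > t" for m
    unfolding E by (rule lead_monoms_contain_high_degrees[OF I g(1) above[OF that(2)]])
      (use that in \<open>simp add: monoms_def\<close>)
  \<comment> \<open>The minimum exists because all monomials of degree above \<open>t\<close> lie in \<open>E\<close>.\<close>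
  have f: "Poly_Mapping.nth (\<alpha> @ [s]) \<in> E \<longleftrightarrow> ?f \<alpha> \<le> s" if "length \<alpha> < n" for \<alpha> s
  proof
    assume "Poly_Mapping.nth (\<alpha> @ [s]) \<in> E"
    then show "?f \<alpha> \<le> s"
      unfolding gin_min_exp_def E_def by (auto intro: Least_le)
  next
    assume le: "?f \<alpha> \<le> s"
    have "Poly_Mapping.nth (\<alpha> @ [t + 1]) \<in> E"
    proof (rule high)
      show "keys (Poly_Mapping.nth (\<alpha> @ [t + 1])) \<subseteq> {..<n}"
        using keys_nth_list[of "\<alpha> @ [t + 1]"] that by (auto simp del: keys_nth)
    qed (simp add: monom_deg_nth)
    then have "Poly_Mapping.nth (\<alpha> @ [?f \<alpha>]) \<in> E"
      unfolding gin_min_exp_def E_def mem_Collect_eq by (rule LeastI)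
    then have "Poly_Mapping.nth (\<alpha> @ [?f \<alpha>]) + single (length \<alpha>) (s - ?f \<alpha>) \<in> E"
      by (rule up) (use that in auto)
    then show "Poly_Mapping.nth (\<alpha> @ [s]) \<in> E"
      using le by (simp add: nth_append_single add.assoc single_add[symmetric])
  qed
  \<comment> \<open>The last of the inequalities defining the index set already says that \<open>x\<^sup>\<alpha>\<close> is not in \<open>E\<close>; the
    others follow as \<open>E\<close> contains the multiples of its elements. There is a last one since \<open>n \<ge> 2\<close>.\<close>
  have index: "\<alpha> \<in> gin_index_set n I (n - 1) \<longleftrightarrow> length \<alpha> = n - 1 \<and> Poly_Mapping.nth \<alpha> \<notin> E" for \<alpha>
  proof (cases "length \<alpha> = n - 1")
    case len: True
    have "(\<forall>j<n - 1. \<alpha> ! j < ?f (take j \<alpha>)) \<longleftrightarrow> Poly_Mapping.nth \<alpha> \<notin> E"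
    proof
      assume *: "\<forall>j<n - 1. \<alpha> ! j < ?f (take j \<alpha>)"
      have "\<not> ?f (take (n - 2) \<alpha>) \<le> \<alpha> ! (n - 2)"
        using * assms(1) by (simp add: not_le)
      moreover have "take (n - 2) \<alpha> @ [\<alpha> ! (n - 2)] = \<alpha>"
        using take_Suc_conv_app_nth[of "n - 2" \<alpha>] len assms(1) by (simp add: Suc_diff_le)
      ultimately show "Poly_Mapping.nth \<alpha> \<notin> E"
        using f[of "take (n - 2) \<alpha>" "\<alpha> ! (n - 2)"] len assms(1) by simp
    next
      assume *: "Poly_Mapping.nth \<alpha> \<notin> E"
      show "\<forall>j<n - 1. \<alpha> ! j < ?f (take j \<alpha>)"
      proof (intro allI impI, rule ccontr)
        fix j assume j: "j < n - 1" "\<not> \<alpha> ! j < ?f (take j \<alpha>)"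
        then have "Poly_Mapping.nth (take j \<alpha> @ [\<alpha> ! j]) \<in> E"
          using f[of "take j \<alpha>" "\<alpha> ! j"] len by simp
        then have in_E: "Poly_Mapping.nth (take (Suc j) \<alpha>) \<in> E"
          using j len by (simp add: take_Suc_conv_app_nth)
        have "lookup (Poly_Mapping.nth (take (Suc j) \<alpha>)) k \<le> lookup (Poly_Mapping.nth \<alpha>) k" for k
          by (simp add: lookup_nth_list del: lookup_nth)
        then obtain l where l: "Poly_Mapping.nth \<alpha> = l + Poly_Mapping.nth (take (Suc j) \<alpha>)"
          using monom_split_nat by metis
        have "keys l \<subseteq> keys (Poly_Mapping.nth \<alpha>)"
          unfolding l keys_add_nat by blast
        also have "\<dots> \<subseteq> {..<n}"
          using keys_nth_list[of \<alpha>] len by (auto simp del: keys_nth)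
        finally have "Poly_Mapping.nth \<alpha> \<in> E"
          using up[OF in_E] l by (simp add: add.commute)
        then show False
          using * by simp
      qed
    qed
    then show ?thesis
      using len by (simp add: gin_index_set_def)
  qed (simp add: gin_index_set_def)
  have "strong_stanley n I \<longleftrightarrow> (\<forall>i\<le>t div 2. last_var_bijective n E i (t - 2 * i))"
    unfolding E_def by (rule strong_stanley_iff_gin[OF assms(2-5)]) (use assms(1) in simp)
  also have "\<dots> \<longleftrightarrow> (\<forall>\<alpha>. length \<alpha> = n - 1 \<and> Poly_Mapping.nth \<alpha> \<notin> E \<longrightarrow>
      int (?f \<alpha>) = int t - 2 * int (sum_list \<alpha>) + 1)"
  proof (rule last_var_bijective_iff_symmetric_strings)
    show "0 < n"
      using assms(1) by simp
    show "Poly_Mapping.nth \<alpha> + single (n - 1) s \<in> E \<longleftrightarrow> ?f \<alpha> \<le> s" if "length \<alpha> = n - 1" for \<alpha> s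
      using f[of \<alpha> s] that assms(1) by (simp add: nth_append_single)
    show "monom_deg m \<le> t" if "keys m \<subseteq> {..<n}" "m \<notin> E" for m
      using high[OF that(1)] that(2) by (meson not_le)
  qed
  finally show ?thesis
    unfolding Ball_def index .
qed

end
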